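(* Let $\mathfrak{k}$ be a simple Hilbert--Lie algebra (infinite-dimensional) and let $\varphi\in\mathrm{Aut}(\mathfrak{k})$ be of finite order $N$. Let $\psi\in\mathrm{Aut}(\mathfrak{k})$ (the identity or standard, of order $N_\psi\in\{1,2\}$), $(\phi_t)_{t\in\mathbb{R}}$, $\mathfrak{t}$, $\mathfrak{t}_0=\mathfrak{t}^\varphi=\mathfrak{t}^\psi$ and $\mu\in i\mathfrak{t}_0^*$ be untwisting data for $(\mathfrak{k},\varphi)$ (as defined in the context), and let $\mathfrak{t}_0^e=\mathbb{R}\oplus\mathfrak{t}_0\oplus\mathbb{R}$. Denote by $\widehat{\mathcal{W}}_{\psi}\subseteq\mathrm{GL}(i(\mathfrak{t}_0^e)^* )$ and $\widehat{\Delta}_{\psi}\subseteq i(\mathfrak{t}_0^e)^*$ the Weyl group and root system of the standard affinisation $\widehat{\mathcal{L}}_{\psi}(\mathfrak{k})=\widehat{\mathcal{L}}^{0}_{\psi}(\mathfrak{k})$ with respect to $\mathfrak{t}_0^e$. Let $\nu,\nu'\in i\mathfrak{t}_0^*$ and let $\lambda\in i(\mathfrak{t}_0^e)^*$ be an integral weight of $\widehat{\mathcal{L}}^{\nu}_{\varphi}(\mathfrak{k})$ with $\lambda(\mathbf{c})\neq0$. Then the following assertions are equivalent: (i) The highest weight representation $\widetilde{\rho}_{\lambda}\colon \widehat{\mathcal{L}}_{\varphi}^{\nu}(\mathfrak{k})\rtimes \mathbb{R} D_{\nu'}\to \mathrm{End}(L_{\nu}(\lambda))$ is of positive energy. (ii)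 $M_{\mu,\nu,\nu'}:=\inf \chi(\widehat{\mathcal{W}}_{\psi}.\lambda_{\mu+\nu}-\lambda_{\mu+\nu})>-\infty$, where $$\lambda_{\mu+\nu}:=\lambda-\lambda(\mathbf{c})(\mu+\nu)\in i(\mathfrak{t}_0^e)^*\quad\text{and}\quad\chi\colon\mathbb{Z}[\widehat{\Delta}_{\psi}]\to\mathbb{R},\ (\alpha,n)\mapsto (\mu+\nu')(\alpha^{\sharp})+n/N_{\psi}.$$ Moreover, if $M_{\mu,\nu,\nu'}>-\infty$, then $M_{\mu,\nu,\nu'}$ is the minimal energy level of $\widetilde{\rho}_{\lambda}$.
   Context: **Hilbert--Lie algebras.** A Hilbert--Lie algebra $\mathfrak{k}$ is a real Lie algebra that is also a real Hilbert space with $\langle [x,y],z\rangle=\langle x,[y,z]\rangle$. By Schue's theorem the infinite-dimensional simple ones are exactly (up to isomorphism) $\mathfrak{u}_2(\mathcal{H}_{\mathbb{K}})$, the skew-symmetric Hilbert--Schmidt operators on an infinite-dimensional Hilbert space over $\mathbb{K}\in\{\mathbb{R},\mathbb{C},\mathbb{H}\}$. $\langle\cdot,\cdot\rangle$ also denotes the hermitian extension to $\mathfrak{k}_{\mathbb{C}}$ (linear in the first argument). For $\varphi\in\mathrm{Aut}(\mathfrak{k})$: $\mathfrak{k}^\varphi=\{x:\varphi(x)=x\}$, $\mathfrak{t}^\varphi=\mathfrak{t}\cap\mathfrak{k}^\varphi$. **Weights.** Let $\varphi$ have order $N$ and $\mathfrak{t}_0=\mathfrak{t}^\varphi$ be maximal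 abelian in $\mathfrak{k}^\varphi$. $i\mathfrak{t}_0^*$ (resp. $i(\mathfrak{t}_0^e)^*$) is the space of complex linear functionals on $(\mathfrak{t}_0)_{\mathbb{C}}$ (resp. $(\mathfrak{t}_0^e)_{\mathbb{C}}$) that are real on $i\mathfrak{t}_0$ (resp. $i\mathfrak{t}_0^e$). Let $\mathfrak{k}_{\mathbb{C}}^\alpha=\{x: [h,x]=\alpha(h)x\ \forall h\in\mathfrak{t}_0\}$, $\Delta_\varphi=\{\alpha\in i\mathfrak{t}_0^*\setminus\{0\}:\mathfrak{k}_{\mathbb{C}}^\alpha\neq 0\}$; $\alpha^\sharp\in i\mathfrak{t}_0$ is given by $\langle h,\alpha^\sharp\rangle=\alpha(h)$ ($h\in\mathfrak{t}_0$); $0^\sharp=0$; $(\alpha,\beta)=\langle\alpha^\sharp,\beta^\sharp\rangle$; $\check\alpha=\frac{2}{(\alpha,\alpha)}\alpha^\sharp$; $\mathfrak{k}_{\mathbb{C}}^{(\alpha,n)}=\{x\in\mathfrak{k}_{\mathbb{C}}^\alpha:\varphi^{-1}(x)=e^{2\pi i n/N}x\}$. **Affinisations.** $\mathcal{L}_\varphi(\mathfrak{k})=\{\xi\in C^\infty(\mathbb{R},\mathfrak{k}):\xi(t+2\pi)=\varphi^{-1}(\xi(t))\}$ with pointwise bracket and $\langle\xi,\eta\rangle=\frac1{2\pi}\int_0^{2\pi}\langle\xi(t),\eta(t)\rangle dt$. For $\nu\in i\mathfrak{t}_0^*$, $\overline{D}_\nu$ acts on $\mathfrak{k}_{\mathbb{C}}^\alpha$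 by $i\nu(\alpha^\sharp)$ ($\alpha\in\Delta_\varphi$), by $0$ on $\mathfrak{k}^0_{\mathbb{C}}$, and pointwise on loops; $D_\nu\xi=\xi'+\overline{D}_\nu\xi$; $\omega_{D_\nu}(\xi,\eta)=\langle D_\nu\xi,\eta\rangle$. (If $\{\nu(\alpha^\sharp)\}$ is unbounded, replace $\mathcal{L}_\varphi(\mathfrak{k})$ by the subalgebra of those $\xi$ for which $t\mapsto\overline{D}_\nu^k\xi(t)$ is defined and smooth for all $k\geq0$.) $\mathfrak{g}_\nu:=\widehat{\mathcal{L}}^\nu_\varphi(\mathfrak{k})=\mathbb{R}\oplus\mathcal{L}_\varphi(\mathfrak{k})\oplus\mathbb{R}$ has bracket $$[(z_1,x_1,t_1),(z_2,x_2,t_2)]=(\omega_{D_\nu}(x_1,x_2),[x_1,x_2]+t_1D_\nu x_2-t_2D_\nu x_1,0).$$ Its roots with respect to the maximal abelian subalgebra $\mathfrak{t}_0^e$ are identified with the pairs $(\alpha,n)\neq(0,0)$, $\alpha\in\Delta_\varphi\cup\{0\}$, $n\in\mathbb{Z}$, $\mathfrak{k}_{\mathbb{C}}^{(\alpha,n)}\ne0$, acting by $(\alpha,n)(z,h,t)=\alpha(h)+it(\frac nN+\nu(\alpha^\sharp))$, with root space $e^{int/N}\otimes\mathfrak{k}_{\mathbb{C}}^{(\alpha,n)}$. The compact roots (index $c$) are those with $\alpha\neq0$; with the form $((\alpha,m),(\beta,n))=(\alpha,\beta)$ they form a locally affine root system (isomorphisms of such are bijections extending to $\mathbb{Q}$-linear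 isomorphisms of the $\mathbb{Q}$-spans respecting the forms). The coroot of a compact root is $(\alpha,n)^\vee=\Big(\frac{-2i(\frac nN+\nu(\alpha^\sharp))}{(\alpha,\alpha)},\check\alpha,0\Big)$. The Weyl group is generated by the reflections $v\mapsto v-(\alpha,n)(v)(\alpha,n)^\vee$ of $\mathfrak{t}_0^e$ for compact roots; it acts on $i(\mathfrak{t}_0^e)^*$ by $(w.\lambda)(v)=\lambda(w^{-1}v)$. The same applies to $\psi$ in place of $\varphi$ (with $N_\psi$ in place of $N$). $\mathbb{Z}[\cdot]$ denotes the $\mathbb{Z}$-span; $\chi$ is the group homomorphism with the given values on roots. Put $\mathbf{c}=(i,0,0)$, $\mathbf{d}=(0,0,-i)\in i\mathfrak{t}_0^e$; identify $i\mathfrak{t}_0^*$ with $\{\mu\in i(\mathfrak{t}_0^e)^*:\mu(\mathbf{c})=\mu(\mathbf{d})=0\}$. **Standard automorphisms** (order 2) of $\mathfrak{u}_2(\mathcal{H}_{\mathbb{K}})$, up to unitary identification: ($\mathbb{K}=\mathbb{R}$) conjugation by the reflection in a hyperplane; ($\mathbb{K}=\mathbb{C}$, $\mathcal{H}=\mathcal{H}_0\oplus\mathcal{H}_0$) conjugation by $\theta(v,w)=(\sigma_0w,-\sigma_0v)$; ($\mathbb{K}=\mathbb{C}$, $\mathcal{H}=\mathcal{H}_0\oplus\mathbb{C}\oplus\mathcal{H}_0$) conjugation by $\theta(v,c,w)=(\sigma_0w,\overline c,\sigma_0v)$, where $\sigma_0$ is a complex conjugation on $\mathcal{H}_0$.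 **Untwisting data** for $(\mathfrak{k},\varphi)$: $\psi\in\mathrm{Aut}(\mathfrak{k})$ the identity or standard; a smooth one-parameter group $(\phi_t)$ of automorphisms of $\mathfrak{k}$ commuting with $\varphi$ with $\varphi=\phi_1\psi$; a maximal abelian subalgebra $\mathfrak{t}\subseteq\mathfrak{k}$ with $\mathfrak{t}^\varphi=\mathfrak{t}^\psi=:\mathfrak{t}_0$ maximal abelian in both $\mathfrak{k}^\varphi$ and $\mathfrak{k}^\psi$; and $\mu\in i\mathfrak{t}_0^*$; such that for every $\nu\in i\mathfrak{t}_0^*$: (a) $(z_1,\xi(t),z_2)\mapsto(z_1,\phi_{t/2\pi}(\xi(t)),z_2)$ is a Lie algebra isomorphism $\widehat{\mathcal{L}}^\nu_\varphi(\mathfrak{k})\to\widehat{\mathcal{L}}^{\mu+\nu}_\psi(\mathfrak{k})$ fixing $\mathfrak{t}_0^e$ pointwise; (b) it induces the isomorphism of compact root systems $(\alpha,n)\mapsto(\alpha,N_\psi(\frac nN-\mu(\alpha^\sharp)))$; (c) the Weyl groups of $\widehat{\mathcal{L}}^\nu_\varphi(\mathfrak{k})$ and $\widehat{\mathcal{L}}^{\mu+\nu}_\psi(\mathfrak{k})$ with respect to $\mathfrak{t}_0^e$ coincide. (Such data always exist.) **Highest weight representations.** $\lambda\in i(\mathfrak{t}_0^e)^*$ is integral for $\mathfrak{g}_\nu$ if $\lambda((\alpha,n)^\vee)\in\mathbb{Z}$ for all compact roots. If also $\lambda(\mathbf{c})\neq0$, a theorem of Neeb gives an irreducible integrable highest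 weight module $L_\nu(\lambda)$ of highest weight $\lambda$ with highest weight vector $v_\lambda$. Here modules are modules over the subalgebra of $(\mathfrak{g}_\nu)_{\mathbb{C}}$ generated by $(\mathfrak{t}_0^e)_{\mathbb{C}}$ and the root spaces of compact roots; integrable means that $(\mathfrak{t}_0^e)_{\mathbb{C}}$ acts diagonalisably and vectors in compact root spaces act locally nilpotently; highest weight module of highest weight $\lambda$ means generated by a vector $v_\lambda\ne0$ of weight $\lambda$ annihilated by the root spaces of all roots in some positive system $\Delta^+$ (all roots are the disjoint union of $\Delta^+$ and $-\Delta^+$, and no nontrivial $\mathbb{N}_0$-combination of $\Delta^+$ vanishes). By the same theorem, the set of weights of $L_\nu(\lambda)$ is $\mathcal{P}_\lambda=\mathrm{conv}(\widehat{\mathcal{W}}.\lambda)\cap(\lambda+\mathbb{Z}[\widehat\Delta])$, where $\widehat{\mathcal{W}}$ and $\widehat\Delta$ are the Weyl group and the root set of $(\mathfrak{g}_\nu,\mathfrak{t}_0^e)$. For $\nu'\in i\mathfrak{t}_0^*$, extend $D_{\nu'}$ to a derivation of $\mathfrak{g}_\nu$ by $D_{\nu'}(\mathfrak{t}_0^e)=0$; it acts on the root space of $(\alpha,n)$ by $i(\frac nN+\nu'(\alpha^\sharp))$. The representation $\rho_\lambda$ on $L_\nu(\lambda)$ extends to a representation $\widetilde\rho_\lambda$ of the semidirect product with $\mathbb{R}D_{\nu'}$ with $\widetilde\rho_\lambda(D_{\nu'})v_\lambda=0$; explicitly $\widetilde\rho_\lambda(D_{\nu'})$ acts on the weight space of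 weight $\gamma\in\mathcal{P}_\lambda$ by $i\chi'(\gamma-\lambda)$, where $\chi'\colon\mathbb{Z}[\widehat\Delta]\to\mathbb{R}$ is the homomorphism with $\chi'((\alpha,n))=\frac nN+\nu'(\alpha^\sharp)$. $\widetilde\rho_\lambda$ is of positive energy if the spectrum (set of eigenvalues) of $H_{\nu'}=-i\widetilde\rho_\lambda(D_{\nu'})$ is bounded below; the infimum of this spectrum is then the minimal energy level. *)

theory Defs
  imports "HOL-Analysis.Analysis" "HOL-Library.Function_Algebras"
begin

text \<open>Pointwise real vector space structure on functions; it is used for spaces of loops, of
  operators and of linear functionals.\<close>

instantiation "fun" :: (type, real_vector) real_vector
begin

definition scaleR_fun :: "real \<Rightarrow> ('a \<Rightarrow> 'b) \<Rightarrow> 'a \<Rightarrow> 'b" where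
  "scaleR_fun r f = (\<lambda>x. r *\<^sub>R f x)"

instance
  by standard (auto simp: scaleR_fun_def fun_eq_iff algebra_simps)

end


section \<open>Complexification\<close>

text \<open>The complexification of a real vector space \<open>'a\<close> is \<open>'a \<times> 'a\<close>, the pair \<open>(x, y)\<close> standing
  for \<open>x + i y\<close>. A real subspace \<open>T\<close> has complexification \<open>T \<times> T\<close>, and \<open>iT\<close> is \<open>{0} \<times> T\<close>.\<close>

definition cscale :: "complex \<Rightarrow> 'a::real_vector \<times> 'a \<Rightarrow> 'a \<times> 'a" where
  "cscale c x = (Re c *\<^sub>R fst x - Im c *\<^sub>R snd x, Re c *\<^sub>R snd x + Im c *\<^sub>R fst x)"

text \<open>Complex bilinear extension of a real bilinear bracket.\<close>

definition cbracket :: "('a \<Rightarrow> 'a \<Rightarrow> 'a::real_vector) \<Rightarrow> 'a \<times> 'a \<Rightarrow> 'a \<times> 'a \<Rightarrow> 'a \<times> 'a" where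
  "cbracket b x y = (b (fst x) (fst y) - b (snd x) (snd y), b (fst x) (snd y) + b (snd x) (fst y))"

text \<open>Hermitian extension of the inner product, linear in the first argument.\<close>

definition cinner :: "'a::real_inner \<times> 'a \<Rightarrow> 'a \<times> 'a \<Rightarrow> complex" where
  "cinner x y = Complex (inner (fst x) (fst y) + inner (snd x) (snd y))
                        (inner (snd x) (fst y) - inner (fst x) (snd y))"

text \<open>Complex linear functionals on \<open>T \<times> T\<close>, extended by \<open>0\<close> to the whole type so that
  equality, sums and spans of functionals are those of functions on the type.\<close>

definition cdual :: "'a::real_vector set \<Rightarrow> ('a \<times> 'a \<Rightarrow> complex) set" where
  "cdual T = {f. (\<forall>v. v \<notin> T \<times> T \<longrightarrow> f v = 0) \<and>
                 (\<forall>u \<in> T \<times> T. \<forall>v \<in> T \<times> T. f (u + v) = f u + f v) \<and>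
                 (\<forall>c. \<forall>v \<in> T \<times> T. f (cscale c v) = c * f v)}"

definition im_dual :: "'a::real_vector set \<Rightarrow> ('a \<times> 'a \<Rightarrow> complex) set" where
  "im_dual T = {f \<in> cdual T. \<forall>h \<in> T. f (0, h) \<in> \<real>}"

abbreviation int_span :: "'a::real_vector set \<Rightarrow> 'a set" where
  "int_span \<equiv> module.span (\<lambda>n::int. scaleR (of_int n))"

abbreviation rat_span :: "'a::real_vector set \<Rightarrow> 'a set" where
  "rat_span \<equiv> module.span (\<lambda>q::rat. scaleR (of_rat q))"


section \<open>Hilbert--Lie algebras\<close>

class hilbert_lie = real_inner + complete_space +
  fixes lie :: "'a \<Rightarrow> 'a \<Rightarrow> 'a"
  assumes lie_add_left: "lie (x + y) z = lie x z + lie y z"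
    and lie_scaleR_left: "lie (scaleR r x) z = scaleR r (lie x z)"
    and lie_add_right: "lie z (x + y) = lie z x + lie z y"
    and lie_scaleR_right: "lie z (scaleR r x) = scaleR r (lie z x)"
    and lie_self: "lie x x = 0"
    and lie_jacobi: "lie x (lie y z) + lie y (lie z x) + lie z (lie x y) = 0"
    and lie_invariant: "inner (lie x y) z = inner x (lie y z)"

text \<open>Simplicity refers to closed ideals: the finite rank operators, for instance, form a proper
  non-closed ideal of the skew Hilbert--Schmidt operators.\<close>

definition simple_hilbert_lie :: "'k::hilbert_lie itself \<Rightarrow> bool" where
  "simple_hilbert_lie _ \<longleftrightarrow>
     (\<exists>x y::'k. lie x y \<noteq> 0) \<and>
     (\<forall>I::'k set. closed I \<and> subspace I \<and> (\<forall>x. \<forall>y \<in> I. lie x y \<in> I) \<longrightarrow> I = {0} \<or> I = UNIV)"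

definition infinite_dimensional :: "'a::real_vector itself \<Rightarrow> bool" where
  "infinite_dimensional _ \<longleftrightarrow> (\<nexists>B::'a set. finite B \<and> span B = UNIV)"

text \<open>Automorphisms preserve both the Lie bracket and the Hilbert space structure.\<close>

definition hl_aut :: "('k::hilbert_lie \<Rightarrow> 'k) \<Rightarrow> bool" where
  "hl_aut \<phi> \<longleftrightarrow> linear \<phi> \<and> bij \<phi> \<and> (\<forall>x y. \<phi> (lie x y) = lie (\<phi> x) (\<phi> y)) \<and>
               (\<forall>x y. inner (\<phi> x) (\<phi> y) = inner x y)"

definition has_order :: "('a \<Rightarrow> 'a) \<Rightarrow> nat \<Rightarrow> bool" where
  "has_order \<phi> N \<longleftrightarrow> N > 0 \<and> \<phi> ^^ N = id \<and> (\<forall>m. 0 < m \<and> m < N \<longrightarrow> \<phi> ^^ m \<noteq> id)"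

definition fixed_points :: "('a \<Rightarrow> 'a) \<Rightarrow> 'a set" where
  "fixed_points \<phi> = {x. \<phi> x = x}"

definition abelian_subalgebra :: "'k::hilbert_lie set \<Rightarrow> bool" where
  "abelian_subalgebra T \<longleftrightarrow> subspace T \<and> (\<forall>x \<in> T. \<forall>y \<in> T. lie x y = 0)"

definition maximal_abelian_in :: "'k::hilbert_lie set \<Rightarrow> 'k set \<Rightarrow> bool" where
  "maximal_abelian_in K T \<longleftrightarrow> abelian_subalgebra T \<and> T \<subseteq> K \<and>
     (\<forall>S. abelian_subalgebra S \<and> S \<subseteq> K \<and> T \<subseteq> S \<longrightarrow> S = T)"

definition smooth_curve :: "(real \<Rightarrow> 'a::real_normed_vector) \<Rightarrow> bool" where
  "smooth_curve \<xi> \<longleftrightarrow>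
     (\<exists>D. D 0 = \<xi> \<and> (\<forall>n t. (D n has_vector_derivative D (Suc n) t) (at t)))"


section \<open>Standard automorphisms\<close>

text \<open>Operators on a real Hilbert space \<open>'e\<close>; a complex Hilbert space is a real one together with
  its multiplication \<open>J\<close> by \<open>i\<close>. For a complex linear operator, skew-adjointness and the
  Hilbert--Schmidt property do not depend on whether the real or the complex structure is used.\<close>

definition orthonormal_basis :: "'e::real_inner set \<Rightarrow> bool" where
  "orthonormal_basis B \<longleftrightarrow> (\<forall>e \<in> B. norm e = 1) \<and>
     (\<forall>e \<in> B. \<forall>f \<in> B. e \<noteq> f \<longrightarrow> inner e f = 0) \<and> closure (span B) = UNIV"

definition hilbert_schmidt :: "('e::real_inner \<Rightarrow> 'e) \<Rightarrow> bool" where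
  "hilbert_schmidt A \<longleftrightarrow> bounded_linear A \<and>
     (\<exists>B. orthonormal_basis B \<and> (\<lambda>e. (norm (A e))\<^sup>2) summable_on B)"

definition u2_real :: "('e::real_inner \<Rightarrow> 'e) set" where
  "u2_real = {A. hilbert_schmidt A \<and> (\<forall>v w. inner (A v) w = - inner v (A w))}"

definition u2_complex :: "('e::real_inner \<Rightarrow> 'e) \<Rightarrow> ('e \<Rightarrow> 'e) set" where
  "u2_complex J = {A \<in> u2_real. A \<circ> J = J \<circ> A}"

text \<open>\<open>\<psi>\<close> corresponds to conjugation by \<open>\<theta>\<close> under an isomorphism of \<open>'k\<close> with the operator Lie
  algebra \<open>U\<close>. The invariant inner product is determined by the Lie algebra only up to a positive
  factor, hence the constant \<open>C\<close>.\<close>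

definition modelled_by ::
  "('k::hilbert_lie \<Rightarrow> 'k) \<Rightarrow> ('e::real_inner \<Rightarrow> 'e) set \<Rightarrow> ('e \<Rightarrow> 'e) \<Rightarrow> bool" where
  "modelled_by \<psi> U \<theta> \<longleftrightarrow> (\<exists>\<Phi>::'k \<Rightarrow> 'e \<Rightarrow> 'e. linear \<Phi> \<and> bij_betw \<Phi> UNIV U \<and>
     (\<forall>x y. \<Phi> (lie x y) = \<Phi> x \<circ> \<Phi> y - \<Phi> y \<circ> \<Phi> x) \<and>
     (\<exists>C>0. \<exists>B. orthonormal_basis B \<and>
        (\<forall>x y. ((\<lambda>e. C * inner (\<Phi> x e) (\<Phi> y e)) has_sum inner x y) B)) \<and>
     (\<forall>x. \<Phi> (\<psi> x) = \<theta> \<circ> \<Phi> x \<circ> inv \<theta>))"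

text \<open>\<open>'h\<close> is the real Hilbert space \<open>H\<close> in the real case; in the complex cases
  \<open>H\<^sub>0\<close> is the complexification \<open>'h \<times> 'h\<close>, and \<open>'h\<close> is the real form fixed by \<open>\<sigma>\<^sub>0\<close>.\<close>

definition conj0 :: "'h::real_inner \<times> 'h \<Rightarrow> 'h \<times> 'h" where
  "conj0 v = (fst v, - snd v)"

definition standard_real :: "'h::{real_inner,complete_space} itself \<Rightarrow> ('k::hilbert_lie \<Rightarrow> 'k) \<Rightarrow> bool" where
  "standard_real (_::'h itself) \<psi> \<longleftrightarrow>
     (\<exists>e::'h. norm e = 1 \<and> modelled_by \<psi> u2_real (\<lambda>v. v - (2 * inner v e) *\<^sub>R e))"

definition standard_complex_even :: "'h::{real_inner,complete_space} itself \<Rightarrow> ('k::hilbert_lie \<Rightarrow> 'k) \<Rightarrow> bool" where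
  "standard_complex_even (_::'h itself) \<psi> \<longleftrightarrow>
     modelled_by \<psi>
       (u2_complex (\<lambda>(v::'h \<times> 'h, w::'h \<times> 'h). (cscale \<i> v, cscale \<i> w)))
       (\<lambda>(v, w). (conj0 w, - conj0 v))"

definition standard_complex_odd :: "'h::{real_inner,complete_space} itself \<Rightarrow> ('k::hilbert_lie \<Rightarrow> 'k) \<Rightarrow> bool" where
  "standard_complex_odd (_::'h itself) \<psi> \<longleftrightarrow>
     modelled_by \<psi>
       (u2_complex (\<lambda>(v::'h \<times> 'h, c::complex, w::'h \<times> 'h). (cscale \<i> v, \<i> * c, cscale \<i> w)))
       (\<lambda>(v, c, w). (conj0 w, cnj c, conj0 v))"

definition standard_aut :: "'h::{real_inner,complete_space} itself \<Rightarrow> ('k::hilbert_lie \<Rightarrow> 'k) \<Rightarrow> bool" where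
  "standard_aut H \<psi> \<longleftrightarrow>
     standard_real H \<psi> \<or> standard_complex_even H \<psi> \<or> standard_complex_odd H \<psi>"


section \<open>Weights\<close>

text \<open>In what follows \<open>T\<close> is the maximal abelian subalgebra \<open>\<tt>\<^sub>0\<close> of the fixed point algebra of
  \<open>\<phi>\<close>, and \<open>N\<close> is the order of \<open>\<phi>\<close>.\<close>

definition weight_space_k :: "'k::hilbert_lie set \<Rightarrow> ('k \<times> 'k \<Rightarrow> complex) \<Rightarrow> ('k \<times> 'k) set" where
  "weight_space_k T \<alpha> = {x. \<forall>h \<in> T. cbracket lie (h, 0) x = cscale (\<alpha> (h, 0)) x}"

definition roots_k :: "'k::hilbert_lie set \<Rightarrow> ('k \<times> 'k \<Rightarrow> complex) set" where
  "roots_k T = {\<alpha> \<in> im_dual T. \<alpha> \<noteq> 0 \<and> weight_space_k T \<alpha> \<noteq> {0}}"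

definition sharp :: "'k::hilbert_lie set \<Rightarrow> ('k \<times> 'k \<Rightarrow> complex) \<Rightarrow> 'k \<times> 'k" where
  "sharp T \<alpha> = (THE s. s \<in> {0} \<times> T \<and> (\<forall>h \<in> T. cinner (h, 0) s = \<alpha> (h, 0)))"

text \<open>On \<open>iT\<close> the hermitian form is real and agrees with the inner product of the product type.
  The real number \<open>\<nu>(\<alpha>\<^sup>\<sharp>)\<close> is \<open>pairing T \<nu> \<alpha>\<close>.\<close>

definition dual_form :: "'k::hilbert_lie set \<Rightarrow> ('k \<times> 'k \<Rightarrow> complex) \<Rightarrow> ('k \<times> 'k \<Rightarrow> complex) \<Rightarrow> real" where
  "dual_form T \<alpha> \<beta> = inner (sharp T \<alpha>) (sharp T \<beta>)"

definition pairing :: "'k::hilbert_lie set \<Rightarrow> ('k \<times> 'k \<Rightarrow> complex) \<Rightarrow> ('k \<times> 'k \<Rightarrow> complex) \<Rightarrow> real" where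
  "pairing T \<nu> \<alpha> = Re (\<nu> (sharp T \<alpha>))"

definition weight_space_kn ::
  "('k::hilbert_lie \<Rightarrow> 'k) \<Rightarrow> nat \<Rightarrow> 'k set \<Rightarrow> ('k \<times> 'k \<Rightarrow> complex) \<times> int \<Rightarrow> ('k \<times> 'k) set" where
  "weight_space_kn \<phi> N T \<beta> = {x \<in> weight_space_k T (fst \<beta>).
     map_prod (inv \<phi>) (inv \<phi>) x = cscale (cis (2 * pi * of_int (snd \<beta>) / real N)) x}"


section \<open>Affinisations\<close>

text \<open>The graph of \<open>D\<^sub>\<nu>\<close>-bar on the closed sum of the (mutually orthogonal) weight spaces; note
  that \<open>pairing T \<nu> 0 = 0\<close>. If the numbers \<open>\<nu>(\<alpha>\<^sup>\<sharp>)\<close> are bounded this is the bounded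
  operator acting by these scalars, otherwise the closed unbounded one.\<close>

definition Dbar_rel :: "'k::hilbert_lie set \<Rightarrow> ('k \<times> 'k \<Rightarrow> complex) \<Rightarrow> 'k \<Rightarrow> 'k \<Rightarrow> bool" where
  "Dbar_rel T \<nu> x y \<longleftrightarrow> (\<exists>c. (\<forall>\<alpha> \<in> insert 0 (roots_k T). c \<alpha> \<in> weight_space_k T \<alpha>) \<and>
     (c has_sum (x, 0)) (insert 0 (roots_k T)) \<and>
     ((\<lambda>\<alpha>. cscale (\<i> * of_real (pairing T \<nu> \<alpha>)) (c \<alpha>)) has_sum (y, 0)) (insert 0 (roots_k T)))"

definition Dbar :: "'k::hilbert_lie set \<Rightarrow> ('k \<times> 'k \<Rightarrow> complex) \<Rightarrow> 'k \<Rightarrow> 'k" where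
  "Dbar T \<nu> x = (THE y. Dbar_rel T \<nu> x y)"

definition twisted_loops :: "('k::hilbert_lie \<Rightarrow> 'k) \<Rightarrow> (real \<Rightarrow> 'k) set" where
  "twisted_loops \<phi> = {\<xi>. smooth_curve \<xi> \<and> (\<forall>t. \<xi> (t + 2 * pi) = inv \<phi> (\<xi> t))}"

text \<open>The loops all of whose iterates under \<open>D\<^sub>\<nu>\<close>-bar are defined and smooth. In the bounded case
  this condition is automatic and all twisted loops are obtained.\<close>

definition twisted_loops_nu ::
  "('k::hilbert_lie \<Rightarrow> 'k) \<Rightarrow> 'k set \<Rightarrow> ('k \<times> 'k \<Rightarrow> complex) \<Rightarrow> (real \<Rightarrow> 'k) set" where
  "twisted_loops_nu \<phi> T \<nu> = {\<xi> \<in> twisted_loops \<phi>. \<exists>\<eta>::nat \<Rightarrow> real \<Rightarrow> 'k. \<eta> 0 = \<xi> \<and>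
     (\<forall>k. smooth_curve (\<eta> k)) \<and> (\<forall>k t. Dbar_rel T \<nu> (\<eta> k t) (\<eta> (Suc k) t))}"

definition loop_deriv ::
  "'k::hilbert_lie set \<Rightarrow> ('k \<times> 'k \<Rightarrow> complex) \<Rightarrow> (real \<Rightarrow> 'k) \<Rightarrow> real \<Rightarrow> 'k" where
  "loop_deriv T \<nu> \<xi> = (\<lambda>t. vector_derivative \<xi> (at t) + Dbar T \<nu> (\<xi> t))"

definition loop_inner :: "(real \<Rightarrow> 'k::hilbert_lie) \<Rightarrow> (real \<Rightarrow> 'k) \<Rightarrow> real" where
  "loop_inner \<xi> \<eta> = 1 / (2 * pi) * integral {0..2 * pi} (\<lambda>t. inner (\<xi> t) (\<eta> t))"

type_synonym 'k aff = "real \<times> (real \<Rightarrow> 'k) \<times> real"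
type_synonym 'k cartan = "real \<times> 'k \<times> real"

definition aff_carrier ::
  "('k::hilbert_lie \<Rightarrow> 'k) \<Rightarrow> 'k set \<Rightarrow> ('k \<times> 'k \<Rightarrow> complex) \<Rightarrow> 'k aff set" where
  "aff_carrier \<phi> T \<nu> = UNIV \<times> twisted_loops_nu \<phi> T \<nu> \<times> UNIV"

definition aff_bracket ::
  "'k::hilbert_lie set \<Rightarrow> ('k \<times> 'k \<Rightarrow> complex) \<Rightarrow> 'k aff \<Rightarrow> 'k aff \<Rightarrow> 'k aff" where
  "aff_bracket T \<nu> = (\<lambda>(z1, x1, t1) (z2, x2, t2).
     (loop_inner (loop_deriv T \<nu> x1) x2,
      (\<lambda>s. lie (x1 s) (x2 s)) + t1 *\<^sub>R loop_deriv T \<nu> x2 - t2 *\<^sub>R loop_deriv T \<nu> x1,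
      0))"

text \<open>\<open>\<tt>\<^sub>0\<^sup>e\<close>, and its embedding into the affinisation by constant loops.\<close>

definition ext_cartan :: "'k::hilbert_lie set \<Rightarrow> 'k cartan set" where
  "ext_cartan T = UNIV \<times> T \<times> UNIV"

definition const_embed :: "'k cartan \<Rightarrow> 'k aff" where
  "const_embed = (\<lambda>(z, h, t). (z, (\<lambda>_. h), t))"

text \<open>\<open>c = (i, 0, 0)\<close>, as an element of the complexification of \<open>ext_cartan T\<close>.\<close>

definition c_elt :: "'k::hilbert_lie cartan \<times> 'k cartan" where
  "c_elt = ((0, 0, 0), (1, 0, 0))"

text \<open>The identification of functionals on the complexification of \<open>T\<close> with functionals on that of
  \<open>ext_cartan T\<close> vanishing at \<open>(i, 0, 0)\<close> and \<open>(0, 0, -i)\<close>.\<close>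

definition extend_functional ::
  "'k::hilbert_lie set \<Rightarrow> ('k \<times> 'k \<Rightarrow> complex) \<Rightarrow> 'k cartan \<times> 'k cartan \<Rightarrow> complex" where
  "extend_functional T \<mu> = (\<lambda>((z1, h1, t1), (z2, h2, t2)).
     if h1 \<in> T \<and> h2 \<in> T then \<mu> (h1, h2) else 0)"


section \<open>Roots and Weyl group of an affinisation\<close>

definition aff_roots ::
  "('k::hilbert_lie \<Rightarrow> 'k) \<Rightarrow> nat \<Rightarrow> 'k set \<Rightarrow> (('k \<times> 'k \<Rightarrow> complex) \<times> int) set" where
  "aff_roots \<phi> N T = {\<beta>. fst \<beta> \<in> insert 0 (roots_k T) \<and> \<beta> \<noteq> (0, 0) \<and>
     weight_space_kn \<phi> N T \<beta> \<noteq> {0}}"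

definition compact_roots ::
  "('k::hilbert_lie \<Rightarrow> 'k) \<Rightarrow> nat \<Rightarrow> 'k set \<Rightarrow> (('k \<times> 'k \<Rightarrow> complex) \<times> int) set" where
  "compact_roots \<phi> N T = {\<beta> \<in> aff_roots \<phi> N T. fst \<beta> \<noteq> 0}"

text \<open>The value \<open>n/N + \<nu>(\<alpha>\<^sup>\<sharp>)\<close> at a pair \<open>(\<alpha>, n)\<close>.\<close>

definition root_height ::
  "nat \<Rightarrow> 'k::hilbert_lie set \<Rightarrow> ('k \<times> 'k \<Rightarrow> complex) \<Rightarrow> ('k \<times> 'k \<Rightarrow> complex) \<times> int \<Rightarrow> real" where
  "root_height N T \<nu> \<beta> = of_int (snd \<beta>) / real N + pairing T \<nu> (fst \<beta>)"

text \<open>The functional on the complexification of \<open>ext_cartan T\<close> identified with a pair.\<close>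

definition root_functional ::
  "nat \<Rightarrow> 'k::hilbert_lie set \<Rightarrow> ('k \<times> 'k \<Rightarrow> complex) \<Rightarrow> ('k \<times> 'k \<Rightarrow> complex) \<times> int
     \<Rightarrow> 'k cartan \<times> 'k cartan \<Rightarrow> complex" where
  "root_functional N T \<nu> \<beta> = (\<lambda>((z1, h1, t1), (z2, h2, t2)).
     if h1 \<in> T \<and> h2 \<in> T
     then fst \<beta> (h1, h2) + \<i> * Complex t1 t2 * of_real (root_height N T \<nu> \<beta>) else 0)"

text \<open>The root space of \<open>(\<alpha>, n)\<close>, spanned by the loops \<open>t \<mapsto> exp(int/N) x\<close> with \<open>x\<close> in
  \<open>weight_space_kn \<phi> N T (\<alpha>, n)\<close>, split into real and imaginary part.\<close>

definition aff_root_space ::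
  "('k::hilbert_lie \<Rightarrow> 'k) \<Rightarrow> nat \<Rightarrow> 'k set \<Rightarrow> ('k \<times> 'k \<Rightarrow> complex) \<times> int
     \<Rightarrow> ('k aff \<times> 'k aff) set" where
  "aff_root_space \<phi> N T \<beta> =
     (\<lambda>x. ((0, (\<lambda>t. fst (cscale (cis (of_int (snd \<beta>) * t / real N)) x)), 0),
           (0, (\<lambda>t. snd (cscale (cis (of_int (snd \<beta>) * t / real N)) x)), 0)))
     ` weight_space_kn \<phi> N T \<beta>"

text \<open>The coroot lies in \<open>i\<tt>\<^sub>0\<^sup>e\<close>, so only the imaginary component is nonzero.\<close>

definition coroot ::
  "nat \<Rightarrow> 'k::hilbert_lie set \<Rightarrow> ('k \<times> 'k \<Rightarrow> complex) \<Rightarrow> ('k \<times> 'k \<Rightarrow> complex) \<times> int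
     \<Rightarrow> 'k cartan \<times> 'k cartan" where
  "coroot N T \<nu> \<beta> = ((0, 0, 0),
     (- 2 * root_height N T \<nu> \<beta> / dual_form T (fst \<beta>) (fst \<beta>),
      snd ((2 / dual_form T (fst \<beta>) (fst \<beta>)) *\<^sub>R sharp T (fst \<beta>)),
      0))"

text \<open>Reflections are extended complex linearly to the complexification of \<open>ext_cartan T\<close>, and by
  the identity to the rest of the type.\<close>

definition reflection ::
  "nat \<Rightarrow> 'k::hilbert_lie set \<Rightarrow> ('k \<times> 'k \<Rightarrow> complex) \<Rightarrow> ('k \<times> 'k \<Rightarrow> complex) \<times> int
     \<Rightarrow> 'k cartan \<times> 'k cartan \<Rightarrow> 'k cartan \<times> 'k cartan" where
  "reflection N T \<nu> \<beta> v = v - cscale (root_functional N T \<nu> \<beta> v) (coroot N T \<nu> \<beta>)"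

text \<open>Reflections are involutions, so closure under inverses need not be demanded.\<close>

inductive_set weyl_group ::
  "('k::hilbert_lie \<Rightarrow> 'k) \<Rightarrow> nat \<Rightarrow> 'k set \<Rightarrow> ('k \<times> 'k \<Rightarrow> complex)
     \<Rightarrow> ('k cartan \<times> 'k cartan \<Rightarrow> 'k cartan \<times> 'k cartan) set"
  for \<phi> N T \<nu> where
  weyl_id: "id \<in> weyl_group \<phi> N T \<nu>"
| weyl_step: "w \<in> weyl_group \<phi> N T \<nu> \<Longrightarrow> \<beta> \<in> compact_roots \<phi> N T \<Longrightarrow>
    reflection N T \<nu> \<beta> \<circ> w \<in> weyl_group \<phi> N T \<nu>"

definition dual_action :: "('b \<Rightarrow> 'b) \<Rightarrow> ('b \<Rightarrow> complex) \<Rightarrow> 'b \<Rightarrow> complex" where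
  "dual_action w \<gamma> = \<gamma> \<circ> inv w"

definition root_lattice ::
  "('k::hilbert_lie \<Rightarrow> 'k) \<Rightarrow> nat \<Rightarrow> 'k set \<Rightarrow> ('k \<times> 'k \<Rightarrow> complex)
     \<Rightarrow> ('k cartan \<times> 'k cartan \<Rightarrow> complex) set" where
  "root_lattice \<phi> N T \<nu> = int_span (root_functional N T \<nu> ` aff_roots \<phi> N T)"


section \<open>Untwisting data\<close>

definition real_pairs :: "('a \<times> int) set \<Rightarrow> ('a \<times> real) set" where
  "real_pairs R = map_prod id real_of_int ` R"

text \<open>Isomorphism of locally affine root systems, with form \<open>((\<alpha>, m), (\<beta>, n)) \<mapsto> (\<alpha>, \<beta>)\<close> on the
  rational spans.\<close>

definition aff_root_system_iso ::
  "'k::hilbert_lie set \<Rightarrow> (('k \<times> 'k \<Rightarrow> complex) \<times> real) set \<Rightarrow> (('k \<times> 'k \<Rightarrow> complex) \<times> real) set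
     \<Rightarrow> (('k \<times> 'k \<Rightarrow> complex) \<times> real \<Rightarrow> ('k \<times> 'k \<Rightarrow> complex) \<times> real) \<Rightarrow> bool" where
  "aff_root_system_iso T R R' f \<longleftrightarrow> bij_betw f R R' \<and>
     (\<exists>g. bij_betw g (rat_span R) (rat_span R') \<and>
       (\<forall>u \<in> rat_span R. \<forall>v \<in> rat_span R. g (u + v) = g u + g v) \<and>
       (\<forall>q::rat. \<forall>u \<in> rat_span R. g (of_rat q *\<^sub>R u) = of_rat q *\<^sub>R g u) \<and>
       (\<forall>u \<in> R. g u = f u) \<and>
       (\<forall>u \<in> rat_span R. \<forall>v \<in> rat_span R.
          dual_form T (fst (g u)) (fst (g v)) = dual_form T (fst u) (fst v)))"

definition aff_lie_iso ::
  "('k::hilbert_lie aff \<Rightarrow> 'k aff) \<Rightarrow> 'k aff set \<Rightarrow> ('k aff \<Rightarrow> 'k aff \<Rightarrow> 'k aff)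
     \<Rightarrow> 'k aff set \<Rightarrow> ('k aff \<Rightarrow> 'k aff \<Rightarrow> 'k aff) \<Rightarrow> bool" where
  "aff_lie_iso F A b A' b' \<longleftrightarrow> bij_betw F A A' \<and>
     (\<forall>x \<in> A. \<forall>y \<in> A. F (x + y) = F x + F y) \<and>
     (\<forall>r. \<forall>x \<in> A. F (r *\<^sub>R x) = r *\<^sub>R F x) \<and>
     (\<forall>x \<in> A. \<forall>y \<in> A. F (b x y) = b' (F x) (F y))"

definition untwist :: "(real \<Rightarrow> 'k \<Rightarrow> 'k) \<Rightarrow> 'k aff \<Rightarrow> 'k aff" where
  "untwist \<Phi> = (\<lambda>(z1, \<xi>, z2). (z1, (\<lambda>t. \<Phi> (t / (2 * pi)) (\<xi> t)), z2))"

definition untwist_root ::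
  "nat \<Rightarrow> nat \<Rightarrow> 'k::hilbert_lie set \<Rightarrow> ('k \<times> 'k \<Rightarrow> complex)
     \<Rightarrow> ('k \<times> 'k \<Rightarrow> complex) \<times> real \<Rightarrow> ('k \<times> 'k \<Rightarrow> complex) \<times> real" where
  "untwist_root N N\<psi> T \<mu> = (\<lambda>(\<alpha>, r). (\<alpha>, real N\<psi> * (r / real N - pairing T \<mu> \<alpha>)))"

definition untwisting_data ::
  "'h::{real_inner,complete_space} itself \<Rightarrow> ('k::hilbert_lie \<Rightarrow> 'k) \<Rightarrow> nat \<Rightarrow> ('k \<Rightarrow> 'k) \<Rightarrow> nat
     \<Rightarrow> (real \<Rightarrow> 'k \<Rightarrow> 'k) \<Rightarrow> 'k set \<Rightarrow> 'k set \<Rightarrow> ('k \<times> 'k \<Rightarrow> complex) \<Rightarrow> bool" where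
  "untwisting_data H \<phi> N \<psi> N\<psi> \<Phi> \<tt> T \<mu> \<longleftrightarrow>
     hl_aut \<psi> \<and> (\<psi> = id \<or> standard_aut H \<psi>) \<and>
     (\<forall>s. hl_aut (\<Phi> s)) \<and> \<Phi> 0 = id \<and> (\<forall>r s. \<Phi> (r + s) = \<Phi> r \<circ> \<Phi> s) \<and>
     (\<forall>x. smooth_curve (\<lambda>s. \<Phi> s x)) \<and> (\<forall>s. \<Phi> s \<circ> \<phi> = \<phi> \<circ> \<Phi> s) \<and> \<phi> = \<Phi> 1 \<circ> \<psi> \<and>
     maximal_abelian_in UNIV \<tt> \<and> \<tt> \<inter> fixed_points \<phi> = T \<and> \<tt> \<inter> fixed_points \<psi> = T \<and>
     maximal_abelian_in (fixed_points \<phi>) T \<and> maximal_abelian_in (fixed_points \<psi>) T \<and>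
     \<mu> \<in> im_dual T \<and>
     (\<forall>\<nu> \<in> im_dual T.
        aff_lie_iso (untwist \<Phi>) (aff_carrier \<phi> T \<nu>) (aff_bracket T \<nu>)
          (aff_carrier \<psi> T (\<mu> + \<nu>)) (aff_bracket T (\<mu> + \<nu>)) \<and>
        (\<forall>v \<in> ext_cartan T. untwist \<Phi> (const_embed v) = const_embed v) \<and>
        aff_root_system_iso T (real_pairs (compact_roots \<phi> N T)) (real_pairs (compact_roots \<psi> N\<psi> T))
          (untwist_root N N\<psi> T \<mu>) \<and>
        (\<forall>\<alpha> n m. (\<alpha>, n) \<in> compact_roots \<phi> N T \<and>
            untwist_root N N\<psi> T \<mu> (\<alpha>, of_int n) = (\<alpha>, of_int m) \<longrightarrow>
          map_prod (untwist \<Phi>) (untwist \<Phi>) ` aff_root_space \<phi> N T (\<alpha>, n)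
            = aff_root_space \<psi> N\<psi> T (\<alpha>, m)) \<and>
        weyl_group \<phi> N T \<nu> = weyl_group \<psi> N\<psi> T (\<mu> + \<nu>))"


section \<open>Highest weight representations\<close>

definition integral_weight ::
  "('k::hilbert_lie \<Rightarrow> 'k) \<Rightarrow> nat \<Rightarrow> 'k set \<Rightarrow> ('k \<times> 'k \<Rightarrow> complex)
     \<Rightarrow> ('k cartan \<times> 'k cartan \<Rightarrow> complex) \<Rightarrow> bool" where
  "integral_weight \<phi> N T \<nu> \<Lambda> \<longleftrightarrow> \<Lambda> \<in> im_dual (ext_cartan T) \<and>
     (\<forall>\<beta> \<in> compact_roots \<phi> N T. \<Lambda> (coroot N T \<nu> \<beta>) \<in> \<int>)"

abbreviation aff_cbracket ::
  "'k::hilbert_lie set \<Rightarrow> ('k \<times> 'k \<Rightarrow> complex)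
     \<Rightarrow> 'k aff \<times> 'k aff \<Rightarrow> 'k aff \<times> 'k aff \<Rightarrow> 'k aff \<times> 'k aff" where
  "aff_cbracket T \<nu> \<equiv> cbracket (aff_bracket T \<nu>)"

abbreviation cembed :: "'k cartan \<times> 'k cartan \<Rightarrow> 'k aff \<times> 'k aff" where
  "cembed \<equiv> map_prod const_embed const_embed"

text \<open>The complex subalgebra generated by the complexification of \<open>ext_cartan T\<close> and the compact
  root spaces.\<close>

definition core_algebra ::
  "('k::hilbert_lie \<Rightarrow> 'k) \<Rightarrow> nat \<Rightarrow> 'k set \<Rightarrow> ('k \<times> 'k \<Rightarrow> complex) \<Rightarrow> ('k aff \<times> 'k aff) set" where
  "core_algebra \<phi> N T \<nu> =
     (\<lambda>S. module.subspace cscale S \<and> (\<forall>x \<in> S. \<forall>y \<in> S. aff_cbracket T \<nu> x y \<in> S)) hull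
     (cembed ` (ext_cartan T \<times> ext_cartan T) \<union>
      (\<Union>\<beta> \<in> compact_roots \<phi> N T. aff_root_space \<phi> N T \<beta>))"

text \<open>Representation of a complex Lie algebra, with carrier \<open>A\<close> and bracket \<open>b\<close>, on the complex vector
  space \<open>'v\<close> with scalar multiplication \<open>sc\<close>.\<close>

definition lie_rep ::
  "('a::real_vector \<times> 'a) set \<Rightarrow> ('a \<times> 'a \<Rightarrow> 'a \<times> 'a \<Rightarrow> 'a \<times> 'a)
     \<Rightarrow> (complex \<Rightarrow> 'v::ab_group_add \<Rightarrow> 'v) \<Rightarrow> ('a \<times> 'a \<Rightarrow> 'v \<Rightarrow> 'v) \<Rightarrow> bool" where
  "lie_rep A b sc \<rho> \<longleftrightarrow> vector_space sc \<and>
     (\<forall>x \<in> A. Vector_Spaces.linear sc sc (\<rho> x)) \<and>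
     (\<forall>x \<in> A. \<forall>y \<in> A. \<forall>v. \<rho> (x + y) v = \<rho> x v + \<rho> y v) \<and>
     (\<forall>c. \<forall>x \<in> A. \<forall>v. \<rho> (cscale c x) v = sc c (\<rho> x v)) \<and>
     (\<forall>x \<in> A. \<forall>y \<in> A. \<forall>v. \<rho> (b x y) v = \<rho> x (\<rho> y v) - \<rho> y (\<rho> x v))"

definition weight_space ::
  "'k::hilbert_lie set \<Rightarrow> (complex \<Rightarrow> 'v \<Rightarrow> 'v) \<Rightarrow> ('k aff \<times> 'k aff \<Rightarrow> 'v \<Rightarrow> 'v)
     \<Rightarrow> ('k cartan \<times> 'k cartan \<Rightarrow> complex) \<Rightarrow> 'v set" where
  "weight_space T sc \<rho> \<gamma> =
     {v. \<forall>h \<in> ext_cartan T \<times> ext_cartan T. \<rho> (cembed h) v = sc (\<gamma> h) v}"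

definition integrable_rep ::
  "('k::hilbert_lie \<Rightarrow> 'k) \<Rightarrow> nat \<Rightarrow> 'k set
     \<Rightarrow> (complex \<Rightarrow> 'v::ab_group_add \<Rightarrow> 'v) \<Rightarrow> ('k aff \<times> 'k aff \<Rightarrow> 'v \<Rightarrow> 'v) \<Rightarrow> bool" where
  "integrable_rep \<phi> N T sc \<rho> \<longleftrightarrow>
     module.span sc (\<Union>\<gamma> \<in> cdual (ext_cartan T). weight_space T sc \<rho> \<gamma>) = UNIV \<and>
     (\<forall>\<beta> \<in> compact_roots \<phi> N T. \<forall>x \<in> aff_root_space \<phi> N T \<beta>. \<forall>v. \<exists>n. (\<rho> x ^^ n) v = 0)"

definition subrep ::
  "('a \<times> 'a) set \<Rightarrow> (complex \<Rightarrow> 'v::ab_group_add \<Rightarrow> 'v) \<Rightarrow> ('a \<times> 'a \<Rightarrow> 'v \<Rightarrow> 'v) \<Rightarrow> 'v set \<Rightarrow> bool" where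
  "subrep A sc \<rho> W \<longleftrightarrow> module.subspace sc W \<and> (\<forall>x \<in> A. \<forall>v \<in> W. \<rho> x v \<in> W)"

definition irreducible_rep ::
  "('a \<times> 'a) set \<Rightarrow> (complex \<Rightarrow> 'v::ab_group_add \<Rightarrow> 'v) \<Rightarrow> ('a \<times> 'a \<Rightarrow> 'v \<Rightarrow> 'v) \<Rightarrow> bool" where
  "irreducible_rep A sc \<rho> \<longleftrightarrow> (\<exists>v::'v. v \<noteq> 0) \<and> (\<forall>W. subrep A sc \<rho> W \<longrightarrow> W = {0} \<or> W = UNIV)"

definition positive_system ::
  "('k::hilbert_lie \<Rightarrow> 'k) \<Rightarrow> nat \<Rightarrow> 'k set \<Rightarrow> ('k \<times> 'k \<Rightarrow> complex)
     \<Rightarrow> (('k \<times> 'k \<Rightarrow> complex) \<times> int) set \<Rightarrow> bool" where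
  "positive_system \<phi> N T \<nu> P \<longleftrightarrow>
     aff_roots \<phi> N T = P \<union> uminus ` P \<and> P \<inter> uminus ` P = {} \<and>
     (\<forall>F (c::_ \<Rightarrow> nat). finite F \<and> F \<subseteq> P \<and>
        (\<Sum>\<beta>\<in>F. real (c \<beta>) *\<^sub>R root_functional N T \<nu> \<beta>) = 0 \<longrightarrow> (\<forall>\<beta> \<in> F. c \<beta> = 0))"

text \<open>Since only \<open>core_algebra\<close> acts, root vectors for roots \<open>(0, n)\<close> are required to annihilate the
  highest weight vector only if they belong to it.\<close>

definition highest_weight_rep ::
  "('k::hilbert_lie \<Rightarrow> 'k) \<Rightarrow> nat \<Rightarrow> 'k set \<Rightarrow> ('k \<times> 'k \<Rightarrow> complex)
     \<Rightarrow> (complex \<Rightarrow> 'v::ab_group_add \<Rightarrow> 'v) \<Rightarrow> ('k aff \<times> 'k aff \<Rightarrow> 'v \<Rightarrow> 'v)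
     \<Rightarrow> ('k cartan \<times> 'k cartan \<Rightarrow> complex) \<Rightarrow> 'v \<Rightarrow> bool" where
  "highest_weight_rep \<phi> N T \<nu> sc \<rho> \<Lambda> v\<Lambda> \<longleftrightarrow>
     v\<Lambda> \<noteq> 0 \<and> v\<Lambda> \<in> weight_space T sc \<rho> \<Lambda> \<and>
     subrep (core_algebra \<phi> N T \<nu>) sc \<rho> hull {v\<Lambda>} = UNIV \<and>
     (\<exists>P. positive_system \<phi> N T \<nu> P \<and>
        (\<forall>\<beta> \<in> P. \<forall>x \<in> aff_root_space \<phi> N T \<beta> \<inter> core_algebra \<phi> N T \<nu>. \<rho> x v\<Lambda> = 0))"

text \<open>\<open>(\<rho>, v\<Lambda>)\<close> is the irreducible integrable module of highest weight \<open>\<Lambda>\<close>.\<close>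

definition is_L ::
  "('k::hilbert_lie \<Rightarrow> 'k) \<Rightarrow> nat \<Rightarrow> 'k set \<Rightarrow> ('k \<times> 'k \<Rightarrow> complex)
     \<Rightarrow> ('k cartan \<times> 'k cartan \<Rightarrow> complex)
     \<Rightarrow> (complex \<Rightarrow> 'v::ab_group_add \<Rightarrow> 'v) \<Rightarrow> ('k aff \<times> 'k aff \<Rightarrow> 'v \<Rightarrow> 'v) \<Rightarrow> 'v \<Rightarrow> bool" where
  "is_L \<phi> N T \<nu> \<Lambda> sc \<rho> v\<Lambda> \<longleftrightarrow>
     lie_rep (core_algebra \<phi> N T \<nu>) (aff_cbracket T \<nu>) sc \<rho> \<and>
     irreducible_rep (core_algebra \<phi> N T \<nu>) sc \<rho> \<and>
     integrable_rep \<phi> N T sc \<rho> \<and>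
     highest_weight_rep \<phi> N T \<nu> sc \<rho> \<Lambda> v\<Lambda>"

text \<open>The extension of \<open>D\<^sub>\<nu>\<^sub>'\<close> to the affinisation that vanishes on \<open>\<tt>\<^sub>0\<^sup>e\<close>; it kills the two outer
  summands, and it kills constant loops in \<open>T\<close> anyway.\<close>

definition aff_deriv ::
  "'k::hilbert_lie set \<Rightarrow> ('k \<times> 'k \<Rightarrow> complex) \<Rightarrow> 'k aff \<Rightarrow> 'k aff" where
  "aff_deriv T \<nu>' = (\<lambda>(z, \<xi>, t). (0, loop_deriv T \<nu>' \<xi>, 0))"

text \<open>An extension of \<open>\<rho>\<close> to the semidirect product with \<open>D\<^sub>\<nu>\<^sub>'\<close> is given by the operator \<open>D\<close>
  by which \<open>D\<^sub>\<nu>\<^sub>'\<close> acts; \<open>D\<close> is normalised by \<open>D v\<Lambda> = 0\<close>.\<close>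

definition derivation_extension ::
  "('k::hilbert_lie \<Rightarrow> 'k) \<Rightarrow> nat \<Rightarrow> 'k set \<Rightarrow> ('k \<times> 'k \<Rightarrow> complex) \<Rightarrow> ('k \<times> 'k \<Rightarrow> complex)
     \<Rightarrow> (complex \<Rightarrow> 'v::ab_group_add \<Rightarrow> 'v) \<Rightarrow> ('k aff \<times> 'k aff \<Rightarrow> 'v \<Rightarrow> 'v) \<Rightarrow> 'v
     \<Rightarrow> ('v \<Rightarrow> 'v) \<Rightarrow> bool" where
  "derivation_extension \<phi> N T \<nu> \<nu>' sc \<rho> v\<Lambda> D \<longleftrightarrow>
     Vector_Spaces.linear sc sc D \<and> D v\<Lambda> = 0 \<and>
     (\<forall>x \<in> core_algebra \<phi> N T \<nu>. \<forall>v.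
        \<rho> (map_prod (aff_deriv T \<nu>') (aff_deriv T \<nu>') x) v = D (\<rho> x v) - \<rho> x (D v))"

text \<open>The eigenvalues of \<open>H = -i D\<close>; they are real for the modules considered here.\<close>

definition energy_spectrum :: "(complex \<Rightarrow> 'v::ab_group_add \<Rightarrow> 'v) \<Rightarrow> ('v \<Rightarrow> 'v) \<Rightarrow> real set" where
  "energy_spectrum sc D = {E. \<exists>v. v \<noteq> 0 \<and> sc (- \<i>) (D v) = sc (of_real E) v}"

definition positive_energy :: "(complex \<Rightarrow> 'v::ab_group_add \<Rightarrow> 'v) \<Rightarrow> ('v \<Rightarrow> 'v) \<Rightarrow> bool" where
  "positive_energy sc D \<longleftrightarrow> bdd_below (energy_spectrum sc D)"

definition minimal_energy :: "(complex \<Rightarrow> 'v::ab_group_add \<Rightarrow> 'v) \<Rightarrow> ('v \<Rightarrow> 'v) \<Rightarrow> real" where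
  "minimal_energy sc D = Inf (energy_spectrum sc D)"


section \<open>The energy character\<close>

text \<open>\<open>\<Lambda> - \<Lambda>(c) \<kappa>\<close>, to be used with \<open>\<kappa> = \<mu> + \<nu>\<close>.\<close>

definition shifted_weight ::
  "'k::hilbert_lie set \<Rightarrow> ('k cartan \<times> 'k cartan \<Rightarrow> complex) \<Rightarrow> ('k \<times> 'k \<Rightarrow> complex)
     \<Rightarrow> 'k cartan \<times> 'k cartan \<Rightarrow> complex" where
  "shifted_weight T \<Lambda> \<kappa> = (\<lambda>v. \<Lambda> v - \<Lambda> c_elt * extend_functional T \<kappa> v)"

text \<open>\<open>chi\<close> is a homomorphism on the root lattice of the standard affinisation (parameter \<open>0\<close>) with
  \<open>chi (\<alpha>, n) = \<kappa>(\<alpha>\<^sup>\<sharp>) + n/N\<close>.\<close>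

definition energy_character ::
  "('k::hilbert_lie \<Rightarrow> 'k) \<Rightarrow> nat \<Rightarrow> 'k set \<Rightarrow> ('k \<times> 'k \<Rightarrow> complex)
     \<Rightarrow> (('k cartan \<times> 'k cartan \<Rightarrow> complex) \<Rightarrow> real) \<Rightarrow> bool" where
  "energy_character \<psi> N T \<kappa> chi \<longleftrightarrow>
     (\<forall>a \<in> root_lattice \<psi> N T 0. \<forall>b \<in> root_lattice \<psi> N T 0. chi (a + b) = chi a + chi b) \<and>
     (\<forall>\<alpha> n. (\<alpha>, n) \<in> aff_roots \<psi> N T \<longrightarrow>
        chi (root_functional N T 0 (\<alpha>, n)) = pairing T \<kappa> \<alpha> + of_int n / real N)"

definition orbit_infimum ::
  "('k::hilbert_lie \<Rightarrow> 'k) \<Rightarrow> nat \<Rightarrow> 'k set \<Rightarrow> (('k cartan \<times> 'k cartan \<Rightarrow> complex) \<Rightarrow> real)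
     \<Rightarrow> ('k cartan \<times> 'k cartan \<Rightarrow> complex) \<Rightarrow> ereal" where
  "orbit_infimum \<psi> N T chi \<Lambda>' = (INF w \<in> weyl_group \<psi> N T 0. ereal (chi (dual_action w \<Lambda>' - \<Lambda>')))"

end

theory Submission
  imports Defs
begin

text \<open>The module \<open>L\<close> is spanned by the vectors \<open>x\<^sub>1 \<dots> x\<^sub>k v\<^sub>\<Lambda>\<close> with \<open>x\<^sub>j\<close> a root vector of a compact root
  \<open>(\<alpha>\<^sub>j, n\<^sub>j)\<close>, and on such a monomial \<open>- \<i> D\<close> acts by the sum of the energies
  \<open>n\<^sub>j/N + \<nu>'(\<alpha>\<^sub>j\<^sup>\<sharp>)\<close>. So the energy spectrum is the set of energies of the nonzero monomials, and
  it has to be compared with the energies along the Weyl orbit of \<open>\<Lambda>\<close>.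

  Powers of root vectors, chosen by the representation theory of \<open>\<ss>\<ll>\<^sub>2\<close>, carry \<open>v\<^sub>\<Lambda>\<close> to nonzero vectors
  of all the weights \<open>w.\<Lambda>\<close>, whence every energy of the orbit is in the spectrum (\<open>orbit_in_spectrum\<close>).

  Conversely let \<open>m\<close> be a lower bound of the orbit energies (\<open>spectrum_bound\<close>). A given monomial
  involves finitely many compact roots. The roots whose finite part \<open>\<alpha>\<close> lies in the span of theirs
  have only finitely many finite parts, because Cartan integers are bounded; so their negative
  energies stay below some \<open>- \<epsilon> < 0\<close>. Let \<open>\<gamma>\<close> be a weight in the orbit of \<open>\<Lambda>\<close> under the reflections
  in these roots, with energy less than \<open>\<epsilon>\<close> above the infimum over this orbit, and let \<open>u\<close> be the
  vector of weight \<open>\<gamma>\<close> reached from \<open>v\<^sub>\<Lambda>\<close>. Every root vector of negative energy in the subsystem kills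
  \<open>u\<close>: for a compact root, because otherwise the reflection in it would lower the energy by
  at least \<open>\<epsilon>\<close>; for a root \<open>(0, n)\<close>, because a lower bound on the orbit energies forces the level
  \<open>\<Lambda>(c)\<close> to be positive, which makes \<open>(0, n)\<close> with \<open>n < 0\<close> a positive root. As in the
  Poincare-Birkhoff-Witt theorem (\<open>pbw_span_stable\<close>), the module generated by \<open>u\<close> under the
  subsystem is then spanned by monomials of nonnegative energy applied to \<open>u\<close>. It contains
  \<open>v\<^sub>\<Lambda>\<close>, hence the given monomial, whose energy is therefore at least that of \<open>u\<close>, and so at least \<open>m\<close>.

  In both halves one has to know which weights occur. The weights of \<open>L\<close> lie in \<open>\<Lambda> - Q\<close>, where \<open>Q\<close> is
  the pointed cone generated by the positive roots. So \<open>\<Lambda>\<close> is not the midpoint of two other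
  weights; this property is invariant under reflections, and it guarantees that for every compact
  root \<open>\<beta>\<close> and every weight \<open>\<gamma>\<close> of the orbit a root vector of \<open>\<beta>\<close> or of \<open>- \<beta>\<close> kills the
  vectors of weight \<open>\<gamma>\<close>.

  Finally, the energies along an orbit depend only on the Cartan integers, on the values of the
  weight at the coroots and on the energies of the roots. Untwisting matches all these numbers for
  \<open>\<Lambda>\<close> with those for \<open>\<Lambda>\<^sub>\<mu>\<^sub>+\<^sub>\<nu>\<close> and the standard affinisation (\<open>shifted_weight_coroot\<close>,
  \<open>reflection_orbit_transport\<close>), and there the character \<open>\<chi>\<close> computes the orbit energies (\<open>weyl_orbit\<close>).\<close>

section \<open>Simultaneous eigenvectors and \<open>\<ss>\<ll>\<^sub>2\<close>-strings\<close>

context vector_space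
begin

text \<open>Eigenvectors for distinct systems of eigenvalues are linearly independent; the shape needed
  here is that an eigenvector in a span of eigenvectors shares its eigenvalues with one of them.\<close>

lemma eigenvalue_of_span:
  assumes lin: "\<And>i. Vector_Spaces.linear scale scale (op i)"
    and v: "v \<noteq> 0" "\<And>i. op i v = scale (g i) v"
    and mem: "v \<in> span {w. \<exists>g'\<in>G. \<forall>i. op i w = scale (g' i) w}"
  shows "g \<in> G"
proof (rule ccontr)
  assume "g \<notin> G"
  obtain t r where t: "finite t" "t \<subseteq> {w. \<exists>g'\<in>G. \<forall>i. op i w = scale (g' i) w}"
    and vt: "v = (\<Sum>a\<in>t. scale (r a) a)"
    using mem unfolding span_explicit by blast
  have "x = 0" if "x = (\<Sum>a\<in>t. scale (r a) a)" "\<And>i. op i x = scale (g i) x" for x r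
    using t that
  proof (induction t arbitrary: x r)
    case empty
    then show ?case by simp
  next
    case (insert a t)
    obtain g' where g': "g' \<in> G" "\<And>i. op i a = scale (g' i) a" using insert.prems(1) by auto
    then obtain i where i: "g i \<noteq> g' i" using \<open>g \<notin> G\<close> by (metis ext)
    interpret L: Vector_Spaces.linear scale scale "op i" by (rule lin)
    have "\<forall>b\<in>t. \<exists>c. op i b = scale c b" using insert.prems(1) by auto
    then obtain c where c: "\<And>b. b \<in> t \<Longrightarrow> op i b = scale (c b) b" by metis
    have x: "x = scale (r a) a + (\<Sum>b\<in>t. scale (r b) b)" using insert by simp
    let ?y = "scale (g i - g' i) x"
    (* op i - g' i kills the new vector a and multiplies x by a nonzero scalar, so the induction
       hypothesis applies to a shorter sum *)
    have xb: "op i x - scale (g' i) x = (\<Sum>b\<in>t. op i (scale (r b) b) - scale (g' i) (scale (r b) b))"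
      unfolding x by (simp add: L.add L.sum L.scale g'(2) scale_right_distrib scale_sum_right
          sum_subtractf mult.commute)
    have "?y = op i x - scale (g' i) x" using insert.prems(3) by (simp add: scale_left_diff_distrib)
    also have "\<dots> = (\<Sum>b\<in>t. scale ((c b - g' i) * r b) b)"
      unfolding xb by (rule sum.cong) (simp_all add: L.scale c scale_left_diff_distrib[symmetric] left_diff_distrib right_diff_distrib mult.commute del: scale_left_diff_distrib)
    finally have y: "?y = (\<Sum>b\<in>t. scale ((c b - g' i) * r b) b)" .
    have "?y = 0"
    proof (rule insert.IH[OF _ y])
      show "t \<subseteq> {w. \<exists>g'\<in>G. \<forall>i. op i w = scale (g' i) w}" using insert.prems(1) by auto
      fix j
      interpret J: Vector_Spaces.linear scale scale "op j" by (rule lin)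
      show "op j ?y = scale (g j) ?y" using insert.prems(3) by (simp add: J.scale mult.commute)
    qed
    then show ?case using i by simp
  qed
  then show False using v vt by blast
qed

text \<open>In this and the next two lemmas \<open>e\<close>, \<open>f\<close> and their commutator act like the standard basis of
  \<open>\<ss>\<ll>\<^sub>2\<close> on a string of vectors, the commutator having eigenvalue \<open>m\<close> at its start.\<close>

lemma sl2_string:
  assumes e: "Vector_Spaces.linear scale scale e" and f: "Vector_Spaces.linear scale scale f"
    and comm: "\<And>j. e (f ((f ^^ j) u)) - f (e ((f ^^ j) u)) = scale (m - 2 * of_nat j) ((f ^^ j) u)"
    and eu: "e u = 0"
  shows "e ((f ^^ Suc j) u) = scale (of_nat (Suc j) * (m - of_nat j)) ((f ^^ j) u)"
proof (induction j)
  case 0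
  interpret F: Vector_Spaces.linear scale scale f by (rule f)
  show ?case using comm[of 0] eu by (simp add: F.zero)
next
  case (Suc j)
  interpret F: Vector_Spaces.linear scale scale f by (rule f)
  have "e ((f ^^ Suc (Suc j)) u) = f (e ((f ^^ Suc j) u)) + scale (m - 2 * of_nat (Suc j)) ((f ^^ Suc j) u)"
    using comm[of "Suc j"] by (simp add: algebra_simps)
  also have "\<dots> = scale (of_nat (Suc j) * (m - of_nat j)) ((f ^^ Suc j) u)
      + scale (m - 2 * of_nat (Suc j)) ((f ^^ Suc j) u)"
    by (subst Suc.IH) (simp add: F.scale)
  also have "\<dots> = scale (of_nat (Suc (Suc j)) * (m - of_nat (Suc j))) ((f ^^ Suc j) u)"
    unfolding scale_left_distrib[symmetric] by (rule arg_cong2[where f = scale]) (simp_all add: algebra_simps)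
  finally show ?case .
qed

end

text \<open>Local nilpotency makes the coefficient of \<open>sl2_string\<close> vanish at the end of the string, so \<open>m\<close> is
  the length of the string; before its end all coefficients are nonzero.\<close>

lemma (in vector_space) sl2_highest:
  fixes m :: "'a"
  assumes of_nat_Suc_nonzero: "\<And>n. of_nat (Suc n) \<noteq> (0::'a)"
   and e: "Vector_Spaces.linear scale scale e" and f: "Vector_Spaces.linear scale scale f"
    and comm: "\<And>j. e (f ((f ^^ j) u)) - f (e ((f ^^ j) u)) = scale (m - 2 * of_nat j) ((f ^^ j) u)"
    and eu: "e u = 0" and u: "u \<noteq> 0" and nil: "\<exists>n. (f ^^ n) u = 0"
  obtains l where "m = of_nat l" "\<And>j. j \<le> l \<Longrightarrow> (f ^^ j) u \<noteq> 0"
    "\<exists>c. c \<noteq> 0 \<and> (e ^^ l) ((f ^^ l) u) = scale c u"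
proof -
  note str = sl2_string[OF e f comm eu]
  define n where "n = (LEAST n. (f ^^ n) u = 0)"
  have n: "(f ^^ n) u = 0" unfolding n_def by (rule LeastI_ex[OF nil])
  have nz: "(f ^^ j) u \<noteq> 0" if "j < n" for j by (rule not_less_Least[OF that[unfolded n_def]])
  obtain l where l: "n = Suc l" using n u by (cases n) auto
  interpret E: Vector_Spaces.linear scale scale e by (rule e)
  have "scale (of_nat (Suc l) * (m - of_nat l)) ((f ^^ l) u) = 0"
    unfolding str[symmetric] using n by (simp only: l E.zero)
  then have m: "m = of_nat l" using nz[of l] l of_nat_Suc_nonzero[of l] by (simp del: of_nat_Suc)
  have "\<exists>c. c \<noteq> 0 \<and> (e ^^ j) ((f ^^ j) u) = scale c u" if "j \<le> l" for j
    using that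
  proof (induction j)
    case 0
    show ?case by (rule exI[of _ 1]) simp
  next
    case (Suc j)
    then obtain c where c: "c \<noteq> 0" "(e ^^ j) ((f ^^ j) u) = scale c u" by auto
    have lin: "(e ^^ j) (scale a x) = scale a ((e ^^ j) x)" for a x j
      by (induction j) (simp_all add: E.scale)
    define k where "k = l - Suc j"
    have k: "l = j + Suc k" using Suc.prems by (simp add: k_def)
    have "m - of_nat j = of_nat (Suc k)" unfolding m k by simp
    have "(e ^^ Suc j) ((f ^^ Suc j) u) = (e ^^ j) (e ((f ^^ Suc j) u))"
      by (simp only: funpow_Suc_right comp_apply)
    also have "\<dots> = scale ((of_nat (Suc j) * of_nat (Suc k)) * c) u"
      by (simp only: str lin c \<open>m - of_nat j = of_nat (Suc k)\<close> scale_scale)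
    finally have "(e ^^ Suc j) ((f ^^ Suc j) u) = scale ((of_nat (Suc j) * of_nat (Suc k)) * c) u" .
    then show ?case using c of_nat_Suc_nonzero by (metis mult_eq_0_iff)
  qed
  from this[OF order.refl] show ?thesis using that m nz l by auto
qed

text \<open>The weight \<open>m\<close> is reflected to \<open>- m\<close> by first climbing to the top \<open>u = e\<^sup>k v\<close> of the string and
  then descending \<open>k + m\<close> steps. The string below \<open>u\<close> has length \<open>m + 2 k\<close>, so it reaches that far
  if \<open>m \<ge> 0\<close>.\<close>

lemma (in vector_space) sl2_reflected_vector:
  fixes m :: "'a"
  assumes of_nat_Suc_nonzero: "\<And>n. of_nat (Suc n) \<noteq> (0::'a)"
    and e: "Vector_Spaces.linear scale scale e" and f: "Vector_Spaces.linear scale scale f"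
    and comm: "\<And>j k. e (f ((f ^^ j) ((e ^^ k) v))) - f (e ((f ^^ j) ((e ^^ k) v)))
        = scale (m + 2 * of_nat k - 2 * of_nat j) ((f ^^ j) ((e ^^ k) v))"
    and v: "v \<noteq> 0" and nil: "\<exists>n. (e ^^ n) v = 0" "\<And>u. \<exists>n. (f ^^ n) u = 0"
  obtains n :: int where "m = of_int n" "0 \<le> n \<Longrightarrow> \<exists>k. (f ^^ (k + nat n)) ((e ^^ k) v) \<noteq> 0"
proof -
  define n where "n = (LEAST n. (e ^^ n) v = 0)"
  have n: "(e ^^ n) v = 0" unfolding n_def by (rule LeastI_ex[OF nil(1)])
  obtain k where k: "n = Suc k" using n v by (cases n) auto
  define u where "u = (e ^^ k) v"
  have u: "u \<noteq> 0" unfolding u_def by (rule not_less_Least) (use k in \<open>simp add: n_def\<close>)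
  have eu: "e u = 0" using n k by (simp add: u_def)
  have cu: "e (f ((f ^^ j) u)) - f (e ((f ^^ j) u)) = scale (m + 2 * of_nat k - 2 * of_nat j) ((f ^^ j) u)" for j
    using comm[of j k] by (simp only: u_def)
  obtain l where l: "m + 2 * of_nat k = of_nat l" "\<And>j. j \<le> l \<Longrightarrow> (f ^^ j) u \<noteq> 0"
    by (rule sl2_highest[OF of_nat_Suc_nonzero e f cu eu u nil(2)]) blast
  show ?thesis
  proof (rule that[of "int l - 2 * int k"])
    show "m = of_int (int l - 2 * int k)" using l(1) by (simp add: algebra_simps)
    show "\<exists>k'. (f ^^ (k' + nat (int l - 2 * int k))) ((e ^^ k') v) \<noteq> 0" if "0 \<le> int l - 2 * int k"
      using l(2)[of "k + nat (int l - 2 * int k)"] that unfolding u_def by (intro exI[of _ k]) auto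
  qed
qed

section \<open>Integrable modules with an energy grading\<close>

text \<open>The orbit of \<open>\<Lambda>\<close> under the reflections in the roots from \<open>B\<close>, each weight being paired with its
  energy relative to \<open>\<Lambda>\<close>. The integers \<open>\<gamma>(co \<beta>)\<close> are complex values of a functional, hence the
  real part.\<close>

inductive_set reflection_orbit ::
  "('b \<Rightarrow> 'h \<Rightarrow> complex) \<Rightarrow> ('b \<Rightarrow> 'h) \<Rightarrow> ('b \<Rightarrow> real) \<Rightarrow> ('h \<Rightarrow> complex) \<Rightarrow> 'b set
    \<Rightarrow> (('h \<Rightarrow> complex) \<times> real) set"
  for rt co en \<Lambda> B where
  orbit_base: "(\<Lambda>, 0) \<in> reflection_orbit rt co en \<Lambda> B"
| orbit_step: "(\<gamma>, r) \<in> reflection_orbit rt co en \<Lambda> B \<Longrightarrow> \<beta> \<in> B \<Longrightarrow>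
    (\<lambda>h. \<gamma> h - \<gamma> (co \<beta>) * rt \<beta> h, r - Re (\<gamma> (co \<beta>)) * en \<beta>) \<in> reflection_orbit rt co en \<Lambda> B"

lemma reflection_orbit_mono:
  assumes "B \<subseteq> B'" "p \<in> reflection_orbit rt co en \<Lambda> B"
  shows "p \<in> reflection_orbit rt co en \<Lambda> B'"
  using assms(2)
proof (cases p)
  case (Pair \<gamma> r)
  show ?thesis using assms(2) unfolding Pair
    by induction (use assms(1) in \<open>auto intro: reflection_orbit.intros\<close>)
qed

text \<open>What the argument needs of \<open>L\<close>: \<open>hop h\<close> is the action of the Cartan subalgebra, \<open>X \<beta>\<close> is the set of
  operators by which the root space of \<open>\<beta>\<close> acts, \<open>rt \<beta>\<close> is the root as a functional, \<open>co \<beta>\<close> its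
  coroot, and \<open>en \<beta>\<close> the energy by which it shifts the grading operator \<open>D\<close>. The roots in
  \<open>roots - cpt\<close> are the imaginary ones.\<close>

locale energy_module = vector_space sc for sc :: "complex \<Rightarrow> 'v::ab_group_add \<Rightarrow> 'v" +
  fixes hop :: "'h \<Rightarrow> 'v \<Rightarrow> 'v"
    and roots cpt :: "'b::ab_group_add set"
    and X :: "'b \<Rightarrow> ('v \<Rightarrow> 'v) set"
    and rt :: "'b \<Rightarrow> 'h \<Rightarrow> complex" and co :: "'b \<Rightarrow> 'h"
    and v0 :: 'v and \<Lambda> :: "'h \<Rightarrow> complex"
    and D :: "'v \<Rightarrow> 'v" and en :: "'b \<Rightarrow> real"
  assumes hop_linear: "Vector_Spaces.linear sc sc (hop h)"
    and X_linear: "\<beta> \<in> roots \<Longrightarrow> x \<in> X \<beta> \<Longrightarrow> Vector_Spaces.linear sc sc x"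
    and hop_X: "\<beta> \<in> roots \<Longrightarrow> x \<in> X \<beta> \<Longrightarrow> hop h (x v) = x (hop h v) + sc (rt \<beta> h) (x v)"
    and bracket_root: "\<beta> \<in> roots \<Longrightarrow> \<beta>' \<in> roots \<Longrightarrow> \<beta> + \<beta>' \<in> roots \<Longrightarrow> x \<in> X \<beta> \<Longrightarrow> y \<in> X \<beta>' \<Longrightarrow>
        (\<lambda>v. x (y v) - y (x v)) \<in> X (\<beta> + \<beta>')"
    and bracket_cartan: "\<beta> \<in> roots \<Longrightarrow> \<beta>' \<in> roots \<Longrightarrow> \<beta> + \<beta>' = 0 \<Longrightarrow> x \<in> X \<beta> \<Longrightarrow> y \<in> X \<beta>' \<Longrightarrow>
        \<exists>h. \<forall>v. x (y v) - y (x v) = hop h v"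
    and bracket_zero: "\<beta> \<in> roots \<Longrightarrow> \<beta>' \<in> roots \<Longrightarrow> \<beta> + \<beta>' \<notin> roots \<Longrightarrow> \<beta> + \<beta>' \<noteq> 0 \<Longrightarrow>
        x \<in> X \<beta> \<Longrightarrow> y \<in> X \<beta>' \<Longrightarrow> x (y v) - y (x v) = 0"
    and cpt_roots: "cpt \<subseteq> roots"
    and cpt_uminus: "\<beta> \<in> cpt \<Longrightarrow> - \<beta> \<in> cpt"
    and sl2: "\<beta> \<in> cpt \<Longrightarrow> \<exists>e\<in>X \<beta>. \<exists>f\<in>X (- \<beta>). \<forall>v. e (f v) - f (e v) = hop (co \<beta>) v"
    and rt_co: "\<beta> \<in> cpt \<Longrightarrow> rt \<beta> (co \<beta>) = 2"
    and rt_uminus: "\<beta> \<in> cpt \<Longrightarrow> rt (- \<beta>) = - rt \<beta>"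
    and rt_imaginary: "\<beta> \<in> roots - cpt \<Longrightarrow> \<beta>' \<in> cpt \<Longrightarrow> rt \<beta> (co \<beta>') = 0"
    and nilpotent: "\<beta> \<in> cpt \<Longrightarrow> x \<in> X \<beta> \<Longrightarrow> \<exists>n. (x ^^ n) v = 0"
    and v0_nonzero: "v0 \<noteq> 0"
    and v0_weight: "hop h v0 = sc (\<Lambda> h) v0"
    and v0_generates: "subspace W \<Longrightarrow> v0 \<in> W \<Longrightarrow>
        (\<And>h w. w \<in> W \<Longrightarrow> hop h w \<in> W) \<Longrightarrow>
        (\<And>\<beta> x w. \<beta> \<in> cpt \<Longrightarrow> x \<in> X \<beta> \<Longrightarrow> w \<in> W \<Longrightarrow> x w \<in> W) \<Longrightarrow> W = UNIV"
    and D_linear: "Vector_Spaces.linear sc sc D"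
    and D_v0: "D v0 = 0"
    and D_X: "\<beta> \<in> roots \<Longrightarrow> x \<in> X \<beta> \<Longrightarrow> D (x v) = x (D v) + sc (\<i> * of_real (en \<beta>)) (x v)"
    and en_uminus: "\<beta> \<in> cpt \<Longrightarrow> en (- \<beta>) = - en \<beta>"
begin

definition weight_vectors :: "('h \<Rightarrow> complex) \<Rightarrow> 'v set" where
  "weight_vectors \<gamma> = {v. \<forall>h. hop h v = sc (\<gamma> h) v}"

definition weights :: "('h \<Rightarrow> complex) set" where
  "weights = {\<gamma>. \<exists>v\<in>weight_vectors \<gamma>. v \<noteq> 0}"

definition reflect :: "'b \<Rightarrow> ('h \<Rightarrow> complex) \<Rightarrow> 'h \<Rightarrow> complex" where
  "reflect \<beta> \<gamma> = (\<lambda>h. \<gamma> h - \<gamma> (co \<beta>) * rt \<beta> h)"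

abbreviation orbit :: "'b set \<Rightarrow> (('h \<Rightarrow> complex) \<times> real) set" where
  "orbit \<equiv> reflection_orbit rt co en \<Lambda>"

text \<open>The vectors \<open>x\<^sub>1 \<dots> x\<^sub>k u\<close> with \<open>x\<^sub>j\<close> a root operator for a root in \<open>B\<close>, together with their weight
  and energy, given those of \<open>u\<close>. Keeping track of both is necessary since a vanishing
  monomial does not determine them.\<close>

inductive monomial :: "'b set \<Rightarrow> 'v \<Rightarrow> ('h \<Rightarrow> complex) \<Rightarrow> real \<Rightarrow> 'v \<Rightarrow> ('h \<Rightarrow> complex) \<Rightarrow> real \<Rightarrow> bool"
  for B u \<gamma> r where
  monomial_base: "monomial B u \<gamma> r u \<gamma> r"
| monomial_step: "monomial B u \<gamma> r w \<gamma>' r' \<Longrightarrow> \<beta> \<in> B \<Longrightarrow> x \<in> X \<beta> \<Longrightarrow> monomial B u \<gamma> r (x w) (\<gamma>' + rt \<beta>) (r' + en \<beta>)"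

lemma X_weight_vectors:
  assumes "\<beta> \<in> roots" "x \<in> X \<beta>" "v \<in> weight_vectors \<gamma>"
  shows "x v \<in> weight_vectors (\<gamma> + rt \<beta>)"
proof -
  interpret L: Vector_Spaces.linear sc sc x using assms X_linear by blast
  show ?thesis
    using assms hop_X[OF assms(1,2)] unfolding weight_vectors_def by (auto simp: L.scale scale_left_distrib)
qed

lemma X_pow_weight_vectors:
  assumes "\<beta> \<in> roots" "x \<in> X \<beta>" "v \<in> weight_vectors \<gamma>"
  shows "(x ^^ n) v \<in> weight_vectors (\<lambda>h. \<gamma> h + of_nat n * rt \<beta> h)"
proof (induction n)
  case 0
  then show ?case using assms by simp
next
  case (Suc n)
  have "(\<lambda>h. \<gamma> h + of_nat n * rt \<beta> h) + rt \<beta> = (\<lambda>h. \<gamma> h + of_nat (Suc n) * rt \<beta> h)"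
    by (auto simp: fun_eq_iff algebra_simps)
  then show ?case using X_weight_vectors[OF assms(1,2) Suc] by simp
qed

lemma X_eigen_D:
  assumes "\<beta> \<in> roots" "x \<in> X \<beta>" "D v = sc (\<i> * of_real r) v"
  shows "D (x v) = sc (\<i> * of_real (r + en \<beta>)) (x v)"
proof -
  interpret L: Vector_Spaces.linear sc sc x using assms X_linear by blast
  have "\<i> * of_real (r + en \<beta>) = \<i> * of_real r + \<i> * of_real (en \<beta>)" by (simp add: distrib_left)
  then show ?thesis by (simp only: D_X[OF assms(1,2)] assms(3) L.scale scale_left_distrib)
qed

lemma X_pow_eigen_D:
  assumes "\<beta> \<in> roots" "x \<in> X \<beta>" "D v = sc (\<i> * of_real r) v"
  shows "D ((x ^^ n) v) = sc (\<i> * of_real (r + of_nat n * en \<beta>)) ((x ^^ n) v)"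
proof (induction n)
  case 0
  then show ?case using assms by simp
next
  case (Suc n)
  have "r + of_nat n * en \<beta> + en \<beta> = r + of_nat (Suc n) * en \<beta>" by (simp add: distrib_right)
  then show ?case using X_eigen_D[OF assms(1,2) Suc] by (simp only: funpow.simps comp_apply)
qed

lemma monomial_weight_energy:
  assumes "monomial B u \<gamma> r w \<gamma>' r'" "B \<subseteq> roots" "u \<in> weight_vectors \<gamma>" "D u = sc (\<i> * of_real r) u"
  shows "w \<in> weight_vectors \<gamma>' \<and> D w = sc (\<i> * of_real r') w"
  using assms(1)
proof induction
  case monomial_base
  then show ?case using assms by simp
next
  case (monomial_step w \<gamma>' r' \<beta> x)
  then have "\<beta> \<in> roots" using assms by blast
  with monomial_step show ?case using X_weight_vectors X_eigen_D by blast
qed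

lemma monomial_mono:
  assumes "monomial B u \<gamma> r w \<gamma>' r'" "B \<subseteq> B'"
  shows "monomial B' u \<gamma> r w \<gamma>' r'"
  using assms by induction (auto intro: monomial.intros)

lemma monomial_finite:
  assumes "monomial B u \<gamma> r w \<gamma>' r'"
  shows "\<exists>F\<subseteq>B. finite F \<and> monomial F u \<gamma> r w \<gamma>' r'"
  using assms
proof induction
  case monomial_base
  then show ?case by (intro exI[of _ "{}"]) (auto intro: monomial.monomial_base)
next
  case (monomial_step w \<gamma>' r' \<beta> x)
  then obtain F where F: "F \<subseteq> B" "finite F" "monomial F u \<gamma> r w \<gamma>' r'" by blast
  have "monomial (insert \<beta> F) u \<gamma> r w \<gamma>' r'" by (rule monomial_mono[OF F(3)]) auto
  then have "monomial (insert \<beta> F) u \<gamma> r (x w) (\<gamma>' + rt \<beta>) (r' + en \<beta>)"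
    using monomial_step by (intro monomial.monomial_step) auto
  moreover have "insert \<beta> F \<subseteq> B" "finite (insert \<beta> F)" using F monomial_step by auto
  ultimately show ?case by blast
qed

definition monomials :: "'b set \<Rightarrow> 'v \<Rightarrow> ('h \<Rightarrow> complex) \<Rightarrow> real \<Rightarrow> 'v set" where
  "monomials B u \<gamma> r = {w. \<exists>\<gamma>' r'. monomial B u \<gamma> r w \<gamma>' r'}"

lemma linear_span_stable:
  assumes "Vector_Spaces.linear sc sc x" "\<And>w. w \<in> M \<Longrightarrow> x w \<in> span M" "v \<in> span M"
  shows "x v \<in> span M"
proof -
  interpret L: Vector_Spaces.linear sc sc x by (rule assms)
  show ?thesis using assms(3)
  proof (induction rule: span_induct_alt)
    case base
    then show ?case by (simp add: L.zero span_zero)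
  next
    case (step c w y)
    then show ?case using assms(2) by (simp add: L.add L.scale span_add span_scale)
  qed
qed

lemma hop_span_monomials:
  assumes "B \<subseteq> roots" "u \<in> weight_vectors \<gamma>" "D u = sc (\<i> * of_real r) u" "v \<in> span (monomials B u \<gamma> r)"
  shows "hop h v \<in> span (monomials B u \<gamma> r)"
proof (rule linear_span_stable[OF hop_linear _ assms(4)])
  fix w assume w: "w \<in> monomials B u \<gamma> r"
  then obtain \<gamma>' r' where "monomial B u \<gamma> r w \<gamma>' r'" unfolding monomials_def by blast
  then have "hop h w = sc (\<gamma>' h) w" using monomial_weight_energy[OF _ assms(1-3)] by (auto simp: weight_vectors_def)
  then show "hop h w \<in> span (monomials B u \<gamma> r)" using w by (simp add: span_scale span_base)
qed

text \<open>A root operator that does not belong to \<open>A\<close> is moved to the right through a monomial until it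
  reaches \<open>u\<close> and kills it. The commutators that arise act on shorter monomials, either as root
  operators of the closed set \<open>S\<close> or, for opposite roots, by scalars. Taking \<open>A\<close> to be the negative
  roots, this gives the usual spanning set of a highest weight module; taking the roots of
  nonnegative energy, it gives the lower bound on the energies.\<close>

lemma pbw_span_stable:
  assumes S: "S \<subseteq> roots" and clos: "\<And>\<beta> \<beta>'. \<beta> \<in> S \<Longrightarrow> \<beta>' \<in> S \<Longrightarrow> \<beta> + \<beta>' \<in> roots \<Longrightarrow> \<beta> + \<beta>' \<in> S"
    and A: "A \<subseteq> S" and u: "u \<in> weight_vectors \<gamma>" "D u = sc (\<i> * of_real r) u"
    and kill: "\<And>\<beta> x. \<beta> \<in> S - A \<Longrightarrow> x \<in> X \<beta> \<Longrightarrow> x u = 0"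
    and z: "\<delta> \<in> S" "z \<in> X \<delta>" and v: "v \<in> span (monomials A u \<gamma> r)"
  shows "z v \<in> span (monomials A u \<gamma> r)"
proof -
  let ?M = "monomials A u \<gamma> r"
  have stepA: "x v \<in> span ?M" if "\<beta> \<in> A" "x \<in> X \<beta>" "v \<in> span ?M" for \<beta> x v
  proof (rule linear_span_stable[OF _ _ that(3)])
    show "Vector_Spaces.linear sc sc x" using that A S X_linear by blast
    fix w assume "w \<in> ?M"
    then show "x w \<in> span ?M" unfolding monomials_def using that by (auto intro!: span_base intro: monomial_step)
  qed
  have *: "z w \<in> span ?M" if "monomial A u \<gamma> r w \<gamma>' r'" "\<delta> \<in> S" "z \<in> X \<delta>" for w \<gamma>' r' \<delta> z
    using that
  proof (induction arbitrary: \<delta> z)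
    case monomial_base
    show ?case
    proof (cases "\<delta> \<in> A")
      case True
      have "u \<in> span ?M" by (rule span_base) (auto simp: monomials_def intro: monomial.monomial_base)
      then show ?thesis by (rule stepA[OF True monomial_base(2)])
    next
      case False
      then have "z u = 0" using kill monomial_base by simp
      then show ?thesis by (simp only: span_zero)
    qed
  next
    case (monomial_step w \<gamma>' r' \<beta> x)
    have \<beta>: "\<beta> \<in> S" "\<beta> \<in> roots" "\<delta> \<in> roots" using monomial_step A S by auto
    have "z (x w) = x (z w) + (z (x w) - x (z w))" by simp
    moreover have "x (z w) \<in> span ?M" using stepA monomial_step by blast
    moreover have "z (x w) - x (z w) \<in> span ?M"
    proof (cases "\<delta> + \<beta> \<in> roots")
      case True
      then have "\<delta> + \<beta> \<in> S" using clos monomial_step \<beta> by blast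
      moreover have "(\<lambda>v. z (x v) - x (z v)) \<in> X (\<delta> + \<beta>)"
        using bracket_root \<beta> True monomial_step by blast
      ultimately show ?thesis using monomial_step.IH by blast
    next
      case False
      show ?thesis
      proof (cases "\<delta> + \<beta> = 0")
        case True
        then obtain h where "z (x w) - x (z w) = hop h w" using bracket_cartan \<beta> monomial_step by metis
        moreover have "w \<in> weight_vectors \<gamma>'" using monomial_weight_energy[OF monomial_step(1)] A S u by blast
        moreover have "w \<in> ?M" using monomial_step(1) unfolding monomials_def by blast
        ultimately show ?thesis unfolding weight_vectors_def by (auto intro: span_scale span_base)
      next
        case F: False
        then show ?thesis using bracket_zero[OF _ _ False F] \<beta> monomial_step span_zero by metis
      qed
    qed
    ultimately show ?case by (metis span_add)
  qed
  show ?thesis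
  proof (rule linear_span_stable[OF _ _ v])
    show "Vector_Spaces.linear sc sc z" using z S X_linear by blast
  qed (use * z in \<open>auto simp: monomials_def\<close>)
qed

lemma v0_weight_vector: "v0 \<in> weight_vectors \<Lambda>" using v0_weight by (simp add: weight_vectors_def)

lemma v0_energy: "D v0 = sc (\<i> * of_real 0) v0" by (simp add: D_v0)

lemma Lambda_weight: "\<Lambda> \<in> weights" using v0_weight_vector v0_nonzero by (auto simp: weights_def)

lemma monomials_span: "span (monomials cpt v0 \<Lambda> 0) = UNIV"
proof (rule v0_generates[OF subspace_span])
  show "v0 \<in> span (monomials cpt v0 \<Lambda> 0)" by (rule span_base) (auto simp: monomials_def intro: monomial_base)
  show "hop h w \<in> span (monomials cpt v0 \<Lambda> 0)" if "w \<in> span (monomials cpt v0 \<Lambda> 0)" for h w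
    by (rule hop_span_monomials[OF cpt_roots v0_weight_vector v0_energy that])
  fix \<beta> x w assume b: "\<beta> \<in> cpt" "x \<in> X \<beta>" "w \<in> span (monomials cpt v0 \<Lambda> 0)"
  show "x w \<in> span (monomials cpt v0 \<Lambda> 0)"
  proof (rule linear_span_stable[OF _ _ b(3)])
    show "Vector_Spaces.linear sc sc x" using b cpt_roots X_linear by blast
  qed (use b in \<open>auto simp: monomials_def intro!: span_base intro: monomial_step\<close>)
qed

text \<open>With \<open>Q\<close> the cone of the positive roots, this says that the weights of a highest weight module are
  obtained from \<open>\<Lambda>\<close> by subtracting positive roots.\<close>

lemma weights_below:
  assumes Q0: "0 \<in> Q" and Qadd: "\<And>a b. a \<in> Q \<Longrightarrow> b \<in> Q \<Longrightarrow> a + b \<in> Q"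
    and pos: "\<And>\<beta>. \<beta> \<in> roots \<Longrightarrow> - rt \<beta> \<in> Q \<or> (\<forall>x\<in>X \<beta>. x v0 = 0)"
    and g: "\<gamma> \<in> weights"
  shows "\<Lambda> - \<gamma> \<in> Q"
proof -
  define A where "A = {\<beta>\<in>roots. - rt \<beta> \<in> Q}"
  let ?M = "monomials A v0 \<Lambda> 0"
  have A: "A \<subseteq> roots" by (auto simp: A_def)
  have "span ?M = UNIV"
  proof (rule v0_generates[OF subspace_span])
    show "v0 \<in> span ?M" by (rule span_base) (auto simp: monomials_def intro: monomial_base)
    show "hop h w \<in> span ?M" if "w \<in> span ?M" for h w
      by (rule hop_span_monomials[OF A v0_weight_vector v0_energy that])
    fix \<beta> x w assume b: "\<beta> \<in> cpt" "x \<in> X \<beta>" "w \<in> span ?M"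
    show "x w \<in> span ?M"
      by (rule pbw_span_stable[OF order.refl _ A v0_weight_vector v0_energy _ _ b(2) b(3)])
        (use pos b cpt_roots in \<open>auto simp: A_def\<close>)
  qed
  obtain v where v: "v \<in> weight_vectors \<gamma>" "v \<noteq> 0" using g by (auto simp: weights_def)
  have wt: "\<Lambda> - \<gamma>' \<in> Q" if "monomial A v0 \<Lambda> 0 w \<gamma>' r'" for w \<gamma>' r'
    using that
  proof induction
    case monomial_base
    show ?case by (simp only: diff_self Q0)
  next
    case (monomial_step w \<gamma>' r' \<beta> x)
    then have "- rt \<beta> \<in> Q" by (simp only: A_def mem_Collect_eq)
    then have "(\<Lambda> - \<gamma>') + (- rt \<beta>) \<in> Q" using Qadd monomial_step.IH by blast
    moreover have "(\<Lambda> - \<gamma>') + (- rt \<beta>) = \<Lambda> - (\<gamma>' + rt \<beta>)" by (rule ext) simp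
    ultimately show ?case by (simp only:)
  qed
  have "?M \<subseteq> {w. \<exists>g'\<in>{\<gamma>'. \<Lambda> - \<gamma>' \<in> Q}. \<forall>h. hop h w = sc (g' h) w}"
    using wt monomial_weight_energy[OF _ A v0_weight_vector v0_energy] by (fastforce simp: monomials_def weight_vectors_def)
  then have "v \<in> span {w. \<exists>g'\<in>{\<gamma>'. \<Lambda> - \<gamma>' \<in> Q}. \<forall>h. hop h w = sc (g' h) w}"
    using \<open>span ?M = UNIV\<close> span_mono by blast
  from eigenvalue_of_span[OF hop_linear v(2) _ this] v show ?thesis by (simp add: weight_vectors_def)
qed

text \<open>\<open>D\<close> is diagonal on monomials, so an eigenvector in their span has the energy of one of them.\<close>

lemma energy_of_monomial:
  assumes "v \<noteq> 0" "D v = sc (\<i> * of_real E) v" "v \<in> span (monomials B u \<gamma> r)"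
    and B: "B \<subseteq> roots" and u: "u \<in> weight_vectors \<gamma>" "D u = sc (\<i> * of_real r) u"
  shows "\<exists>w \<gamma>'. monomial B u \<gamma> r w \<gamma>' E \<and> w \<noteq> 0"
proof -
  let ?G = "{g :: unit \<Rightarrow> complex. \<exists>w \<gamma>' r'. monomial B u \<gamma> r w \<gamma>' r' \<and> w \<noteq> 0 \<and> g () = \<i> * of_real r'}"
  let ?S = "{w. \<exists>g'\<in>?G. \<forall>i::unit. D w = sc (g' i) w}"
  have "w \<in> span ?S" if w: "w \<in> monomials B u \<gamma> r" for w
  proof (cases "w = 0")
    case True
    then show ?thesis by (simp add: span_zero)
  next
    case False
    obtain \<gamma>' r' where m: "monomial B u \<gamma> r w \<gamma>' r'" using w unfolding monomials_def by blast
    then have "D w = sc (\<i> * of_real r') w" using monomial_weight_energy[OF _ B u] by blast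
    then have "w \<in> ?S" using m False by (intro CollectI bexI[of _ "\<lambda>_. \<i> * of_real r'"]) auto
    then show ?thesis by (rule span_base)
  qed
  then have "v \<in> span ?S" using assms(3) span_minimal[OF _ subspace_span] by blast
  from eigenvalue_of_span[of "\<lambda>_. D" v "\<lambda>_. \<i> * of_real E", OF D_linear assms(1) assms(2) this]
  show ?thesis by auto
qed

lemma string_commutators:
  assumes b: "\<beta> \<in> cpt" and e: "e \<in> X \<beta>" and f: "f \<in> X (- \<beta>)"
    and ef: "\<And>v. e (f v) - f (e v) = hop (co \<beta>) v" and u: "u \<in> weight_vectors \<gamma>"
  shows "e (f ((f ^^ j) u)) - f (e ((f ^^ j) u)) = sc (\<gamma> (co \<beta>) - 2 * of_nat j) ((f ^^ j) u)"
    and "f (e ((e ^^ j) u)) - e (f ((e ^^ j) u)) = sc (- \<gamma> (co \<beta>) - 2 * of_nat j) ((e ^^ j) u)"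
proof -
  have r: "\<beta> \<in> roots" "- \<beta> \<in> roots" using b cpt_roots cpt_uminus by auto
  show "e (f ((f ^^ j) u)) - f (e ((f ^^ j) u)) = sc (\<gamma> (co \<beta>) - 2 * of_nat j) ((f ^^ j) u)"
    using X_pow_weight_vectors[OF r(2) f u, of j] rt_co[OF b] rt_uminus[OF b] unfolding ef weight_vectors_def
    by (simp add: mult.commute)
  have "f (e ((e ^^ j) u)) - e (f ((e ^^ j) u)) = - hop (co \<beta>) ((e ^^ j) u)"
    unfolding ef[symmetric] by simp
  then show "f (e ((e ^^ j) u)) - e (f ((e ^^ j) u)) = sc (- \<gamma> (co \<beta>) - 2 * of_nat j) ((e ^^ j) u)"
    using X_pow_weight_vectors[OF r(1) e u, of j] rt_co[OF b] unfolding weight_vectors_def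
    by (simp add: mult.commute scale_minus_left[symmetric] del: scale_minus_left)
qed

lemma of_nat_Suc_nonzero: "of_nat (Suc n) \<noteq> (0::complex)" by (simp del: of_nat_Suc)

text \<open>Both signs of \<open>\<gamma>(co \<beta>)\<close> are covered by applying \<open>sl2_reflected_vector\<close> to \<open>(e, f)\<close> and to \<open>(f, e)\<close>.\<close>

lemma weights_reflect:
  assumes b: "\<beta> \<in> cpt" and g: "\<gamma> \<in> weights"
  shows "\<gamma> (co \<beta>) \<in> \<int>" and "reflect \<beta> \<gamma> \<in> weights"
proof -
  obtain e f where e: "e \<in> X \<beta>" and f: "f \<in> X (- \<beta>)"
    and ef: "\<And>v. e (f v) - f (e v) = hop (co \<beta>) v" using sl2[OF b] by blast
  have r: "\<beta> \<in> roots" "- \<beta> \<in> roots" and b': "- \<beta> \<in> cpt" using b cpt_roots cpt_uminus by auto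
  obtain v where v: "v \<in> weight_vectors \<gamma>" "v \<noteq> 0" using g by (auto simp: weights_def)
  have ek: "(e ^^ k) v \<in> weight_vectors (\<lambda>h. \<gamma> h + of_nat k * rt \<beta> h)" for k by (rule X_pow_weight_vectors[OF r(1) e v(1)])
  have fk: "(f ^^ k) v \<in> weight_vectors (\<lambda>h. \<gamma> h + of_nat k * rt (- \<beta>) h)" for k by (rule X_pow_weight_vectors[OF r(2) f v(1)])
  note s1 = string_commutators(1)[OF b e f ef ek] and s2 = string_commutators(2)[OF b e f ef fk]
  have c1: "e (f ((f ^^ j) ((e ^^ k) v))) - f (e ((f ^^ j) ((e ^^ k) v)))
      = sc (\<gamma> (co \<beta>) + 2 * of_nat k - 2 * of_nat j) ((f ^^ j) ((e ^^ k) v))" for j k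
    using s1[of j k] by (simp add: rt_co[OF b] mult.commute)
  have c2: "f (e ((e ^^ j) ((f ^^ k) v))) - e (f ((e ^^ j) ((f ^^ k) v)))
      = sc (- \<gamma> (co \<beta>) + 2 * of_nat k - 2 * of_nat j) ((e ^^ j) ((f ^^ k) v))" for j k
    using s2[of j k] by (simp add: rt_co[OF b] rt_uminus[OF b] mult.commute)
  obtain n where n: "\<gamma> (co \<beta>) = of_int n" "0 \<le> n \<Longrightarrow> \<exists>k. (f ^^ (k + nat n)) ((e ^^ k) v) \<noteq> 0"
    using sl2_reflected_vector[OF of_nat_Suc_nonzero X_linear[OF r(1) e] X_linear[OF r(2) f] c1 v(2)
      nilpotent[OF b e] nilpotent[OF b' f]] by blast
  obtain n' where n': "- \<gamma> (co \<beta>) = of_int n'" "0 \<le> n' \<Longrightarrow> \<exists>k. (e ^^ (k + nat n')) ((f ^^ k) v) \<noteq> 0"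
    using sl2_reflected_vector[OF of_nat_Suc_nonzero X_linear[OF r(2) f] X_linear[OF r(1) e] c2 v(2)
      nilpotent[OF b' f] nilpotent[OF b e]] by blast
  show "\<gamma> (co \<beta>) \<in> \<int>" by (simp add: n(1))
  show "reflect \<beta> \<gamma> \<in> weights"
  proof (cases "0 \<le> n")
    case True
    then obtain k where k: "(f ^^ (k + nat n)) ((e ^^ k) v) \<noteq> 0" using n(2) by blast
    have "(\<lambda>h. \<gamma> h + of_nat k * rt \<beta> h + of_nat (k + nat n) * rt (- \<beta>) h) = reflect \<beta> \<gamma>"
      using True by (simp add: reflect_def n(1) rt_uminus[OF b] fun_eq_iff algebra_simps)
    then show ?thesis using X_pow_weight_vectors[OF r(2) f ek[of k], of "k + nat n"] k by (auto simp: weights_def)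
  next
    case False
    have "of_int n' = (of_int (- n) :: complex)" using n'(1) n(1) by simp
    then have nn: "n' = - n" by (simp only: of_int_eq_iff)
    then obtain k where k: "(e ^^ (k + nat n')) ((f ^^ k) v) \<noteq> 0" using n'(2) False by auto
    have "(\<lambda>h. \<gamma> h + of_nat k * rt (- \<beta>) h + of_nat (k + nat n') * rt \<beta> h) = reflect \<beta> \<gamma>"
      using False by (simp add: nn reflect_def n(1) rt_uminus[OF b] fun_eq_iff algebra_simps)
    then show ?thesis using X_pow_weight_vectors[OF r(1) e fk[of k], of "k + nat n'"] k by (auto simp: weights_def)
  qed
qed

lemma reflect_reflect: "\<beta> \<in> cpt \<Longrightarrow> reflect \<beta> (reflect \<beta> \<gamma>) = \<gamma>"
  unfolding reflect_def by (rule ext) (simp add: rt_co)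

lemma reflect_add: "reflect \<beta> (\<gamma> + \<eta>) = reflect \<beta> \<gamma> + reflect \<beta> \<eta>"
  unfolding reflect_def by (rule ext) (simp add: distrib_right)

lemma reflect_diff: "reflect \<beta> (\<gamma> - \<eta>) = reflect \<beta> \<gamma> - reflect \<beta> \<eta>"
  unfolding reflect_def by (rule ext) (simp add: left_diff_distrib)

text \<open>No two weights have \<open>\<gamma>\<close> as their midpoint, unless they are equal. This replaces dominance: it is
  visibly invariant under the affine bijections \<open>reflect \<beta>\<close> of the set of weights, and it implies
  that \<open>\<gamma> + rt \<beta>\<close> or \<open>\<gamma> - rt \<beta>\<close> is not a weight when \<open>\<beta>\<close> is compact.\<close>

definition extreme :: "('h \<Rightarrow> complex) \<Rightarrow> bool" where
  "extreme \<gamma> \<longleftrightarrow> (\<forall>\<eta>. \<gamma> + \<eta> \<in> weights \<longrightarrow> \<gamma> - \<eta> \<in> weights \<longrightarrow> \<eta> = 0)"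

lemma extreme_reflect:
  assumes b: "\<beta> \<in> cpt" and "extreme \<gamma>"
  shows "extreme (reflect \<beta> \<gamma>)"
  unfolding extreme_def
proof (intro allI impI)
  fix \<eta> assume a: "reflect \<beta> \<gamma> + \<eta> \<in> weights" "reflect \<beta> \<gamma> - \<eta> \<in> weights"
  have "\<gamma> + reflect \<beta> \<eta> \<in> weights" "\<gamma> - reflect \<beta> \<eta> \<in> weights"
    using weights_reflect(2)[OF b a(1)] weights_reflect(2)[OF b a(2)]
    by (simp_all only: reflect_add reflect_diff reflect_reflect[OF b])
  then have "reflect \<beta> \<eta> = 0" using assms(2) unfolding extreme_def by blast
  then have "\<eta> = reflect \<beta> 0" using reflect_reflect[OF b, of \<eta>] by metis
  then show "\<eta> = 0" by (simp add: reflect_def zero_fun_def)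
qed

lemma orbit_extreme_weight:
  assumes "(\<gamma>, r) \<in> orbit B" "B \<subseteq> cpt" "extreme \<Lambda>"
  shows "\<gamma> \<in> weights \<and> extreme \<gamma>"
  using assms
proof (induction rule: reflection_orbit.induct)
  case orbit_base
  then show ?case using Lambda_weight by simp
next
  case (orbit_step \<gamma> r \<beta>)
  then have "\<beta> \<in> cpt" by blast
  with orbit_step have "reflect \<beta> \<gamma> \<in> weights" "extreme (reflect \<beta> \<gamma>)" using weights_reflect(2) extreme_reflect by blast+
  then show ?case unfolding reflect_def by (rule conjI)
qed

definition stable :: "'b set \<Rightarrow> 'v set \<Rightarrow> bool" where
  "stable S W \<longleftrightarrow> subspace W \<and> (\<forall>\<beta>\<in>S. \<forall>x\<in>X \<beta>. \<forall>w\<in>W. x w \<in> W)"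

lemma stable_pow: "stable S W \<Longrightarrow> \<beta> \<in> S \<Longrightarrow> x \<in> X \<beta> \<Longrightarrow> w \<in> W \<Longrightarrow> (x ^^ n) w \<in> W"
  by (induction n) (auto simp: stable_def)

text \<open>At an extreme weight, \<open>u\<close> is an end of its \<open>\<beta>\<close>-string, and its reflection is the other end. The
  string can be climbed back, which is why \<open>u\<close> lies in every stable subspace that contains the new
  vector.\<close>

lemma extremal_step:
  assumes b: "\<beta> \<in> cpt" and S: "\<beta> \<in> S" "- \<beta> \<in> S" and ex: "extreme \<gamma>"
    and u: "u \<in> weight_vectors \<gamma>" "u \<noteq> 0" "D u = sc (\<i> * of_real r) u"
  obtains u' where "u' \<in> weight_vectors (reflect \<beta> \<gamma>)" "u' \<noteq> 0" "D u' = sc (\<i> * of_real (r - Re (\<gamma> (co \<beta>)) * en \<beta>)) u'"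
    "\<And>W. stable S W \<Longrightarrow> u' \<in> W \<Longrightarrow> u \<in> W"
proof -
  obtain e f where e: "e \<in> X \<beta>" and f: "f \<in> X (- \<beta>)"
    and ef: "\<And>v. e (f v) - f (e v) = hop (co \<beta>) v" using sl2[OF b] by blast
  have r: "\<beta> \<in> roots" "- \<beta> \<in> roots" and b': "- \<beta> \<in> cpt" using b cpt_roots cpt_uminus by auto
  have nz: "rt \<beta> \<noteq> 0" using rt_co[OF b] by auto
  have unscale: "u \<in> W" if "sc c u \<in> W" "c \<noteq> 0" "stable S W" for c W
  proof -
    have "sc (inverse c) (sc c u) \<in> W" using that subspace_scale unfolding stable_def by blast
    then show ?thesis using that by simp
  qed
  show ?thesis
  proof (cases "\<gamma> + rt \<beta> \<in> weights")
    case False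
    then have eu: "e u = 0" using X_weight_vectors[OF r(1) e u(1)] by (auto simp: weights_def)
    obtain l where l: "\<gamma> (co \<beta>) = of_nat l" "\<And>j. j \<le> l \<Longrightarrow> (f ^^ j) u \<noteq> 0"
      "\<exists>c. c \<noteq> 0 \<and> (e ^^ l) ((f ^^ l) u) = sc c u"
      by (rule sl2_highest[OF of_nat_Suc_nonzero X_linear[OF r(1) e] X_linear[OF r(2) f]
          string_commutators(1)[OF b e f ef u(1)] eu u(2) nilpotent[OF b' f]]) blast
    show ?thesis
    proof (rule that[of "(f ^^ l) u"])
      have "(\<lambda>h. \<gamma> h + of_nat l * rt (- \<beta>) h) = reflect \<beta> \<gamma>"
        by (simp add: reflect_def l(1) rt_uminus[OF b] fun_eq_iff)
      then show "(f ^^ l) u \<in> weight_vectors (reflect \<beta> \<gamma>)" using X_pow_weight_vectors[OF r(2) f u(1), of l] by simp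
      show "(f ^^ l) u \<noteq> 0" using l(2) by simp
      show "D ((f ^^ l) u) = sc (\<i> * of_real (r - Re (\<gamma> (co \<beta>)) * en \<beta>)) ((f ^^ l) u)"
        using X_pow_eigen_D[OF r(2) f u(3), of l] by (simp add: en_uminus[OF b] l(1))
      show "u \<in> W" if "stable S W" "(f ^^ l) u \<in> W" for W
        using l(3) stable_pow[OF that(1) S(1) e that(2), of l] unscale that by metis
    qed
  next
    case True
    then have "\<gamma> - rt \<beta> \<notin> weights" using ex nz unfolding extreme_def by blast
    then have fu: "f u = 0" using X_weight_vectors[OF r(2) f u(1)] by (auto simp: weights_def rt_uminus[OF b])
    obtain l where l: "- \<gamma> (co \<beta>) = of_nat l" "\<And>j. j \<le> l \<Longrightarrow> (e ^^ j) u \<noteq> 0"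
      "\<exists>c. c \<noteq> 0 \<and> (f ^^ l) ((e ^^ l) u) = sc c u"
      by (rule sl2_highest[OF of_nat_Suc_nonzero X_linear[OF r(2) f] X_linear[OF r(1) e]
          string_commutators(2)[OF b e f ef u(1)] fu u(2) nilpotent[OF b e]]) blast
    have l': "\<gamma> (co \<beta>) = - of_nat l" using l(1) by (metis minus_minus)
    show ?thesis
    proof (rule that[of "(e ^^ l) u"])
      have "(\<lambda>h. \<gamma> h + of_nat l * rt \<beta> h) = reflect \<beta> \<gamma>"
        by (simp add: reflect_def l' fun_eq_iff)
      then show "(e ^^ l) u \<in> weight_vectors (reflect \<beta> \<gamma>)" using X_pow_weight_vectors[OF r(1) e u(1), of l] by simp
      show "(e ^^ l) u \<noteq> 0" using l(2) by simp
      show "D ((e ^^ l) u) = sc (\<i> * of_real (r - Re (\<gamma> (co \<beta>)) * en \<beta>)) ((e ^^ l) u)"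
        using X_pow_eigen_D[OF r(1) e u(3), of l] by (simp add: l')
      show "u \<in> W" if "stable S W" "(e ^^ l) u \<in> W" for W
        using l(3) stable_pow[OF that(1) S(2) f that(2), of l] unscale that by metis
    qed
  qed
qed

lemma extremal_vector:
  assumes "(\<gamma>, r) \<in> orbit (S \<inter> cpt)" and ex: "extreme \<Lambda>"
    and S: "\<And>\<beta>. \<beta> \<in> S \<inter> cpt \<Longrightarrow> - \<beta> \<in> S"
  shows "\<exists>u\<in>weight_vectors \<gamma>. u \<noteq> 0 \<and> D u = sc (\<i> * of_real r) u \<and> (\<forall>W. stable S W \<longrightarrow> u \<in> W \<longrightarrow> v0 \<in> W)"
  using assms(1)
proof induction
  case orbit_base
  show ?case using v0_weight_vector v0_nonzero v0_energy by blast
next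
  case (orbit_step \<gamma> r \<beta>)
  then obtain u where u: "u \<in> weight_vectors \<gamma>" "u \<noteq> 0" "D u = sc (\<i> * of_real r) u"
    "\<And>W. stable S W \<Longrightarrow> u \<in> W \<Longrightarrow> v0 \<in> W" by blast
  have g: "extreme \<gamma>" using orbit_extreme_weight[OF orbit_step(1) _ ex] by blast
  obtain u' where "u' \<in> weight_vectors (reflect \<beta> \<gamma>)" "u' \<noteq> 0" "D u' = sc (\<i> * of_real (r - Re (\<gamma> (co \<beta>)) * en \<beta>)) u'"
    "\<And>W. stable S W \<Longrightarrow> u' \<in> W \<Longrightarrow> u \<in> W"
    by (rule extremal_step[of \<beta> S, OF _ _ _ g u(1-3)]) (use orbit_step S in blast)+
  then show ?case using u(4) unfolding reflect_def[of \<beta> \<gamma>, symmetric] by blast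
qed

text \<open>Otherwise the root operators of \<open>\<alpha>\<close> vanish, hence so does the action of its coroot. All
  weights vanish there, so \<open>\<alpha>'\<close>, which does not, cannot connect two weights either, and \<open>\<Lambda>\<close>
  vanishes at both coroots. For nonzero level the hypotheses hold when \<open>\<alpha>'\<close> is \<open>\<alpha>\<close> plus a null root.\<close>

lemma weight_step_exists:
  assumes a: "\<alpha> \<in> cpt" "\<alpha>' \<in> cpt" and "rt \<alpha>' (co \<alpha>) \<noteq> 0" "\<Lambda> (co \<alpha>) \<noteq> \<Lambda> (co \<alpha>')"
  shows "\<exists>\<gamma>\<in>weights. \<gamma> + rt \<alpha> \<in> weights"
proof (rule ccontr)
  assume *: "\<not> ?thesis"
  have kill: "hop (co \<beta>) v = 0"
    if b: "\<beta> \<in> cpt" and v: "v \<in> weight_vectors \<gamma>" "\<gamma> + rt \<beta> \<notin> weights" and d: "\<gamma> - rt \<beta> \<notin> weights \<or> (\<forall>\<gamma>\<in>weights. \<gamma> + rt \<beta> \<notin> weights)" for \<beta> v \<gamma>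
  proof -
    obtain e f where e: "e \<in> X \<beta>" and f: "f \<in> X (- \<beta>)"
      and ef: "\<And>v. e (f v) - f (e v) = hop (co \<beta>) v" using sl2[OF b] by blast
    have r: "\<beta> \<in> roots" "- \<beta> \<in> roots" using b cpt_roots cpt_uminus by auto
    interpret E: Vector_Spaces.linear sc sc e by (rule X_linear[OF r(1) e])
    interpret F: Vector_Spaces.linear sc sc f by (rule X_linear[OF r(2) f])
    have ev: "e v = 0" using X_weight_vectors[OF r(1) e v(1)] v(2) by (auto simp: weights_def)
    have fv: "f v \<in> weight_vectors (\<gamma> - rt \<beta>)" using X_weight_vectors[OF r(2) f v(1)] by (simp only: rt_uminus[OF b] add_uminus_conv_diff)
    have "e (f v) = 0"
    proof (cases "f v = 0")
      case False
      then have "\<gamma> - rt \<beta> \<in> weights" using fv unfolding weights_def by blast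
      then have "\<gamma> - rt \<beta> + rt \<beta> \<notin> weights" using d by blast
      then show ?thesis using X_weight_vectors[OF r(1) e fv] unfolding weights_def by blast
    qed (simp add: E.zero)
    then show ?thesis using ef[of v] by (simp add: ev F.zero)
  qed
  have z: "\<gamma> (co \<alpha>) = 0" if g: "\<gamma> \<in> weights" for \<gamma>
  proof -
    obtain v where v: "v \<in> weight_vectors \<gamma>" "v \<noteq> 0" using g unfolding weights_def by blast
    have "hop (co \<alpha>) v = 0" by (rule kill[OF a(1) v(1)]) (use * g in blast)+
    then show ?thesis using v by (simp add: weight_vectors_def)
  qed
  have "\<Lambda> + rt \<alpha>' \<notin> weights" "\<Lambda> - rt \<alpha>' \<notin> weights"
    using z[OF Lambda_weight] z[of "\<Lambda> + rt \<alpha>'"] z[of "\<Lambda> - rt \<alpha>'"] assms(3) by auto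
  then have "hop (co \<alpha>') v0 = 0" using kill[OF a(2) v0_weight_vector] by blast
  then have "\<Lambda> (co \<alpha>') = 0" using v0_weight[of "co \<alpha>'"] v0_nonzero by simp
  then show False using z[OF Lambda_weight] assms(4) by simp
qed

text \<open>If \<open>\<Lambda> - rt \<beta>\<close> is not a weight, then \<open>v0\<close> is a lowest weight vector for the \<open>\<ss>\<ll>\<^sub>2\<close> of \<open>\<beta>\<close>, and its
  weight \<open>\<Lambda>(co \<beta>)\<close> is not positive.\<close>

lemma weight_step_down:
  assumes b: "\<beta> \<in> cpt" and pos: "Re (\<Lambda> (co \<beta>)) > 0"
  shows "\<Lambda> - rt \<beta> \<in> weights"
proof (rule ccontr)
  assume down: "\<Lambda> - rt \<beta> \<notin> weights"
  obtain e f where e: "e \<in> X \<beta>" and f: "f \<in> X (- \<beta>)"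
    and ef: "\<And>v. e (f v) - f (e v) = hop (co \<beta>) v" using sl2[OF b] by blast
  have r: "\<beta> \<in> roots" "- \<beta> \<in> roots" using b cpt_roots cpt_uminus by auto
  have fu: "f v0 = 0" using X_weight_vectors[OF r(2) f v0_weight_vector] down by (auto simp: weights_def rt_uminus[OF b])
  obtain l where l: "- \<Lambda> (co \<beta>) = of_nat l"
    by (rule sl2_highest[OF of_nat_Suc_nonzero X_linear[OF r(2) f] X_linear[OF r(1) e]
        string_commutators(2)[OF b e f ef v0_weight_vector] fu v0_nonzero nilpotent[OF b e]]) blast
  then have "Re (- \<Lambda> (co \<beta>)) = of_nat l" by simp
  then show False using pos by simp
qed

lemma orbit_pairing_integral:
  assumes "(\<gamma>, r) \<in> orbit B" "B \<subseteq> cpt" "extreme \<Lambda>" "\<beta> \<in> cpt"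
  shows "\<gamma> (co \<beta>) \<in> \<int>"
  using orbit_extreme_weight[OF assms(1-3)] weights_reflect(1)[OF assms(4)] by blast

text \<open>Imaginary roots vanish on coroots, so they are fixed by all reflections.\<close>

lemma imaginary_orbit:
  assumes "(\<gamma>, r) \<in> orbit B" "B \<subseteq> cpt" and \<delta>: "\<delta> \<in> roots - cpt" and "\<gamma> + rt \<delta> \<in> weights"
  shows "\<Lambda> + rt \<delta> \<in> weights"
  using assms(1,4)
proof (induction rule: reflection_orbit.induct)
  case orbit_base
  then show ?case by simp
next
  case (orbit_step \<gamma> r \<beta>)
  then have b: "\<beta> \<in> cpt" using assms by blast
  have "reflect \<beta> (rt \<delta>) = rt \<delta>" using rt_imaginary[OF \<delta> b] by (simp add: reflect_def)
  then have "reflect \<beta> (reflect \<beta> \<gamma> + rt \<delta>) = \<gamma> + rt \<delta>" by (simp add: reflect_add reflect_reflect[OF b])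
  then have "\<gamma> + rt \<delta> \<in> weights" using weights_reflect(2)[OF b orbit_step(4)[folded reflect_def]] by (simp only:)
  then show ?case by (rule orbit_step(3))
qed

text \<open>The central estimate. The infimum of the orbit energies need not be attained, but since the negative
  energies of the roots in \<open>S\<close> are at most \<open>- \<epsilon>\<close>, a weight with energy less than \<open>\<epsilon>\<close> above the
  infimum behaves as if it were minimal.\<close>

lemma orbit_energy_bound:
  assumes S: "S \<subseteq> roots" and clos: "\<And>\<beta> \<beta>'. \<beta> \<in> S \<Longrightarrow> \<beta>' \<in> S \<Longrightarrow> \<beta> + \<beta>' \<in> roots \<Longrightarrow> \<beta> + \<beta>' \<in> S"
    and sym: "\<And>\<beta>. \<beta> \<in> S \<inter> cpt \<Longrightarrow> - \<beta> \<in> S"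
    and eps: "\<epsilon> > 0" "\<And>\<beta>. \<beta> \<in> S \<Longrightarrow> en \<beta> < 0 \<Longrightarrow> en \<beta> \<le> - \<epsilon>"
    and ex: "extreme \<Lambda>"
    and imag: "\<And>\<beta>. \<beta> \<in> S - cpt \<Longrightarrow> en \<beta> < 0 \<Longrightarrow> \<Lambda> + rt \<beta> \<notin> weights"
    and bdd: "\<And>\<gamma> r. (\<gamma>, r) \<in> orbit (S \<inter> cpt) \<Longrightarrow> m \<le> r"
    and w: "monomial (S \<inter> cpt) v0 \<Lambda> 0 w \<gamma>\<^sub>w E" "w \<noteq> 0"
  shows "m \<le> E"
proof -
  let ?O = "snd ` orbit (S \<inter> cpt)"
  have bb: "bdd_below ?O" using bdd by (intro bdd_belowI[of _ m]) auto
  have ne: "?O \<noteq> {}" using reflection_orbit.orbit_base by blast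
  have "Inf ?O < Inf ?O + \<epsilon>" using eps by simp
  then obtain \<gamma> r where \<gamma>: "(\<gamma>, r) \<in> orbit (S \<inter> cpt)" and r: "r < Inf ?O + \<epsilon>"
    using cInf_lessD[OF ne] by fastforce
  obtain u where u: "u \<in> weight_vectors \<gamma>" "u \<noteq> 0" "D u = sc (\<i> * of_real r) u"
    and gen: "\<And>W. stable S W \<Longrightarrow> u \<in> W \<Longrightarrow> v0 \<in> W" using extremal_vector[OF \<gamma> ex sym] by blast
  define A where "A = {\<beta>\<in>S. en \<beta> \<ge> 0}"
  have A: "A \<subseteq> S" by (auto simp: A_def)
  have \<gamma>ex: "extreme \<gamma>" using orbit_extreme_weight[OF \<gamma> _ ex] by blast
  have kill: "x u = 0" if "\<beta> \<in> S - A" "x \<in> X \<beta>" for \<beta> x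
  proof -
    have \<beta>: "\<beta> \<in> S" "en \<beta> < 0" "\<beta> \<in> roots" using that S by (auto simp: A_def)
    have "\<gamma> + rt \<beta> \<notin> weights"
    proof (cases "\<beta> \<in> cpt")
      case False
      then show ?thesis using imaginary_orbit[OF \<gamma>, of \<beta>] imag \<beta> by auto
    next
      case b: True
      show ?thesis
      proof
        assume up: "\<gamma> + rt \<beta> \<in> weights"
        have nz: "rt \<beta> \<noteq> 0" using rt_co[OF b] by auto
        then have down: "\<gamma> - rt \<beta> \<notin> weights" using \<gamma>ex up unfolding extreme_def by blast
        obtain e f where e: "e \<in> X \<beta>" and f: "f \<in> X (- \<beta>)"
          and ef: "\<And>v. e (f v) - f (e v) = hop (co \<beta>) v" using sl2[OF b] by blast
        have rr: "- \<beta> \<in> roots" and b': "- \<beta> \<in> cpt" using b cpt_roots cpt_uminus by auto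
        have fu: "f u = 0" using X_weight_vectors[OF rr f u(1)] down by (auto simp: weights_def rt_uminus[OF b])
        obtain l where l: "- \<gamma> (co \<beta>) = of_nat l"
          by (rule sl2_highest[OF of_nat_Suc_nonzero X_linear[OF rr f] X_linear[OF \<beta>(3) e]
              string_commutators(2)[OF b e f ef u(1)] fu u(2) nilpotent[OF b e]]) blast
        have l': "\<gamma> (co \<beta>) = - of_nat l" using l by (metis minus_minus)
        (* if \<gamma> were orthogonal to \<beta>, the reflection would exchange \<gamma> + \<beta> and \<gamma> - \<beta> *)
        have "l \<noteq> 0"
        proof
          assume "l = 0"
          then have "reflect \<beta> (\<gamma> + rt \<beta>) = \<gamma> - rt \<beta>"
            by (simp add: reflect_def l' rt_co[OF b] fun_eq_iff)
          then show False using down weights_reflect(2)[OF b up] by simp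
        qed
        (* so the reflection in \<beta> lowers the energy r by l * |en \<beta>| \<ge> \<epsilon>, below the infimum *)
        then have "real l \<ge> 1" by simp
        moreover have "en \<beta> \<le> - \<epsilon>" using eps \<beta> by blast
        ultimately have "real l * en \<beta> \<le> - \<epsilon>"
          using mult_right_mono_neg[OF \<open>real l \<ge> 1\<close>, of "en \<beta>"] \<beta>(2) by linarith
        moreover have "r - Re (\<gamma> (co \<beta>)) * en \<beta> \<in> ?O"
          using reflection_orbit.orbit_step[OF \<gamma>, of \<beta>] b \<beta>(1) by force
        then have "Inf ?O \<le> r - Re (\<gamma> (co \<beta>)) * en \<beta>" by (rule cInf_lower[OF _ bb])
        ultimately show False using r by (simp add: l')
      qed
    qed
    then show ?thesis using X_weight_vectors[OF \<beta>(3) that(2) u(1)] by (auto simp: weights_def)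
  qed
  let ?M = "monomials A u \<gamma> r"
  have "x w \<in> span ?M" if "\<beta> \<in> S" "x \<in> X \<beta>" "w \<in> span ?M" for \<beta> x w
    by (rule pbw_span_stable[OF S _ A u(1,3) _ that]) (use clos kill in blast)+
  then have st: "stable S (span ?M)" unfolding stable_def using subspace_span by blast
  have "v0 \<in> span ?M" by (rule gen[OF st]) (auto simp: monomials_def intro!: span_base intro: monomial_base)
  have "w' \<in> span ?M" if "monomial (S \<inter> cpt) v0 \<Lambda> 0 w' \<gamma>' E'" for w' \<gamma>' E'
    using that by induction (use \<open>v0 \<in> span ?M\<close> st in \<open>auto simp: stable_def\<close>)
  then have w': "w \<in> span ?M" using w by blast
  have Dw: "D w = sc (\<i> * of_real E) w"
    using monomial_weight_energy[OF w(1) _ v0_weight_vector v0_energy] S by blast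
  have "A \<subseteq> roots" using A S by blast
  from energy_of_monomial[OF w(2) Dw w' this u(1,3)] obtain w'' \<gamma>'' where
    "monomial A u \<gamma> r w'' \<gamma>'' E" by blast
  then have "r \<le> E" by induction (auto simp: A_def)
  moreover have "m \<le> r" using bdd \<gamma> by blast
  ultimately show ?thesis by simp
qed

lemma spectrum_monomial:
  assumes "v \<noteq> 0" "D v = sc (\<i> * of_real E) v"
  shows "\<exists>w \<gamma> F. F \<subseteq> cpt \<and> finite F \<and> monomial F v0 \<Lambda> 0 w \<gamma> E \<and> w \<noteq> 0"
proof -
  have "v \<in> span (monomials cpt v0 \<Lambda> 0)" using monomials_span by blast
  from energy_of_monomial[OF assms this cpt_roots v0_weight_vector v0_energy] monomial_finite show ?thesis by metis
qed

end

section \<open>Complexified weight spaces\<close>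

lemma lie_zero [simp]: "lie 0 x = 0" "lie x 0 = (0::'k::hilbert_lie)"
  using lie_scaleR_left[of 0 0 x] lie_scaleR_right[of x 0 0] by simp_all

lemma lie_minus [simp]: "lie (- x) y = - lie x y" "lie x (- y) = - lie x (y::'k::hilbert_lie)"
  using lie_scaleR_left[of "-1" x y] lie_scaleR_right[of x "-1" y] by simp_all

lemma lie_anticommute: "lie y x = - lie x (y::'k::hilbert_lie)"
proof -
  have "0 = lie (x + y) (x + y)" by (simp only: lie_self)
  also have "\<dots> = lie x y + lie y x" unfolding lie_add_left lie_add_right lie_self[of x] lie_self[of y] by (simp add: add.commute)
  finally have "lie y x + lie x y = 0" by (simp only: add.commute)
  then show ?thesis by (simp only: eq_neg_iff_add_eq_0)
qed

lemma inner_lie_skew: "inner (lie h x) y = - inner x (lie h (y::'k::hilbert_lie))"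
  using lie_invariant[of x h y] lie_anticommute[of x h] by simp

lemma lie_diff: "lie (x - y) z = lie x z - lie y z" "lie z (x - y) = lie z x - lie z (y::'k::hilbert_lie)"
  using lie_add_left[of x "- y" z] lie_add_right[of z x "- y"] by simp_all

lemma lie_derivation: "lie h (lie x y) = lie (lie h x) y + lie x (lie h (y::'k::hilbert_lie))"
proof -
  have "lie h (lie x y) - lie x (lie h y) - lie (lie h x) y = 0"
    using lie_jacobi[of h x y] unfolding lie_anticommute[of "lie h x" y] lie_anticommute[of y h] by simp
  then show ?thesis by (simp add: algebra_simps)
qed

lemma vector_space_cscale: "vector_space (cscale :: complex \<Rightarrow> 'a::real_vector \<times> 'a \<Rightarrow> _)"
  by unfold_locales (auto simp: cscale_def algebra_simps)

interpretation CS: vector_space "cscale :: complex \<Rightarrow> 'a::real_vector \<times> 'a \<Rightarrow> _"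
  by (rule vector_space_cscale)

definition conjugate :: "'a::real_vector \<times> 'a \<Rightarrow> 'a \<times> 'a" where
  "conjugate x = (fst x, - snd x)"

text \<open>The complex bilinear, rather than hermitian, extension of the inner product: it is invariant
  under the complexified bracket and enters the cocycle of the affinisation.\<close>

definition bilinear_form :: "'a::real_inner \<times> 'a \<Rightarrow> 'a \<times> 'a \<Rightarrow> complex" where
  "bilinear_form x y = Complex (inner (fst x) (fst y) - inner (snd x) (snd y))
                               (inner (fst x) (snd y) + inner (snd x) (fst y))"

lemma bilinear_form_cscale: "bilinear_form (cscale c x) (cscale d y) = c * d * bilinear_form x y"
  by (auto simp: bilinear_form_def cscale_def complex_eq_iff inner_diff_left inner_diff_right
      inner_add_left inner_add_right algebra_simps)

lemma cbracket_cscale: "cbracket lie (cscale c x) (cscale d y) = cscale (c * d) (cbracket lie x (y::'k::hilbert_lie \<times> 'k))"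
  by (auto simp: cbracket_def cscale_def lie_diff lie_add_left lie_add_right lie_scaleR_left
      lie_scaleR_right algebra_simps)

text \<open>A functional in \<open>im_dual T\<close> is determined by its real values on \<open>iT\<close>, which are linear in \<open>h\<close>.\<close>

definition real_functional :: "('a::real_vector \<times> 'a \<Rightarrow> complex) \<Rightarrow> 'a \<Rightarrow> real" where
  "real_functional \<alpha> h = Re (\<alpha> (0, h))"

lemma im_dual_eval:
  assumes "\<alpha> \<in> im_dual T" "h \<in> T" "subspace T"
  shows "\<alpha> (0, h) = of_real (real_functional \<alpha> h)" "\<alpha> (h, 0) = - \<i> * of_real (real_functional \<alpha> h)"
proof -
  have T0: "0 \<in> T" using assms by (simp add: subspace_0)
  have r: "\<alpha> (0, h) \<in> \<real>" using assms by (auto simp: im_dual_def)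
  then show 1: "\<alpha> (0, h) = of_real (real_functional \<alpha> h)"
    unfolding real_functional_def by (metis Reals_cases Re_complex_of_real)
  have "cscale \<i> (h, 0) = (0, h)" by (simp add: cscale_def)
  moreover have "\<alpha> (cscale \<i> (h, 0)) = \<i> * \<alpha> (h, 0)"
    using assms T0 by (auto simp: im_dual_def cdual_def)
  ultimately have "\<i> * \<alpha> (h, 0) = of_real (real_functional \<alpha> h)" using 1 by simp
  then have "- \<i> * (\<i> * \<alpha> (h, 0)) = - \<i> * of_real (real_functional \<alpha> h)" by simp
  then show "\<alpha> (h, 0) = - \<i> * of_real (real_functional \<alpha> h)" by simp
qed

lemma im_dual_apply:
  assumes "\<alpha> \<in> im_dual T" "h1 \<in> T" "h2 \<in> T" "subspace T"
  shows "\<alpha> (h1, h2) = - \<i> * of_real (real_functional \<alpha> h1) + of_real (real_functional \<alpha> h2)"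
proof -
  have T0: "0 \<in> T" using assms by (simp add: subspace_0)
  have "\<alpha> ((h1, 0) + (0, h2)) = \<alpha> (h1, 0) + \<alpha> (0, h2)"
    using assms T0 unfolding im_dual_def cdual_def by blast
  then show ?thesis using im_dual_eval[OF assms(1) _ assms(4)] assms(2,3) by simp
qed

lemma im_dual_cong:
  assumes "\<alpha> \<in> im_dual T" "\<beta> \<in> im_dual T" "subspace T"
    and "\<And>h. h \<in> T \<Longrightarrow> real_functional \<alpha> h = real_functional \<beta> h"
  shows "\<alpha> = \<beta>"
proof
  fix v :: "'a \<times> 'a"
  show "\<alpha> v = \<beta> v"
  proof (cases "v \<in> T \<times> T")
    case True
    then show ?thesis using im_dual_apply[OF assms(1)] im_dual_apply[OF assms(2)] assms(3,4) by auto
  next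
    case False
    have "\<alpha> v = 0" "\<beta> v = 0" using False assms(1,2) unfolding im_dual_def cdual_def by blast+
    then show ?thesis by simp
  qed
qed

lemma real_functional_linear:
  assumes "\<alpha> \<in> im_dual T" "h \<in> T" "h' \<in> T" "subspace T"
  shows "real_functional \<alpha> (h + h') = real_functional \<alpha> h + real_functional \<alpha> h'"
    and "real_functional \<alpha> (c *\<^sub>R h) = c * real_functional \<alpha> h"
proof -
  have T0: "0 \<in> T" using assms by (simp add: subspace_0)
  have "\<alpha> ((0, h) + (0, h')) = \<alpha> (0, h) + \<alpha> (0, h')"
    using assms T0 unfolding im_dual_def cdual_def by blast
  then show "real_functional \<alpha> (h + h') = real_functional \<alpha> h + real_functional \<alpha> h'"
    by (simp add: real_functional_def)
  have "\<alpha> (cscale (of_real c) (0, h)) = of_real c * \<alpha> (0, h)"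
    using assms T0 unfolding im_dual_def cdual_def by blast
  then show "real_functional \<alpha> (c *\<^sub>R h) = c * real_functional \<alpha> h"
    by (simp add: real_functional_def cscale_def)
qed

lemma cdual_add: "subspace T \<Longrightarrow> \<alpha> \<in> cdual T \<Longrightarrow> \<beta> \<in> cdual T \<Longrightarrow> \<alpha> + \<beta> \<in> cdual T"
  unfolding cdual_def by (auto simp: algebra_simps)

lemma cdual_scale: "\<alpha> \<in> cdual T \<Longrightarrow> (\<lambda>v. c * \<alpha> v) \<in> cdual T"
  unfolding cdual_def by (auto simp: algebra_simps)

lemma im_dual_add: "subspace T \<Longrightarrow> \<alpha> \<in> im_dual T \<Longrightarrow> \<beta> \<in> im_dual T \<Longrightarrow> \<alpha> + \<beta> \<in> im_dual T"
  unfolding im_dual_def using cdual_add by auto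

lemma im_dual_uminus: "\<alpha> \<in> im_dual T \<Longrightarrow> - \<alpha> \<in> im_dual T"
  using cdual_scale[of \<alpha> T "-1"] unfolding im_dual_def by (auto simp: fun_Compl_def)

lemma im_dual_zero: "0 \<in> im_dual T"
  by (auto simp: im_dual_def cdual_def)

lemma real_functional_add: "real_functional (\<alpha> + \<beta>) h = real_functional \<alpha> h + real_functional \<beta> h"
  by (simp add: real_functional_def)

lemma real_functional_uminus: "real_functional (- \<alpha>) h = - real_functional \<alpha> h"
  by (simp add: real_functional_def)

lemma real_functional_zero: "real_functional 0 h = 0"
  by (simp add: real_functional_def)

text \<open>The twisted and the standard affinisation are two instances of this setting with the same \<open>T\<close>.\<close>

locale fixed_cartan =
  fixes \<phi> :: "'k::hilbert_lie \<Rightarrow> 'k" and N :: nat and T :: "'k set"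
  assumes aut: "hl_aut \<phi>" and N_pos: "N > 0"
    and maximal: "maximal_abelian_in (fixed_points \<phi>) T"
begin

lemma T_subspace: "subspace T" and T_fixed: "h \<in> T \<Longrightarrow> \<phi> h = h"
  and T_abelian: "h \<in> T \<Longrightarrow> h' \<in> T \<Longrightarrow> lie h h' = 0"
  using maximal by (auto simp: maximal_abelian_in_def abelian_subalgebra_def fixed_points_def)

lemma T_zero: "0 \<in> T" using T_subspace by (rule subspace_0)

text \<open>Otherwise \<open>T + \<real> a\<close> would be a larger abelian subalgebra of fixed points.\<close>

lemma maximalD:
  assumes "\<phi> a = a" "\<And>h. h \<in> T \<Longrightarrow> lie h a = 0"
  shows "a \<in> T"
proof -
  let ?S = "{h + c *\<^sub>R a |h c. h \<in> T}"
  interpret L: linear \<phi> using aut by (simp add: hl_aut_def)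
  have "subspace ?S"
    unfolding subspace_def
  proof (intro conjI ballI allI)
    show "0 \<in> ?S" using T_zero by (intro CollectI exI[of _ 0] exI[of _ "0::real"]) auto
    fix x y assume "x \<in> ?S" "y \<in> ?S"
    then obtain h c h' c' where "x = h + c *\<^sub>R a" "y = h' + c' *\<^sub>R a" "h \<in> T" "h' \<in> T" by blast
    then show "x + y \<in> ?S"
      using subspace_add[OF T_subspace] by (intro CollectI exI[of _ "h + h'"] exI[of _ "c + c'"]) (auto simp: algebra_simps)
  next
    fix r x assume "x \<in> ?S"
    then obtain h c where "x = h + c *\<^sub>R a" "h \<in> T" by blast
    then show "r *\<^sub>R x \<in> ?S"
      using subspace_scale[OF T_subspace] by (intro CollectI exI[of _ "r *\<^sub>R h"] exI[of _ "r * c"]) (auto simp: algebra_simps)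
  qed
  moreover have "lie a h = 0" if "h \<in> T" for h using assms(2)[OF that] lie_anticommute[of a h] by simp
  then have "lie x y = 0" if "x \<in> ?S" "y \<in> ?S" for x y
    using that assms(2) T_abelian
    by (auto simp: lie_add_left lie_add_right lie_scaleR_left lie_scaleR_right lie_self)
  moreover have "?S \<subseteq> fixed_points \<phi>"
    using T_fixed assms(1) by (auto simp: fixed_points_def L.add L.scale)
  moreover have "x \<in> ?S" if "x \<in> T" for x
    using that by (intro CollectI exI[of _ x] exI[of _ "0::real"]) simp
  then have "T \<subseteq> ?S" by blast
  ultimately have "?S = T" using maximal unfolding maximal_abelian_in_def abelian_subalgebra_def by blast
  moreover have "a \<in> ?S" using T_zero by (intro CollectI exI[of _ 0] exI[of _ 1]) auto
  ultimately show ?thesis by blast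
qed

lemma aut_inv: "\<phi> (inv \<phi> x) = x" "inv \<phi> (\<phi> x) = x"
  using aut by (simp_all add: hl_aut_def bij_is_surj surj_f_inv_f bij_is_inj)

lemma inv_phi_eqI: "\<phi> x = y \<Longrightarrow> inv \<phi> y = x"
  using aut_inv(2)[of x] by simp

lemma inv_phi_linear: "linear (inv \<phi>)"
proof -
  interpret L: linear \<phi> using aut by (simp add: hl_aut_def)
  show ?thesis by (rule linearI) (rule inv_phi_eqI, simp add: L.add L.scale aut_inv)+
qed

lemma inv_phi_lie: "inv \<phi> (lie x y) = lie (inv \<phi> x) (inv \<phi> y)"
proof (rule inv_phi_eqI)
  have "\<phi> (lie (inv \<phi> x) (inv \<phi> y)) = lie (\<phi> (inv \<phi> x)) (\<phi> (inv \<phi> y))"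
    using aut unfolding hl_aut_def by blast
  then show "\<phi> (lie (inv \<phi> x) (inv \<phi> y)) = lie x y" by (simp only: aut_inv)
qed

lemma inv_phi_inner: "inner (inv \<phi> x) (inv \<phi> y) = inner x y"
proof -
  have "inner (\<phi> (inv \<phi> x)) (\<phi> (inv \<phi> y)) = inner (inv \<phi> x) (inv \<phi> y)"
    using aut unfolding hl_aut_def by blast
  then show ?thesis by (simp only: aut_inv)
qed

lemma inv_phi_fixed: "inv \<phi> a = a \<longleftrightarrow> \<phi> a = a"
  using aut_inv by metis

lemma weight_space_iff:
  assumes "\<alpha> \<in> im_dual T"
  shows "x \<in> weight_space_k T \<alpha> \<longleftrightarrow> (\<forall>h\<in>T. lie h (fst x) = real_functional \<alpha> h *\<^sub>R snd x \<and>
      lie h (snd x) = - real_functional \<alpha> h *\<^sub>R fst x)"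
  using im_dual_eval(2)[OF assms _ T_subspace]
  by (auto simp: weight_space_k_def cbracket_def cscale_def)

lemma roots_im_dual: "\<alpha> \<in> insert 0 (roots_k T) \<Longrightarrow> \<alpha> \<in> im_dual T"
  using im_dual_zero by (auto simp: roots_k_def)

lemma weight_space_kD:
  assumes "\<alpha> \<in> insert 0 (roots_k T)" "x \<in> weight_space_k T \<alpha>" "h \<in> T"
  shows "lie h (fst x) = real_functional \<alpha> h *\<^sub>R snd x" "lie h (snd x) = - real_functional \<alpha> h *\<^sub>R fst x"
  using weight_space_iff[OF roots_im_dual[OF assms(1)]] assms by auto

lemma weight_space_cscale:
  assumes "\<alpha> \<in> im_dual T" "x \<in> weight_space_k T \<alpha>"
  shows "cscale c x \<in> weight_space_k T \<alpha>"
  using assms unfolding weight_space_iff[OF assms(1)]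
  by (auto simp: cscale_def lie_diff lie_add_right lie_scaleR_right algebra_simps)

lemma weight_space_diff:
  assumes "\<alpha> \<in> im_dual T" "x \<in> weight_space_k T \<alpha>" "y \<in> weight_space_k T \<alpha>"
  shows "x - y \<in> weight_space_k T \<alpha>"
  using assms unfolding weight_space_iff[OF assms(1)]
  by (auto simp: lie_diff algebra_simps)

lemma weight_space_conjugate:
  assumes "\<alpha> \<in> im_dual T" "x \<in> weight_space_k T \<alpha>"
  shows "conjugate x \<in> weight_space_k T (- \<alpha>)"
  using assms unfolding weight_space_iff[OF assms(1)] weight_space_iff[OF im_dual_uminus[OF assms(1)]]
  by (auto simp: conjugate_def real_functional_uminus)

lemma weight_space_bracket:
  assumes "\<alpha> \<in> im_dual T" "\<beta> \<in> im_dual T" "x \<in> weight_space_k T \<alpha>" "y \<in> weight_space_k T \<beta>"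
  shows "cbracket lie x y \<in> weight_space_k T (\<alpha> + \<beta>)"
  using assms(3,4)
  unfolding weight_space_iff[OF assms(1)] weight_space_iff[OF assms(2)]
    weight_space_iff[OF im_dual_add[OF T_subspace assms(1,2)]]
  by (auto simp: cbracket_def real_functional_add lie_derivation lie_diff lie_add_right lie_add_left
      lie_scaleR_left lie_scaleR_right algebra_simps)

lemma uminus_root: "\<alpha> \<in> roots_k T \<Longrightarrow> - \<alpha> \<in> roots_k T"
proof -
  assume a: "\<alpha> \<in> roots_k T"
  then obtain x where x: "x \<in> weight_space_k T \<alpha>" "x \<noteq> 0"
    unfolding roots_k_def weight_space_k_def by (auto simp: cbracket_def cscale_def)
  have "conjugate x \<in> weight_space_k T (- \<alpha>)" "conjugate x \<noteq> 0"
    using weight_space_conjugate[OF _ x(1)] a x by (auto simp: roots_k_def conjugate_def prod_eq_iff)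
  then show ?thesis using a im_dual_uminus by (fastforce simp: roots_k_def)
qed

text \<open>The operators \<open>lie h\<close> are skew, and some \<open>h\<close> separates the two weights.\<close>

lemma weight_space_orthogonal:
  assumes "\<alpha> \<in> im_dual T" "\<beta> \<in> im_dual T" "\<alpha> \<noteq> \<beta>" "x \<in> weight_space_k T \<alpha>" "y \<in> weight_space_k T \<beta>"
  shows "inner x y = 0"
proof -
  obtain h where h: "h \<in> T" "real_functional \<alpha> h \<noteq> real_functional \<beta> h"
    using im_dual_cong[OF assms(1,2) T_subspace] assms(3) by blast
  obtain a b c d where xy: "x = (a, b)" "y = (c, d)" by (cases x, cases y)
  have ab: "lie h a = real_functional \<alpha> h *\<^sub>R b" "lie h b = - real_functional \<alpha> h *\<^sub>R a"
    using assms(4) h unfolding weight_space_iff[OF assms(1)] xy by auto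
  have cd: "lie h c = real_functional \<beta> h *\<^sub>R d" "lie h d = - real_functional \<beta> h *\<^sub>R c"
    using assms(5) h unfolding weight_space_iff[OF assms(2)] xy by auto
  have "real_functional \<alpha> h * inner b d = - (- real_functional \<beta> h * inner a c)"
    using inner_lie_skew[of h a d] by (simp add: ab cd)
  moreover have "- real_functional \<alpha> h * inner a c = - (real_functional \<beta> h * inner b d)"
    using inner_lie_skew[of h b c] by (simp add: ab cd)
  ultimately have "(real_functional \<alpha> h - real_functional \<beta> h) * (inner a c + inner b d) = 0"
    by (simp add: algebra_simps)
  then show ?thesis using h by (simp add: xy)
qed

lemma bilinear_form_orthogonal:
  assumes "\<alpha> \<in> im_dual T" "\<beta> \<in> im_dual T" "\<alpha> + \<beta> \<noteq> 0" "x \<in> weight_space_k T \<alpha>" "y \<in> weight_space_k T \<beta>"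
  shows "bilinear_form x y = 0"
proof -
  have ne: "\<alpha> \<noteq> - \<beta>" using assms(3) by (metis add.left_inverse)
  have i: "- \<beta> \<in> im_dual T" by (rule im_dual_uminus[OF assms(2)])
  have c: "conjugate y \<in> weight_space_k T (- \<beta>)" by (rule weight_space_conjugate[OF assms(2,5)])
  have "inner x (conjugate y) = 0" "inner x (cscale \<i> (conjugate y)) = 0"
    by (rule weight_space_orthogonal[OF assms(1) i ne assms(4)] c weight_space_cscale[OF i c])+
  then show ?thesis
    by (cases x; cases y) (auto simp: conjugate_def cscale_def bilinear_form_def complex_eq_iff)
qed

section \<open>The diagonal derivation and the dual vectors of weights\<close>

text \<open>Weight spaces are mutually orthogonal, so the components of a vector, and with them the right
  hand side of \<open>Dbar_rel\<close>, are determined by the vector.\<close>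

lemma Dbar_rel_unique:
  assumes "Dbar_rel T \<nu> x y" "Dbar_rel T \<nu> x y'"
  shows "y = y'"
proof -
  let ?I = "insert 0 (roots_k T)"
  obtain c where c: "\<forall>\<alpha>\<in>?I. c \<alpha> \<in> weight_space_k T \<alpha>" "(c has_sum (x, 0)) ?I"
      "((\<lambda>\<alpha>. cscale (\<i> * of_real (pairing T \<nu> \<alpha>)) (c \<alpha>)) has_sum (y, 0)) ?I"
    using assms(1) unfolding Dbar_rel_def by (elim exE conjE)
  obtain c' where c': "\<forall>\<alpha>\<in>?I. c' \<alpha> \<in> weight_space_k T \<alpha>" "(c' has_sum (x, 0)) ?I"
      "((\<lambda>\<alpha>. cscale (\<i> * of_real (pairing T \<nu> \<alpha>)) (c' \<alpha>)) has_sum (y', 0)) ?I"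
    using assms(2) unfolding Dbar_rel_def by (elim exE conjE)
  have "c \<alpha> = c' \<alpha>" if a: "\<alpha> \<in> ?I" for \<alpha>
  proof -
    let ?d = "c \<alpha> - c' \<alpha>"
    have d: "?d \<in> weight_space_k T \<alpha>"
      using weight_space_diff[OF roots_im_dual[OF a]] c(1) c'(1) a by blast
    have "((\<lambda>\<beta>. - c' \<beta>) has_sum - (x, 0)) ?I" unfolding has_sum_uminus using c'(2) by simp
    from has_sum_add[OF c(2) this] have "((\<lambda>\<beta>. c \<beta> - c' \<beta>) has_sum ((x, 0) - (x, 0))) ?I"
      by (simp only: diff_conv_add_uminus)
    then have s: "((\<lambda>\<beta>. inner (c \<beta> - c' \<beta>) ?d) has_sum inner ((x, 0) - (x, 0)) ?d) ?I"
      by (rule has_sum_bounded_linear[OF bounded_linear_inner_left, unfolded o_def])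
    have "inner (c \<beta> - c' \<beta>) ?d = 0" if "\<beta> \<in> ?I - {\<alpha>}" for \<beta>
      using weight_space_orthogonal[OF roots_im_dual roots_im_dual[OF a] _ _ d]
        weight_space_diff[OF roots_im_dual] c(1) c'(1) that by blast
    then have "((\<lambda>\<beta>. inner (c \<beta> - c' \<beta>) ?d) has_sum inner ?d ?d) ?I"
      by (intro has_sum_finite_neutralI[of "{\<alpha>}"]) (use a in auto)
    from has_sum_unique[OF s this] have "inner ?d ?d = 0" by (simp only: diff_self inner_zero_left)
    then show ?thesis by simp
  qed
  then have "((\<lambda>\<alpha>. cscale (\<i> * of_real (pairing T \<nu> \<alpha>)) (c \<alpha>)) has_sum (y', 0)) ?I"
    using c'(3) by (subst has_sum_cong[where g = "\<lambda>\<alpha>. cscale (\<i> * of_real (pairing T \<nu> \<alpha>)) (c' \<alpha>)"]) auto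
  then have "(y, 0) = (y', 0 :: 'k)" using has_sum_unique[OF c(3)] by blast
  then show ?thesis by simp
qed

lemma Dbar_eqI: "Dbar_rel T \<nu> x y \<Longrightarrow> Dbar T \<nu> x = y"
  unfolding Dbar_def by (rule the_equality) (auto intro: Dbar_rel_unique)

lemma sharp_eqI:
  assumes "\<alpha> \<in> im_dual T" "t \<in> T" "\<And>h. h \<in> T \<Longrightarrow> inner h t = real_functional \<alpha> h"
  shows "sharp T \<alpha> = (0, t)"
  unfolding sharp_def
proof (rule the_equality)
  have e: "cinner (h, 0) (0, s) = - \<i> * of_real (inner h s)" for h s :: 'k
    by (simp add: cinner_def complex_eq_iff)
  show "(0, t) \<in> {0} \<times> T \<and> (\<forall>h\<in>T. cinner (h, 0) (0, t) = \<alpha> (h, 0))"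
    using assms im_dual_eval(2)[OF assms(1) _ T_subspace] by (auto simp: e)
  fix s assume s: "s \<in> {0} \<times> T \<and> (\<forall>h\<in>T. cinner (h, 0) s = \<alpha> (h, 0))"
  then obtain s' where s': "s = (0, s')" "s' \<in> T" by auto
  have d: "s' - t \<in> T" using s' assms T_subspace by (simp add: subspace_diff)
  have "inner (s' - t) s' = real_functional \<alpha> (s' - t)"
    using s d im_dual_eval(2)[OF assms(1) d T_subspace] by (auto simp: s' e)
  then have "inner (s' - t) (s' - t) = 0" using assms(3)[OF d] by (simp add: inner_diff_right)
  then show "s = (0, t)" by (simp add: s')
qed

lemma sharp_zero: "sharp T 0 = (0, 0)"
  by (rule sharp_eqI) (auto simp: im_dual_zero T_zero real_functional_zero)

lemma pairing_zero: assumes "\<nu> \<in> im_dual T" shows "pairing T \<nu> 0 = 0"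
  using real_functional_linear(2)[OF assms T_zero T_zero T_subspace, of 0]
  by (simp add: pairing_def sharp_zero real_functional_def)

end

context fixed_cartan
begin

lemma weight_space_knD:
  assumes "x \<in> weight_space_kn \<phi> N T \<beta>"
  shows "x \<in> weight_space_k T (fst \<beta>)"
    and "map_prod (inv \<phi>) (inv \<phi>) x = cscale (cis (2 * pi * of_int (snd \<beta>) / real N)) x"
  using assms by (auto simp: weight_space_kn_def)

lemma map_inv_phi_cscale: "map_prod (inv \<phi>) (inv \<phi>) (cscale c x) = cscale c (map_prod (inv \<phi>) (inv \<phi>) x)"
proof -
  interpret L: linear "inv \<phi>" by (rule inv_phi_linear)
  show ?thesis by (cases x) (simp add: cscale_def L.diff L.add L.scale)
qed

lemma kn_cscale:
  assumes "fst \<beta> \<in> im_dual T" "x \<in> weight_space_kn \<phi> N T \<beta>"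
  shows "cscale c x \<in> weight_space_kn \<phi> N T \<beta>"
  using weight_space_knD[OF assms(2)] weight_space_cscale[OF assms(1)]
  by (simp add: weight_space_kn_def map_inv_phi_cscale mult.commute)

lemma conjugate_cscale: "conjugate (cscale c x) = cscale (cnj c) (conjugate x)"
  by (simp add: conjugate_def cscale_def)

lemma kn_conjugate:
  assumes "fst \<beta> \<in> im_dual T" "x \<in> weight_space_kn \<phi> N T \<beta>"
  shows "conjugate x \<in> weight_space_kn \<phi> N T (- \<beta>)"
proof -
  interpret L: linear "inv \<phi>" by (rule inv_phi_linear)
  have "map_prod (inv \<phi>) (inv \<phi>) (conjugate x) = conjugate (map_prod (inv \<phi>) (inv \<phi>) x)"
    by (cases x) (simp add: conjugate_def L.neg)
  also have "\<dots> = cscale (cis (2 * pi * of_int (snd (- \<beta>)) / real N)) (conjugate x)"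
    unfolding weight_space_knD(2)[OF assms(2)] conjugate_cscale by (simp add: cis_cnj)
  finally show ?thesis
    using weight_space_conjugate[OF assms(1) weight_space_knD(1)[OF assms(2)]]
    by (simp add: weight_space_kn_def)
qed

lemma kn_bracket:
  assumes "fst \<beta> \<in> im_dual T" "fst \<beta>' \<in> im_dual T"
    "x \<in> weight_space_kn \<phi> N T \<beta>" "y \<in> weight_space_kn \<phi> N T \<beta>'"
  shows "cbracket lie x y \<in> weight_space_kn \<phi> N T (\<beta> + \<beta>')"
proof -
  interpret L: linear "inv \<phi>" by (rule inv_phi_linear)
  have "map_prod (inv \<phi>) (inv \<phi>) (cbracket lie x y)
      = cbracket lie (map_prod (inv \<phi>) (inv \<phi>) x) (map_prod (inv \<phi>) (inv \<phi>) y)"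
    by (cases x; cases y) (simp add: cbracket_def L.add L.diff inv_phi_lie)
  also have "\<dots> = cscale (cis (2 * pi * of_int (snd (\<beta> + \<beta>')) / real N)) (cbracket lie x y)"
    unfolding weight_space_knD(2)[OF assms(3)] weight_space_knD(2)[OF assms(4)] cbracket_cscale
    by (simp add: cis_mult add_divide_distrib distrib_left)
  finally show ?thesis
    using weight_space_bracket[OF assms(1,2) weight_space_knD(1)[OF assms(3)] weight_space_knD(1)[OF assms(4)]]
    by (simp add: weight_space_kn_def)
qed

text \<open>The complexified fixed points commuting with \<open>T\<close> are the complexification of \<open>T\<close>, by maximality.\<close>

lemma kn_zero: "weight_space_kn \<phi> N T 0 = T \<times> T"
proof -
  have m: "map_prod (inv \<phi>) (inv \<phi>) x = x \<longleftrightarrow> \<phi> (fst x) = fst x \<and> \<phi> (snd x) = snd x" for x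
    by (cases x) (simp add: inv_phi_fixed)
  have w: "x \<in> weight_space_k T 0 \<longleftrightarrow> (\<forall>h\<in>T. lie h (fst x) = 0 \<and> lie h (snd x) = 0)" for x
    unfolding weight_space_iff[OF im_dual_zero] by (simp add: real_functional_zero)
  have "x \<in> weight_space_kn \<phi> N T 0 \<longleftrightarrow> fst x \<in> T \<and> snd x \<in> T" for x
  proof -
    have "x \<in> weight_space_kn \<phi> N T 0 \<longleftrightarrow> x \<in> weight_space_k T 0 \<and> map_prod (inv \<phi>) (inv \<phi>) x = x"
      by (simp add: weight_space_kn_def)
    then show ?thesis unfolding m w using T_abelian T_fixed maximalD by blast
  qed
  then show ?thesis by (auto simp: set_eq_iff)
qed

lemma aff_root_im_dual: "\<beta> \<in> aff_roots \<phi> N T \<Longrightarrow> fst \<beta> \<in> im_dual T"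
  using roots_im_dual by (auto simp: aff_roots_def)

lemma aff_root_vector:
  assumes "\<beta> \<in> aff_roots \<phi> N T"
  obtains x where "x \<in> weight_space_kn \<phi> N T \<beta>" "x \<noteq> 0"
proof -
  interpret L: linear "inv \<phi>" by (rule inv_phi_linear)
  have "0 \<in> weight_space_kn \<phi> N T \<beta>"
    unfolding weight_space_kn_def weight_space_k_def by (simp add: cbracket_def cscale_def L.zero zero_prod_def)
  then show ?thesis using assms that unfolding aff_roots_def by blast
qed

lemma aff_rootI:
  assumes "fst \<beta> \<in> im_dual T" "\<beta> \<noteq> 0" "x \<in> weight_space_kn \<phi> N T \<beta>" "x \<noteq> 0"
  shows "\<beta> \<in> aff_roots \<phi> N T"
proof -
  have "fst \<beta> \<noteq> 0 \<Longrightarrow> fst \<beta> \<in> roots_k T"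
    using assms(1,4) weight_space_knD(1)[OF assms(3)] unfolding roots_k_def by blast
  then show ?thesis using assms unfolding aff_roots_def zero_prod_def by blast
qed

text \<open>The vector of \<open>T\<close> representing the real functional of \<open>\<alpha>\<close>. The inverse image under \<open>h \<mapsto> (0, h)\<close> of
  \<open>sharp T \<alpha>\<close>, it makes sense only for the functionals that are representable, among them the
  finite parts of all roots.\<close>

definition dual_vector :: "('k \<times> 'k \<Rightarrow> complex) \<Rightarrow> 'k" where
  "dual_vector \<alpha> = snd (sharp T \<alpha>)"

definition representable :: "('k \<times> 'k \<Rightarrow> complex) \<Rightarrow> bool" where
  "representable \<alpha> \<longleftrightarrow> \<alpha> \<in> im_dual T \<and> (\<exists>t\<in>T. \<forall>h\<in>T. inner h t = real_functional \<alpha> h)"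

lemma representableD:
  assumes "representable \<alpha>"
  shows "\<alpha> \<in> im_dual T" "dual_vector \<alpha> \<in> T" "sharp T \<alpha> = (0, dual_vector \<alpha>)"
    "h \<in> T \<Longrightarrow> inner h (dual_vector \<alpha>) = real_functional \<alpha> h"
proof -
  obtain t where t: "t \<in> T" "\<And>h. h \<in> T \<Longrightarrow> inner h t = real_functional \<alpha> h" and a: "\<alpha> \<in> im_dual T"
    using assms by (auto simp: representable_def)
  have "sharp T \<alpha> = (0, t)" by (rule sharp_eqI[OF a t])
  then show "\<alpha> \<in> im_dual T" "dual_vector \<alpha> \<in> T" "sharp T \<alpha> = (0, dual_vector \<alpha>)"
    "h \<in> T \<Longrightarrow> inner h (dual_vector \<alpha>) = real_functional \<alpha> h"
    using a t by (auto simp: dual_vector_def)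
qed

lemma representableI:
  assumes "\<alpha> \<in> im_dual T" "t \<in> T" "\<And>h. h \<in> T \<Longrightarrow> inner h t = real_functional \<alpha> h"
  shows "representable \<alpha>" "dual_vector \<alpha> = t"
  using assms sharp_eqI[OF assms] by (auto simp: representable_def dual_vector_def)

lemma representable_zero: "representable 0" "dual_vector 0 = 0"
  using representableI[OF im_dual_zero T_zero] by (simp_all add: real_functional_zero)

lemma representable_uminus:
  assumes "representable \<alpha>" shows "representable (- \<alpha>)" "dual_vector (- \<alpha>) = - dual_vector \<alpha>"
  using representableI[OF im_dual_uminus[OF representableD(1)[OF assms]]
      subspace_neg[OF T_subspace representableD(2)[OF assms]]]
    representableD(4)[OF assms] by (simp_all add: real_functional_uminus)

lemma representable_add:
  assumes "representable \<alpha>" "representable \<beta>"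
  shows "representable (\<alpha> + \<beta>)" "dual_vector (\<alpha> + \<beta>) = dual_vector \<alpha> + dual_vector \<beta>"
  using representableI[OF im_dual_add[OF T_subspace representableD(1)[OF assms(1)] representableD(1)[OF assms(2)]]
      subspace_add[OF T_subspace representableD(2)[OF assms(1)] representableD(2)[OF assms(2)]]]
    representableD(4)[OF assms(1)] representableD(4)[OF assms(2)]
  by (simp_all add: real_functional_add inner_add_right)

text \<open>The bracket of \<open>x = u + i v\<close> with its conjugate is \<open>- 2 i [u, v]\<close>; it is a fixed point of weight \<open>0\<close>, hence
  \<open>[u, v] \<in> T\<close>. By invariance of the inner product, its inner product with \<open>h\<close> is
  \<open>\<alpha>(i h) |u|\<^sup>2\<close> and also \<open>\<alpha>(i h) |v|\<^sup>2\<close>. So \<open>[u, v]\<close> represents \<open>\<alpha>\<close> up to the factor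
  \<open>|u|\<^sup>2 = |v|\<^sup>2\<close>.\<close>

lemma weight_vector_sl2:
  assumes a: "\<alpha> \<in> im_dual T" and ne: "\<alpha> \<noteq> 0" and x: "x \<in> weight_space_kn \<phi> N T (\<alpha>, n)" "x \<noteq> 0"
  shows "representable \<alpha>" and "norm (fst x) = norm (snd x)" and "fst x \<noteq> 0"
    and "lie (fst x) (snd x) = (norm (fst x))\<^sup>2 *\<^sub>R dual_vector \<alpha>"
proof -
  obtain u v where uv: "x = (u, v)" by (cases x)
  have w: "lie h u = real_functional \<alpha> h *\<^sub>R v" "lie h v = - real_functional \<alpha> h *\<^sub>R u" if "h \<in> T" for h
    using weight_space_knD(1)[OF x(1)] that unfolding weight_space_iff[OF a] fst_conv uv by auto
  have "cbracket lie x (conjugate x) \<in> weight_space_kn \<phi> N T ((\<alpha>, n) + - (\<alpha>, n))"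
    by (rule kn_bracket[OF _ _ x(1) kn_conjugate[OF _ x(1)]]) (use a im_dual_uminus in auto)
  then have "cbracket lie x (conjugate x) \<in> T \<times> T" by (simp only: right_minus kn_zero)
  then have "(- 2) *\<^sub>R lie u v \<in> T"
    using lie_anticommute[of u v] by (simp add: uv cbracket_def conjugate_def lie_self scaleR_2)
  from subspace_scale[OF T_subspace this, of "- (1/2)"] have m: "lie u v \<in> T" by simp
  have i1: "inner h (lie u v) = real_functional \<alpha> h * (norm v)\<^sup>2" if "h \<in> T" for h
    using lie_invariant[of h u v] w[OF that] by (simp add: dot_square_norm)
  have i2: "inner h (lie u v) = real_functional \<alpha> h * (norm u)\<^sup>2" if "h \<in> T" for h
    using lie_invariant[of h v u] w[OF that] lie_anticommute[of v u] by (simp add: dot_square_norm)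
  obtain h where h: "h \<in> T" "real_functional \<alpha> h \<noteq> 0"
    using im_dual_cong[OF a im_dual_zero T_subspace] ne by (auto simp: real_functional_zero)
  have "(norm u)\<^sup>2 = (norm v)\<^sup>2" using i1[OF h(1)] i2[OF h(1)] h(2) by simp
  then have n: "norm u = norm v" by simp
  then show "norm (fst x) = norm (snd x)" by (simp add: uv)
  then have u: "u \<noteq> 0" using x(2) by (auto simp: uv zero_prod_def)
  then show "fst x \<noteq> 0" by (simp add: uv)
  have "representable \<alpha>" "dual_vector \<alpha> = (1 / (norm u)\<^sup>2) *\<^sub>R lie u v"
    using representableI[OF a subspace_scale[OF T_subspace m, of "1 / (norm u)\<^sup>2"]] i2 u by simp_all
  then show "representable \<alpha>" "lie (fst x) (snd x) = (norm (fst x))\<^sup>2 *\<^sub>R dual_vector \<alpha>"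
    using u by (simp_all add: uv)
qed

lemma aff_root_representable: "\<beta> \<in> aff_roots \<phi> N T \<Longrightarrow> representable (fst \<beta>)"
proof (cases "fst \<beta> = 0")
  case True
  then show ?thesis using representable_zero by simp
next
  case False
  assume b: "\<beta> \<in> aff_roots \<phi> N T"
  obtain x where "x \<in> weight_space_kn \<phi> N T (fst \<beta>, snd \<beta>)" "x \<noteq> 0"
    using aff_root_vector[OF b] by auto
  then show ?thesis using weight_vector_sl2(1)[OF aff_root_im_dual[OF b] False] by blast
qed

lemma dual_vector_nonzero:
  assumes "representable \<alpha>" "\<alpha> \<noteq> 0" shows "dual_vector \<alpha> \<noteq> 0"
  using im_dual_cong[OF representableD(1)[OF assms(1)] im_dual_zero T_subspace] assms
    representableD(4)[OF assms(1)] by (force simp: real_functional_zero)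

lemma pairing_eq:
  assumes "representable \<alpha>" shows "pairing T \<nu> \<alpha> = real_functional \<nu> (dual_vector \<alpha>)"
  using representableD(3)[OF assms] by (simp add: pairing_def real_functional_def)

lemma dual_form_eq:
  assumes "representable \<alpha>" "representable \<beta>"
  shows "dual_form T \<alpha> \<beta> = inner (dual_vector \<alpha>) (dual_vector \<beta>)"
  using representableD(3)[OF assms(1)] representableD(3)[OF assms(2)] by (simp add: dual_form_def)

lemma pairing_uminus:
  assumes "\<nu> \<in> im_dual T" "representable \<alpha>"
  shows "pairing T \<nu> (- \<alpha>) = - pairing T \<nu> \<alpha>"
  using real_functional_linear(2)[OF assms(1) representableD(2)[OF assms(2)] T_zero T_subspace, of "-1"]
  by (simp add: pairing_eq representable_uminus assms)

text \<open>The real vector \<open>fst x\<close> is half the sum of \<open>x\<close> and its conjugate, which have the opposite weights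
  \<open>\<alpha>\<close> and \<open>- \<alpha>\<close>.\<close>

lemma Dbar_rel_weight:
  assumes \<nu>: "\<nu> \<in> im_dual T" and a: "\<alpha> \<in> insert 0 (roots_k T)" and r: "representable \<alpha>"
    and x: "x \<in> weight_space_k T \<alpha>"
  shows "Dbar_rel T \<nu> (fst x) (- pairing T \<nu> \<alpha> *\<^sub>R snd x)"
proof (cases "\<alpha> = 0")
  case True
  let ?c = "\<lambda>\<beta>. if \<beta> = 0 then (fst x, 0) else 0"
  have w: "(fst x, 0) \<in> weight_space_k T 0"
    using x unfolding True weight_space_iff[OF im_dual_zero] by (auto simp: real_functional_zero)
  have z: "0 \<in> weight_space_k T \<beta>" for \<beta> by (simp add: weight_space_k_def cbracket_def cscale_def)
  have s: "\<And>g b. g 0 = b \<Longrightarrow> (\<And>\<beta>. \<beta> \<noteq> 0 \<Longrightarrow> g \<beta> = 0) \<Longrightarrow> (g has_sum b) (insert 0 (roots_k T))" for g :: "_ \<Rightarrow> 'k \<times> 'k" and b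
    by (rule has_sum_finite_neutralI[of "{0}"]) auto
  show ?thesis
    unfolding Dbar_rel_def
    by (rule exI[of _ ?c], intro conjI s)
      (use w z in \<open>auto simp: True pairing_zero[OF \<nu>] cscale_def zero_prod_def\<close>)
next
  case False
  let ?p = "pairing T \<nu> \<alpha>"
  have ne: "- \<alpha> \<noteq> \<alpha>"
  proof
    assume "- \<alpha> = \<alpha>"
    then have "dual_vector \<alpha> = - dual_vector \<alpha>" using representable_uminus(2)[OF r] by metis
    then have "2 *\<^sub>R dual_vector \<alpha> = 0" by (simp only: scaleR_2 eq_neg_iff_add_eq_0)
    then show False using dual_vector_nonzero[OF r False] by simp
  qed
  let ?c = "\<lambda>\<beta>. if \<beta> = \<alpha> then cscale (1/2) x else if \<beta> = - \<alpha> then cscale (1/2) (conjugate x) else 0"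
  have ar: "\<alpha> \<in> roots_k T" "- \<alpha> \<in> roots_k T" using a False uminus_root by auto
  have i: "\<alpha> \<in> im_dual T" by (rule representableD(1)[OF r])
  have w: "cscale (1/2) x \<in> weight_space_k T \<alpha>" "cscale (1/2) (conjugate x) \<in> weight_space_k T (- \<alpha>)"
    using weight_space_cscale[OF i x] weight_space_cscale[OF im_dual_uminus[OF i] weight_space_conjugate[OF i x]] by auto
  have z: "0 \<in> weight_space_k T \<beta>" for \<beta> by (simp add: weight_space_k_def cbracket_def cscale_def)
  have s: "g \<alpha> + g (- \<alpha>) = b \<Longrightarrow> (\<And>\<beta>. \<beta> \<noteq> \<alpha> \<Longrightarrow> \<beta> \<noteq> - \<alpha> \<Longrightarrow> g \<beta> = 0) \<Longrightarrow>
      (g has_sum b) (insert 0 (roots_k T))" for g :: "_ \<Rightarrow> 'k \<times> 'k" and b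
    by (rule has_sum_finite_neutralI[of "{\<alpha>, - \<alpha>}"]) (use ar ne in auto)
  have half: "(1/2) *\<^sub>R u + (1/2) *\<^sub>R u = u" for u :: 'k by (simp add: scaleR_add_left[symmetric])
  have "\<forall>\<beta>\<in>insert 0 (roots_k T). ?c \<beta> \<in> weight_space_k T \<beta>" using w z by presburger
  moreover have "(?c has_sum (fst x, 0)) (insert 0 (roots_k T))"
    by (rule s) (use ne in \<open>auto simp: cscale_def conjugate_def half\<close>)
  moreover have "((\<lambda>\<beta>. cscale (\<i> * of_real (pairing T \<nu> \<beta>)) (?c \<beta>)) has_sum (- ?p *\<^sub>R snd x, 0)) (insert 0 (roots_k T))"
  proof (rule s)
    have h: "- ((?p / 2) *\<^sub>R u) - (?p / 2) *\<^sub>R u = - (?p *\<^sub>R u)" for u :: 'k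
      using scaleR_add_left[of "- (?p / 2)" "- (?p / 2)" u] by simp
    show "cscale (\<i> * of_real (pairing T \<nu> \<alpha>)) (?c \<alpha>) + cscale (\<i> * of_real (pairing T \<nu> (- \<alpha>))) (?c (- \<alpha>))
        = (- ?p *\<^sub>R snd x, 0)"
      using ne h by (simp add: pairing_uminus[OF \<nu> r] cscale_def conjugate_def)
  qed auto
  ultimately show ?thesis unfolding Dbar_rel_def by (intro exI[of _ ?c] conjI)
qed

lemma Dbar_weight:
  assumes \<nu>: "\<nu> \<in> im_dual T" and a: "\<alpha> \<in> insert 0 (roots_k T)" and r: "representable \<alpha>"
    and x: "x \<in> weight_space_k T \<alpha>"
  shows "Dbar T \<nu> (fst x) = - pairing T \<nu> \<alpha> *\<^sub>R snd x" "Dbar T \<nu> (snd x) = pairing T \<nu> \<alpha> *\<^sub>R fst x"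
proof -
  show "Dbar T \<nu> (fst x) = - pairing T \<nu> \<alpha> *\<^sub>R snd x"
    by (rule Dbar_eqI[OF Dbar_rel_weight[OF assms]])
  (* the imaginary part of x is the real part of - \<i> x *)
  have "cscale (- \<i>) x \<in> weight_space_k T \<alpha>"
    by (rule weight_space_cscale[OF representableD(1)[OF r] x])
  from Dbar_eqI[OF Dbar_rel_weight[OF \<nu> a r this]] show "Dbar T \<nu> (snd x) = pairing T \<nu> \<alpha> *\<^sub>R fst x"
    by (simp add: cscale_def)
qed

section \<open>Brackets of root vectors of the affinisation\<close>

text \<open>The loop \<open>t \<mapsto> exp(int/N) x\<close> as a curve in the complexification of \<open>'k\<close>, and as an element of the
  complexification of the affinisation.\<close>

definition phase_loop :: "int \<Rightarrow> 'k \<times> 'k \<Rightarrow> real \<Rightarrow> 'k \<times> 'k" where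
  "phase_loop n x t = cscale (cis (of_int n * t / real N)) x"

definition root_loop :: "int \<Rightarrow> 'k \<times> 'k \<Rightarrow> 'k aff \<times> 'k aff" where
  "root_loop n x = ((0, (\<lambda>t. fst (phase_loop n x t)), 0), (0, (\<lambda>t. snd (phase_loop n x t)), 0))"

lemma aff_root_space_eq: "aff_root_space \<phi> N T \<beta> = root_loop (snd \<beta>) ` weight_space_kn \<phi> N T \<beta>"
  by (simp add: aff_root_space_def root_loop_def[abs_def] phase_loop_def)

lemma phase_loop_derivative:
  "((\<lambda>t. fst (phase_loop n x t)) has_vector_derivative - (of_int n / real N) *\<^sub>R snd (phase_loop n x t)) (at t)"
  "((\<lambda>t. snd (phase_loop n x t)) has_vector_derivative (of_int n / real N) *\<^sub>R fst (phase_loop n x t)) (at t)"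
proof -
  define \<theta> where "\<theta> = of_int n / real N"
  have e: "of_int n * t / real N = \<theta> * t" for t by (simp add: \<theta>_def)
  have 1: "((\<lambda>t. cos (\<theta> * t) *\<^sub>R fst x - sin (\<theta> * t) *\<^sub>R snd x) has_vector_derivative
      (cos (\<theta> * t) *\<^sub>R 0 + (- sin (\<theta> * t) * \<theta>) *\<^sub>R fst x)
      - (sin (\<theta> * t) *\<^sub>R 0 + (cos (\<theta> * t) * \<theta>) *\<^sub>R snd x)) (at t)"
    by (intro has_vector_derivative_diff has_vector_derivative_scaleR has_vector_derivative_const)
      (auto intro!: derivative_eq_intros)
  show "((\<lambda>t. fst (phase_loop n x t)) has_vector_derivative - (of_int n / real N) *\<^sub>R snd (phase_loop n x t)) (at t)"
    unfolding phase_loop_def cscale_def fst_conv snd_conv cis.sel e \<theta>_def[symmetric]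
    by (rule has_vector_derivative_eq_rhs[OF 1]) (simp add: algebra_simps)
  have 2: "((\<lambda>t. cos (\<theta> * t) *\<^sub>R snd x + sin (\<theta> * t) *\<^sub>R fst x) has_vector_derivative
      (cos (\<theta> * t) *\<^sub>R 0 + (- sin (\<theta> * t) * \<theta>) *\<^sub>R snd x)
      + (sin (\<theta> * t) *\<^sub>R 0 + (cos (\<theta> * t) * \<theta>) *\<^sub>R fst x)) (at t)"
    by (intro has_vector_derivative_add has_vector_derivative_scaleR has_vector_derivative_const)
      (auto intro!: derivative_eq_intros)
  show "((\<lambda>t. snd (phase_loop n x t)) has_vector_derivative (of_int n / real N) *\<^sub>R fst (phase_loop n x t)) (at t)"
    unfolding phase_loop_def cscale_def fst_conv snd_conv cis.sel e \<theta>_def[symmetric]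
    by (rule has_vector_derivative_eq_rhs[OF 2]) (simp add: algebra_simps)
qed

lemma cis_vector_derivative:
  "((\<lambda>t. cis (\<theta> * t)) has_vector_derivative \<theta> *\<^sub>R (\<i> * cis (\<theta> * t))) (at t within S)"
proof -
  have "((\<lambda>z. exp (\<i> * of_real \<theta> * z)) has_field_derivative
      exp (\<i> * of_real \<theta> * of_real t) * (\<i> * of_real \<theta>)) (at (of_real t))"
    by (auto intro!: derivative_eq_intros)
  from has_vector_derivative_real_field[OF this] show ?thesis
    by (simp add: cis_conv_exp scaleR_conv_of_real mult_ac)
qed

lemma aff_root_fst: "\<beta> \<in> aff_roots \<phi> N T \<Longrightarrow> fst \<beta> \<in> insert 0 (roots_k T)"
  by (simp add: aff_roots_def)

lemma loop_deriv_phase_loop: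
  assumes \<nu>: "\<nu> \<in> im_dual T" and b: "\<beta> \<in> aff_roots \<phi> N T" and x: "x \<in> weight_space_kn \<phi> N T \<beta>"
  shows "loop_deriv T \<nu> (\<lambda>t. fst (phase_loop (snd \<beta>) x t)) = (\<lambda>t. - root_height N T \<nu> \<beta> *\<^sub>R snd (phase_loop (snd \<beta>) x t))"
    and "loop_deriv T \<nu> (\<lambda>t. snd (phase_loop (snd \<beta>) x t)) = (\<lambda>t. root_height N T \<nu> \<beta> *\<^sub>R fst (phase_loop (snd \<beta>) x t))"
proof -
  have w: "phase_loop (snd \<beta>) x t \<in> weight_space_k T (fst \<beta>)" for t
    unfolding phase_loop_def by (rule weight_space_cscale[OF aff_root_im_dual[OF b] weight_space_knD(1)[OF x]])
  note d = Dbar_weight[OF \<nu> aff_root_fst[OF b] aff_root_representable[OF b] w]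
  note v = vector_derivative_at[OF phase_loop_derivative(1)] vector_derivative_at[OF phase_loop_derivative(2)]
  show "loop_deriv T \<nu> (\<lambda>t. fst (phase_loop (snd \<beta>) x t)) = (\<lambda>t. - root_height N T \<nu> \<beta> *\<^sub>R snd (phase_loop (snd \<beta>) x t))"
    "loop_deriv T \<nu> (\<lambda>t. snd (phase_loop (snd \<beta>) x t)) = (\<lambda>t. root_height N T \<nu> \<beta> *\<^sub>R fst (phase_loop (snd \<beta>) x t))"
    unfolding loop_deriv_def d v by (simp_all add: root_height_def scaleR_add_left algebra_simps)
qed

lemma cbracket_phase_loop: "cbracket lie (phase_loop n x t) (phase_loop m y t) = phase_loop (n + m) (cbracket lie x y) t"
  by (simp add: phase_loop_def cbracket_cscale cis_mult add_divide_distrib distrib_right)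

lemma bilinear_form_phase_loop: "bilinear_form (phase_loop n x t) (phase_loop m y t)
    = cis (of_int (n + m) * t / real N) * bilinear_form x y"
  by (simp add: phase_loop_def bilinear_form_cscale cis_mult add_divide_distrib distrib_right)

lemma phase_loop_continuous: "continuous_on S (\<lambda>t. fst (phase_loop n x t))" "continuous_on S (\<lambda>t. snd (phase_loop n x t))"
  by (rule continuous_at_imp_continuous_on, rule ballI,
      rule has_vector_derivative_continuous, rule phase_loop_derivative)+

text \<open>The complex bilinear extension of the inner product of loops.\<close>

definition loop_form :: "int \<Rightarrow> 'k \<times> 'k \<Rightarrow> int \<Rightarrow> 'k \<times> 'k \<Rightarrow> complex" where
  "loop_form n x m y = (1 / (2 * pi)) *\<^sub>R integral {0..2 * pi} (\<lambda>t. bilinear_form (phase_loop n x t) (phase_loop m y t))"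

lemma loop_form_inner:
  shows "loop_inner (\<lambda>t. - q *\<^sub>R snd (phase_loop n x t)) (\<lambda>t. fst (phase_loop m y t))
      - loop_inner (\<lambda>t. q *\<^sub>R fst (phase_loop n x t)) (\<lambda>t. snd (phase_loop m y t)) = - q * Im (loop_form n x m y)"
    and "loop_inner (\<lambda>t. - q *\<^sub>R snd (phase_loop n x t)) (\<lambda>t. snd (phase_loop m y t))
      + loop_inner (\<lambda>t. q *\<^sub>R fst (phase_loop n x t)) (\<lambda>t. fst (phase_loop m y t)) = q * Re (loop_form n x m y)"
proof -
  let ?a = "\<lambda>t. fst (phase_loop n x t)" and ?b = "\<lambda>t. snd (phase_loop n x t)"
  let ?c = "\<lambda>t. fst (phase_loop m y t)" and ?d = "\<lambda>t. snd (phase_loop m y t)"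
  have I: "(\<lambda>t. inner (f t) (g t)) integrable_on {0..2*pi}"
    if "f \<in> {?a, ?b}" "g \<in> {?c, ?d}" for f g
    using that phase_loop_continuous[of _ n x] phase_loop_continuous[of _ m y]
    by (intro integrable_continuous_real continuous_on_inner) blast+
  define ac where "ac = integral {0..2*pi} (\<lambda>t. inner (?a t) (?c t))"
  define ad where "ad = integral {0..2*pi} (\<lambda>t. inner (?a t) (?d t))"
  define bc where "bc = integral {0..2*pi} (\<lambda>t. inner (?b t) (?c t))"
  define bd where "bd = integral {0..2*pi} (\<lambda>t. inner (?b t) (?d t))"
  have "((\<lambda>t. of_real (inner (?a t) (?c t) - inner (?b t) (?d t))
      + \<i> * of_real (inner (?a t) (?d t) + inner (?b t) (?c t))) has_integral
      (of_real (ac - bd) + \<i> * of_real (ad + bc))) {0..2*pi}"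
    unfolding ac_def ad_def bc_def bd_def
    by (intro has_integral_add has_integral_mult_right has_integral_of_real has_integral_diff
        integrable_integral I) auto
  moreover have "bilinear_form (phase_loop n x t) (phase_loop m y t) = of_real (inner (?a t) (?c t) - inner (?b t) (?d t))
      + \<i> * of_real (inner (?a t) (?d t) + inner (?b t) (?c t))" for t
    by (simp add: bilinear_form_def complex_eq_iff)
  ultimately have "loop_form n x m y = (1 / (2 * pi)) *\<^sub>R (of_real (ac - bd) + \<i> * of_real (ad + bc))"
    unfolding loop_form_def by (simp only: integral_unique)
  then have R: "Re (loop_form n x m y) = (ac - bd) / (2 * pi)" "Im (loop_form n x m y) = (ad + bc) / (2 * pi)"
    by simp_all
  show "loop_inner (\<lambda>t. - q *\<^sub>R ?b t) ?c - loop_inner (\<lambda>t. q *\<^sub>R ?a t) ?d = - q * Im (loop_form n x m y)"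
    "loop_inner (\<lambda>t. - q *\<^sub>R ?b t) ?d + loop_inner (\<lambda>t. q *\<^sub>R ?a t) ?c = q * Re (loop_form n x m y)"
    unfolding loop_inner_def R inner_scaleR_left integral_mult_right
      ac_def[symmetric] ad_def[symmetric] bc_def[symmetric] bd_def[symmetric]
    by (simp_all add: field_simps)
qed

lemma loop_form_opposite:
  assumes "n + m = 0" shows "loop_form n x m y = bilinear_form x y"
  unfolding loop_form_def bilinear_form_phase_loop assms by (simp add: scaleR_conv_of_real)

text \<open>For \<open>\<alpha> + \<alpha>' \<noteq> 0\<close> the weight spaces are orthogonal for the bilinear form. Otherwise invariance under
  \<open>\<phi>\<close> gives \<open>exp(2\<pi>i(n + n')/N) K = K\<close> for \<open>K = bilinear_form x y\<close>, which is what makes the integral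
  of \<open>exp(i(n + n')t/N) K\<close> over a period vanish when \<open>n + n' \<noteq> 0\<close>.\<close>

lemma loop_form_zero:
  assumes "\<beta> \<in> aff_roots \<phi> N T" "\<beta>' \<in> aff_roots \<phi> N T" and ne: "\<beta> + \<beta>' \<noteq> 0"
    and x: "x \<in> weight_space_kn \<phi> N T \<beta>" and y: "y \<in> weight_space_kn \<phi> N T \<beta>'"
  shows "loop_form (snd \<beta>) x (snd \<beta>') y = 0"
proof (cases "fst \<beta> + fst \<beta>' = 0")
  case False
  have "bilinear_form x y = 0"
    using bilinear_form_orthogonal[OF aff_root_im_dual[OF assms(1)] aff_root_im_dual[OF assms(2)] False]
      weight_space_knD(1) x y by blast
  then show ?thesis unfolding loop_form_def bilinear_form_phase_loop by simp
next
  case True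
  let ?K = "bilinear_form x y"
  define \<theta> where "\<theta> = of_int (snd \<beta> + snd \<beta>') / real N"
  have e: "of_int (snd \<beta> + snd \<beta>') * t / real N = \<theta> * t" for t by (simp add: \<theta>_def)
  have "snd \<beta> + snd \<beta>' \<noteq> 0" using ne True by (metis fst_add snd_add prod.collapse zero_prod_def)
  then have th: "\<theta> \<noteq> 0" using N_pos unfolding \<theta>_def by (simp del: of_int_add)
  have "bilinear_form (map_prod (inv \<phi>) (inv \<phi>) x) (map_prod (inv \<phi>) (inv \<phi>) y) = ?K"
    by (simp add: bilinear_form_def inv_phi_inner)
  then have "cis (2 * pi * of_int (snd \<beta>) / real N) * cis (2 * pi * of_int (snd \<beta>') / real N) * ?K = ?K"
    unfolding weight_space_knD(2)[OF x] weight_space_knD(2)[OF y] bilinear_form_cscale .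
  then have c: "cis (\<theta> * (2 * pi)) * ?K = ?K"
    by (simp add: cis_mult \<theta>_def add_divide_distrib distrib_left distrib_right mult.commute)
  have I: "((\<lambda>t. cis (\<theta> * t) * ?K) has_integral
      (cis (\<theta> * (2 * pi)) * ?K / (\<i> * of_real \<theta>) - cis (\<theta> * 0) * ?K / (\<i> * of_real \<theta>))) {0..2 * pi}"
  proof (rule fundamental_theorem_of_calculus)
    fix t assume "t \<in> {0..2 * pi}"
    have "((\<lambda>t. cis (\<theta> * t)) has_vector_derivative \<theta> *\<^sub>R (\<i> * cis (\<theta> * t))) (at t within {0..2*pi})"
      by (rule cis_vector_derivative)
    from has_vector_derivative_mult_left[OF this, of "?K / (\<i> * of_real \<theta>)"] show "((\<lambda>t. cis (\<theta> * t) * ?K / (\<i> * of_real \<theta>)) has_vector_derivative cis (\<theta> * t) * ?K)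
        (at t within {0..2*pi})"
      using th by (simp add: scaleR_conv_of_real)
  qed simp
  have "integral {0..2*pi} (\<lambda>t. cis (\<theta> * t) * ?K) = 0"
    unfolding integral_unique[OF I] c by simp
  then show ?thesis unfolding loop_form_def bilinear_form_phase_loop e by (simp only: scaleR_zero_right)
qed

lemma loop_bracket:
  assumes \<nu>: "\<nu> \<in> im_dual T" and b: "\<beta> \<in> aff_roots \<phi> N T"
    and x: "x \<in> weight_space_kn \<phi> N T \<beta>"
  shows "aff_cbracket T \<nu> (root_loop (snd \<beta>) x) (root_loop m y) =
    ((- root_height N T \<nu> \<beta> * Im (loop_form (snd \<beta>) x m y), (\<lambda>t. fst (phase_loop (snd \<beta> + m) (cbracket lie x y) t)), 0),
     (root_height N T \<nu> \<beta> * Re (loop_form (snd \<beta>) x m y), (\<lambda>t. snd (phase_loop (snd \<beta> + m) (cbracket lie x y) t)), 0))"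
proof -
  have "fst (phase_loop (snd \<beta> + m) (cbracket lie x y) t)
      = lie (fst (phase_loop (snd \<beta>) x t)) (fst (phase_loop m y t)) - lie (snd (phase_loop (snd \<beta>) x t)) (snd (phase_loop m y t))"
    and "snd (phase_loop (snd \<beta> + m) (cbracket lie x y) t)
      = lie (fst (phase_loop (snd \<beta>) x t)) (snd (phase_loop m y t)) + lie (snd (phase_loop (snd \<beta>) x t)) (fst (phase_loop m y t))" for t
    unfolding cbracket_phase_loop[symmetric] by (simp_all add: cbracket_def)
  note c = this
  show ?thesis
    unfolding c unfolding loop_form_inner[symmetric] cbracket_def root_loop_def fst_conv snd_conv
      aff_bracket_def case_prod_conv loop_deriv_phase_loop[OF \<nu> b x]
    by (simp add: fun_eq_iff)
qed

lemma loop_bracket_root: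
  assumes \<nu>: "\<nu> \<in> im_dual T" and b: "\<beta> \<in> aff_roots \<phi> N T" "\<beta>' \<in> aff_roots \<phi> N T" "\<beta> + \<beta>' \<noteq> 0"
    and x: "x \<in> weight_space_kn \<phi> N T \<beta>" and y: "y \<in> weight_space_kn \<phi> N T \<beta>'"
  shows "aff_cbracket T \<nu> (root_loop (snd \<beta>) x) (root_loop (snd \<beta>') y) = root_loop (snd (\<beta> + \<beta>')) (cbracket lie x y)"
  unfolding loop_bracket[OF \<nu> b(1) x] loop_form_zero[OF b x y] by (simp add: root_loop_def)

lemma loop_bracket_opposite:
  assumes \<nu>: "\<nu> \<in> im_dual T" and b: "\<beta> \<in> aff_roots \<phi> N T" "m = - snd \<beta>"
    and x: "x \<in> weight_space_kn \<phi> N T \<beta>"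
  shows "aff_cbracket T \<nu> (root_loop (snd \<beta>) x) (root_loop m y) =
    cembed ((- root_height N T \<nu> \<beta> * Im (bilinear_form x y), fst (cbracket lie x y), 0),
            (root_height N T \<nu> \<beta> * Re (bilinear_form x y), snd (cbracket lie x y), 0))"
  unfolding loop_bracket[OF \<nu> b(1) x] using b(2)
  by (simp add: loop_form_opposite const_embed_def phase_loop_def cscale_def)

lemma Dbar_T:
  assumes "\<nu> \<in> im_dual T" "h \<in> T" shows "Dbar T \<nu> h = 0"
proof -
  have "(h, 0) \<in> weight_space_k T 0"
    unfolding weight_space_iff[OF im_dual_zero] using T_abelian assms by (auto simp: real_functional_zero)
  from Dbar_weight(1)[OF assms(1) _ representable_zero(1) this] show ?thesis by simp
qed

lemma cartan_bracket:
  assumes \<nu>: "\<nu> \<in> im_dual T" and b: "\<beta> \<in> aff_roots \<phi> N T" and x: "x \<in> weight_space_kn \<phi> N T \<beta>"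
    and h: "h \<in> ext_cartan T \<times> ext_cartan T"
  shows "aff_cbracket T \<nu> (cembed h) (root_loop (snd \<beta>) x) = cscale (root_functional N T \<nu> \<beta> h) (root_loop (snd \<beta>) x)"
proof -
  obtain z1 h1 t1 z2 h2 t2 where hh: "h = ((z1, h1, t1), (z2, h2, t2))" "h1 \<in> T" "h2 \<in> T"
    using h by (auto simp: ext_cartan_def)
  have w: "phase_loop (snd \<beta>) x t \<in> weight_space_k T (fst \<beta>)" for t
    unfolding phase_loop_def by (rule weight_space_cscale[OF aff_root_im_dual[OF b] weight_space_knD(1)[OF x]])
  note l = weight_space_kD[OF aff_root_fst[OF b] w]
  have d: "loop_deriv T \<nu> (\<lambda>_. h) = (\<lambda>_. 0)" if "h \<in> T" for h
    unfolding loop_deriv_def by (simp add: Dbar_T[OF \<nu> that])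
  have i: "loop_inner (\<lambda>_. 0) g = 0" for g :: "real \<Rightarrow> 'k" by (simp add: loop_inner_def)
  have f: "root_functional N T \<nu> \<beta> h = - \<i> * of_real (real_functional (fst \<beta>) h1) + of_real (real_functional (fst \<beta>) h2)
      + \<i> * Complex t1 t2 * of_real (root_height N T \<nu> \<beta>)"
    using im_dual_apply[OF aff_root_im_dual[OF b] hh(2,3) T_subspace] hh by (simp add: root_functional_def)
  show ?thesis
    unfolding f unfolding hh(1) cbracket_def root_loop_def fst_conv snd_conv map_prod_simp const_embed_def
      aff_bracket_def case_prod_conv loop_deriv_phase_loop[OF \<nu> b x] d[OF hh(2)] d[OF hh(3)] i
    by (simp add: cscale_def fun_eq_iff l hh(2,3) scaleR_fun_def algebra_simps)
qed

lemma aff_deriv_root_loop: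
  assumes \<nu>: "\<nu> \<in> im_dual T" and b: "\<beta> \<in> aff_roots \<phi> N T" and x: "x \<in> weight_space_kn \<phi> N T \<beta>"
  shows "map_prod (aff_deriv T \<nu>) (aff_deriv T \<nu>) (root_loop (snd \<beta>) x)
    = cscale (\<i> * of_real (root_height N T \<nu> \<beta>)) (root_loop (snd \<beta>) x)"
  unfolding root_loop_def aff_deriv_def map_prod_simp case_prod_conv loop_deriv_phase_loop[OF assms]
  by (simp add: cscale_def scaleR_fun_def fun_eq_iff)

end

section \<open>Roots, coroots and the null root\<close>

lemma cdualD:
  assumes "f \<in> cdual T"
  shows "v \<notin> T \<times> T \<Longrightarrow> f v = 0" "u \<in> T \<times> T \<Longrightarrow> v \<in> T \<times> T \<Longrightarrow> f (u + v) = f u + f v"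
    "v \<in> T \<times> T \<Longrightarrow> f (cscale c v) = c * f v"
  using assms unfolding cdual_def by blast+

lemma im_dual_cdual: "f \<in> im_dual T \<Longrightarrow> f \<in> cdual T"
  by (simp add: im_dual_def)

context fixed_cartan
begin

lemma root_functional_outside: "h \<notin> ext_cartan T \<times> ext_cartan T \<Longrightarrow> root_functional N T \<nu> \<beta> h = 0"
  by (auto simp: root_functional_def ext_cartan_def split: prod.splits)

lemma coroot_eq:
  assumes "representable (fst \<beta>)"
  shows "coroot N T \<nu> \<beta> = ((0, 0, 0), (- 2 * root_height N T \<nu> \<beta> / (norm (dual_vector (fst \<beta>)))\<^sup>2,
      (2 / (norm (dual_vector (fst \<beta>)))\<^sup>2) *\<^sub>R dual_vector (fst \<beta>), 0))"
  unfolding coroot_def dual_form_eq[OF assms assms] representableD(3)[OF assms]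
  by (simp add: power2_norm_eq_inner)

lemma coroot_ext_cartan:
  assumes "representable (fst \<beta>)"
  shows "coroot N T \<nu> \<beta> \<in> ext_cartan T \<times> ext_cartan T"
  unfolding coroot_eq[OF assms] using T_zero subspace_scale[OF T_subspace representableD(2)[OF assms]]
  by (simp add: ext_cartan_def)

lemma root_functional_coroot:
  assumes "representable (fst \<beta>)" "representable (fst \<beta>')"
  shows "root_functional N T \<nu> \<beta>' (coroot N T \<nu> \<beta>)
    = of_real (2 * inner (dual_vector (fst \<beta>')) (dual_vector (fst \<beta>)) / (norm (dual_vector (fst \<beta>)))\<^sup>2)"
proof -
  let ?t = "(2 / (norm (dual_vector (fst \<beta>)))\<^sup>2) *\<^sub>R dual_vector (fst \<beta>)"
  have t: "?t \<in> T" by (rule subspace_scale[OF T_subspace representableD(2)[OF assms(1)]])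
  have "root_functional N T \<nu> \<beta>' (coroot N T \<nu> \<beta>) = fst \<beta>' (0, ?t)"
    unfolding coroot_eq[OF assms(1)] root_functional_def using t T_zero by (simp add: complex_eq_iff)
  also have "\<dots> = of_real (inner ?t (dual_vector (fst \<beta>')))"
    using im_dual_eval(1)[OF representableD(1)[OF assms(2)] t T_subspace] representableD(4)[OF assms(2) t] by simp
  finally show ?thesis by (simp add: inner_commute)
qed

lemma compact_root_iff: "\<beta> \<in> compact_roots \<phi> N T \<longleftrightarrow> \<beta> \<in> aff_roots \<phi> N T \<and> fst \<beta> \<noteq> 0"
  by (auto simp: compact_roots_def)

lemma aff_root_uminus:
  assumes "\<beta> \<in> aff_roots \<phi> N T" shows "- \<beta> \<in> aff_roots \<phi> N T"
proof -
  obtain x where x: "x \<in> weight_space_kn \<phi> N T \<beta>" "x \<noteq> 0" by (rule aff_root_vector[OF assms])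
  have "\<beta> \<noteq> 0" using assms by (auto simp: aff_roots_def zero_prod_def)
  then show ?thesis
    using x aff_root_im_dual[OF assms]
    by (intro aff_rootI[OF _ _ kn_conjugate[OF _ x(1)]])
      (auto simp: im_dual_uminus conjugate_def prod_eq_iff)
qed

lemma compact_root_uminus: "\<beta> \<in> compact_roots \<phi> N T \<Longrightarrow> - \<beta> \<in> compact_roots \<phi> N T"
  using aff_root_uminus by (auto simp: compact_root_iff)

lemma root_height_uminus:
  assumes "\<nu> \<in> im_dual T" "representable (fst \<beta>)"
  shows "root_height N T \<nu> (- \<beta>) = - root_height N T \<nu> \<beta>"
  using pairing_uminus[OF assms] by (simp add: root_height_def)

lemma root_functional_uminus:
  assumes "\<nu> \<in> im_dual T" "representable (fst \<beta>)"
  shows "root_functional N T \<nu> (- \<beta>) = - root_functional N T \<nu> \<beta>"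
  unfolding root_functional_def root_height_uminus[OF assms] by (auto simp: fun_eq_iff)

text \<open>The functional of the pair \<open>(0, N)\<close>, called \<open>\<delta>\<close> in the comments below; \<open>shift j\<close> adds \<open>j \<delta>\<close>.\<close>

definition null_root :: "'k cartan \<times> 'k cartan \<Rightarrow> complex" where
  "null_root = (\<lambda>((z1, h1, t1), (z2, h2, t2)). if h1 \<in> T \<and> h2 \<in> T then \<i> * Complex t1 t2 else 0)"

definition shift :: "int \<Rightarrow> ('k \<times> 'k \<Rightarrow> complex) \<times> int \<Rightarrow> ('k \<times> 'k \<Rightarrow> complex) \<times> int" where
  "shift j \<beta> = (fst \<beta>, snd \<beta> + int N * j)"

lemma fst_shift [simp]: "fst (shift j \<beta>) = fst \<beta>" by (simp add: shift_def)

lemma kn_shift: "weight_space_kn \<phi> N T (shift j \<beta>) = weight_space_kn \<phi> N T \<beta>"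
proof -
  have "2 * pi * of_int (snd (shift j \<beta>)) / real N = 2 * pi * of_int (snd \<beta>) / real N + 2 * pi * of_int j"
    using N_pos by (simp add: shift_def field_simps)
  then have "cis (2 * pi * of_int (snd (shift j \<beta>)) / real N) = cis (2 * pi * of_int (snd \<beta>) / real N)"
    by (simp add: cis_mult[symmetric] cis_multiple_2pi)
  then show ?thesis by (simp add: weight_space_kn_def)
qed

lemma compact_root_shift: "\<beta> \<in> compact_roots \<phi> N T \<Longrightarrow> shift j \<beta> \<in> compact_roots \<phi> N T"
  using kn_shift[of j \<beta>] by (auto simp: compact_roots_def aff_roots_def shift_def)

lemma root_height_shift: "root_height N T \<nu> (shift j \<beta>) = root_height N T \<nu> \<beta> + of_int j"
  using N_pos by (simp add: root_height_def shift_def field_simps)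

lemma root_functional_shift: "root_functional N T \<nu> (shift j \<beta>) = root_functional N T \<nu> \<beta> + of_int j *\<^sub>R null_root"
  unfolding root_functional_def root_height_shift
  by (auto simp: fun_eq_iff null_root_def scaleR_fun_def scaleR_conv_of_real algebra_simps)

lemma ext_cartan_subspace: "subspace (ext_cartan T)"
  unfolding ext_cartan_def by (intro subspace_Times T_subspace subspace_UNIV)

text \<open>The coroots of \<open>\<beta> + j \<delta>\<close> move along the central direction, so \<open>\<Lambda>\<close> changes linearly in \<open>j\<close>, with slope
  given by the level.\<close>

lemma coroot_shift:
  assumes r: "representable (fst \<beta>)" and L: "\<Lambda> \<in> im_dual (ext_cartan T)"
  shows "\<Lambda> (coroot N T \<nu> (shift j \<beta>)) = \<Lambda> (coroot N T \<nu> \<beta>)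
    - of_real (2 * of_int j * Re (\<Lambda> c_elt) / (norm (dual_vector (fst \<beta>)))\<^sup>2)"
proof -
  let ?d = "(norm (dual_vector (fst \<beta>)))\<^sup>2"
  have c: "c_elt \<in> ext_cartan T \<times> ext_cartan T" using T_zero by (simp add: c_elt_def ext_cartan_def)
  have s: "subspace (ext_cartan T \<times> ext_cartan T)" by (intro subspace_Times ext_cartan_subspace)
  have "\<Lambda> c_elt \<in> \<real>" using L T_zero by (auto simp: im_dual_def c_elt_def ext_cartan_def zero_prod_def)
  then have re: "\<Lambda> c_elt = of_real (Re (\<Lambda> c_elt))" by (simp add: complex_is_Real_iff complex_eq_iff)
  have cs: "cscale (of_real x) v = x *\<^sub>R v" for x and v :: "'k cartan \<times> 'k cartan"
    by (simp add: cscale_def prod_eq_iff)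
  have "coroot N T \<nu> (shift j \<beta>) = coroot N T \<nu> \<beta> + cscale (of_real (- (2 * of_int j / ?d))) c_elt"
    unfolding coroot_eq[of "shift j \<beta>", unfolded fst_shift, OF r] coroot_eq[OF r] root_height_shift cs
    by (simp add: c_elt_def distrib_left add_divide_distrib diff_divide_distrib)
  moreover have "cscale (of_real (- (2 * of_int j / ?d))) c_elt \<in> ext_cartan T \<times> ext_cartan T"
    unfolding cs by (rule subspace_scale[OF s c])
  moreover have "\<Lambda> (u + v) = \<Lambda> u + \<Lambda> v"
    if "u \<in> ext_cartan T \<times> ext_cartan T" "v \<in> ext_cartan T \<times> ext_cartan T" for u v
    by (rule cdualD(2)[OF im_dual_cdual[OF L] that])
  ultimately have "\<Lambda> (coroot N T \<nu> (shift j \<beta>))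
      = \<Lambda> (coroot N T \<nu> \<beta>) + \<Lambda> (cscale (of_real (- (2 * of_int j / ?d))) c_elt)"
    using coroot_ext_cartan[OF r, of \<nu>] by presburger
  also have "\<Lambda> (cscale (of_real (- (2 * of_int j / ?d))) c_elt) = of_real (- (2 * of_int j / ?d)) * \<Lambda> c_elt"
    by (rule cdualD(3)[OF im_dual_cdual[OF L] c])
  finally have "\<Lambda> (coroot N T \<nu> (shift j \<beta>)) = \<Lambda> (coroot N T \<nu> \<beta>) + of_real (- (2 * of_int j / ?d)) * \<Lambda> c_elt" .
  then show ?thesis by (subst (asm) re) simp
qed

end

section \<open>The highest weight module as an energy-graded module\<close>

locale energy_setting = fixed_cartan \<phi> N T
  for \<phi> :: "'k::hilbert_lie \<Rightarrow> 'k" and N :: nat and T :: "'k set" +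
  fixes \<nu> \<nu>' :: "'k \<times> 'k \<Rightarrow> complex" and \<Lambda> :: "'k cartan \<times> 'k cartan \<Rightarrow> complex"
    and sc :: "complex \<Rightarrow> 'v::ab_group_add \<Rightarrow> 'v" and \<rho> :: "'k aff \<times> 'k aff \<Rightarrow> 'v \<Rightarrow> 'v"
    and v\<Lambda> :: 'v and D :: "'v \<Rightarrow> 'v"
  assumes nu: "\<nu> \<in> im_dual T" and nu': "\<nu>' \<in> im_dual T"
    and Lambda: "\<Lambda> \<in> im_dual (ext_cartan T)" and level: "\<Lambda> c_elt \<noteq> 0"
    and is_L: "is_L \<phi> N T \<nu> \<Lambda> sc \<rho> v\<Lambda>"
    and extension: "derivation_extension \<phi> N T \<nu> \<nu>' sc \<rho> v\<Lambda> D"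
begin

abbreviation "H \<equiv> ext_cartan T \<times> ext_cartan T"
abbreviation "core \<equiv> core_algebra \<phi> N T \<nu>"

text \<open>Off the Cartan subalgebra the operators are \<open>0\<close>. Consequently a functional that is the weight of a
  nonzero vector vanishes there, and weights can be compared as functions on the whole type.\<close>

definition hop :: "'k cartan \<times> 'k cartan \<Rightarrow> 'v \<Rightarrow> 'v" where
  "hop h = (if h \<in> H then \<rho> (cembed h) else (\<lambda>_. 0))"

definition X :: "('k \<times> 'k \<Rightarrow> complex) \<times> int \<Rightarrow> ('v \<Rightarrow> 'v) set" where
  "X \<beta> = \<rho> ` (aff_root_space \<phi> N T \<beta> \<inter> core)"

lemma core_cartan: "h \<in> H \<Longrightarrow> cembed h \<in> core"
  unfolding core_algebra_def by (rule hull_inc) blast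

lemma core_compact: "\<beta> \<in> compact_roots \<phi> N T \<Longrightarrow> x \<in> aff_root_space \<phi> N T \<beta> \<Longrightarrow> x \<in> core"
  unfolding core_algebra_def by (rule hull_inc) blast

lemma core_bracket: "x \<in> core \<Longrightarrow> y \<in> core \<Longrightarrow> aff_cbracket T \<nu> x y \<in> core"
  unfolding core_algebra_def hull_def by blast

lemma core_subspace: "CS.subspace core"
  unfolding core_algebra_def hull_def by (rule CS.subspace_Inter) blast

lemma rep: "lie_rep core (aff_cbracket T \<nu>) sc \<rho>" using is_L by (simp add: is_L_def)

lemma rep_linear: "x \<in> core \<Longrightarrow> Vector_Spaces.linear sc sc (\<rho> x)"
  and rep_scale: "x \<in> core \<Longrightarrow> \<rho> (cscale c x) v = sc c (\<rho> x v)"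
  and rep_add: "x \<in> core \<Longrightarrow> y \<in> core \<Longrightarrow> \<rho> (x + y) v = \<rho> x v + \<rho> y v"
  and rep_bracket: "x \<in> core \<Longrightarrow> y \<in> core \<Longrightarrow> \<rho> (aff_cbracket T \<nu> x y) v = \<rho> x (\<rho> y v) - \<rho> y (\<rho> x v)"
  using rep unfolding lie_rep_def by blast+

sublocale V: vector_space sc using rep by (simp add: lie_rep_def)

lemma rep_zero: "\<rho> 0 v = 0"
  using rep_scale[OF CS.subspace_0[OF core_subspace], of 0 v] by simp

lemma X_E:
  assumes "x \<in> X \<beta>"
  obtains u where "u \<in> weight_space_kn \<phi> N T \<beta>" "root_loop (snd \<beta>) u \<in> core" "x = \<rho> (root_loop (snd \<beta>) u)"
  using assms unfolding X_def aff_root_space_eq by blast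

lemma X_I: "u \<in> weight_space_kn \<phi> N T \<beta> \<Longrightarrow> root_loop (snd \<beta>) u \<in> core \<Longrightarrow> \<rho> (root_loop (snd \<beta>) u) \<in> X \<beta>"
  unfolding X_def aff_root_space_eq by blast

text \<open>\<open>f\<close> is the multiple of the conjugate of \<open>e\<close> for which the bracket is exactly the coroot.\<close>

lemma sl2_pair:
  assumes b: "\<beta> \<in> compact_roots \<phi> N T"
  shows "\<exists>e\<in>X \<beta>. \<exists>f\<in>X (- \<beta>). \<forall>v. e (f v) - f (e v) = hop (coroot N T \<nu> \<beta>) v"
proof -
  have r: "\<beta> \<in> aff_roots \<phi> N T" "fst \<beta> \<noteq> 0" using b by (auto simp: compact_root_iff)
  obtain u where u: "u \<in> weight_space_kn \<phi> N T \<beta>" "u \<noteq> 0" by (rule aff_root_vector[OF r(1)])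
  have rp: "representable (fst \<beta>)" by (rule aff_root_representable[OF r(1)])
  let ?t = "dual_vector (fst \<beta>)"
  let ?n = "(norm (fst u))\<^sup>2"
  note s = weight_vector_sl2[OF representableD(1)[OF rp] r(2), of u "snd \<beta>", unfolded prod.collapse, OF u]
  have n: "?n \<noteq> 0" using s(3) by simp
  have d: "(norm ?t)\<^sup>2 \<noteq> 0" using dual_vector_nonzero[OF rp r(2)] by simp
  define c where "c = - (1 / (?n * (norm ?t)\<^sup>2))"
  define y where "y = cscale (of_real c) (conjugate u)"
  have y: "y \<in> weight_space_kn \<phi> N T (- \<beta>)"
    unfolding y_def by (rule kn_cscale[OF _ kn_conjugate[OF _ u(1)]])
      (use representableD(1)[OF rp] im_dual_uminus in auto)
  have "bilinear_form u y = of_real c * bilinear_form u (conjugate u)"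
    unfolding y_def using bilinear_form_cscale[of 1 u "of_real c" "conjugate u"] by simp
  also have "\<dots> = of_real (- 2 / (norm ?t)\<^sup>2)"
    using s(2) n d by (simp add: bilinear_form_def conjugate_def complex_eq_iff c_def dot_square_norm inner_commute[of "snd u"] field_simps)
  finally have bf: "bilinear_form u y = of_real (- 2 / (norm ?t)\<^sup>2)" .
  have "cbracket lie u y = cscale (of_real c) (cbracket lie u (conjugate u))"
    unfolding y_def using cbracket_cscale[of 1 u "of_real c" "conjugate u"] by simp
  also have "cbracket lie u (conjugate u) = (0, (- 2 * ?n) *\<^sub>R ?t)"
  proof -
    have "cbracket lie u (conjugate u) = (0, - (2 *\<^sub>R lie (fst u) (snd u)))"
      using lie_anticommute[of "fst u" "snd u"] by (simp add: cbracket_def conjugate_def lie_self scaleR_2)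
    then show ?thesis using s(4) by simp
  qed
  also have "cscale (of_real c) (0, (- 2 * ?n) *\<^sub>R ?t) = (0, (2 / (norm ?t)\<^sup>2) *\<^sub>R ?t)"
    using n d by (simp add: cscale_def c_def field_simps)
  finally have br: "cbracket lie u y = (0, (2 / (norm ?t)\<^sup>2) *\<^sub>R ?t)" .
  let ?e = "root_loop (snd \<beta>) u" and ?f = "root_loop (- snd \<beta>) y"
  have e: "?e \<in> core" using core_compact[OF b] u unfolding aff_root_space_eq by blast
  have f: "?f \<in> core" using core_compact[OF compact_root_uminus[OF b]] y unfolding aff_root_space_eq by auto
  have "aff_cbracket T \<nu> ?e ?f = cembed (coroot N T \<nu> \<beta>)"
    unfolding loop_bracket_opposite[OF nu r(1) refl u(1)] bf br coroot_eq[OF rp] by (simp add: mult.commute)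
  then have "\<rho> ?e (\<rho> ?f v) - \<rho> ?f (\<rho> ?e v) = hop (coroot N T \<nu> \<beta>) v" for v
    using rep_bracket[OF e f] coroot_ext_cartan[OF rp] by (simp add: hop_def)
  moreover have "\<rho> ?e \<in> X \<beta>" "\<rho> ?f \<in> X (- \<beta>)" using X_I[OF u(1) e] X_I[OF y] f by simp_all
  ultimately show ?thesis by blast
qed

lemma root_loop_zero: "root_loop n 0 = 0"
  by (simp add: root_loop_def phase_loop_def zero_prod_def zero_fun_def cscale_def)

text \<open>The elements of the core algebra that preserve \<open>W\<close> form a subalgebra containing its generators, so
  \<open>W\<close> is a submodule.\<close>

lemma subrep_UNIV:
  assumes W: "V.subspace W" "v\<Lambda> \<in> W" and h: "\<And>h w. w \<in> W \<Longrightarrow> hop h w \<in> W"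
    and x: "\<And>\<beta> x w. \<beta> \<in> compact_roots \<phi> N T \<Longrightarrow> x \<in> X \<beta> \<Longrightarrow> w \<in> W \<Longrightarrow> x w \<in> W"
  shows "W = UNIV"
proof -
  define S where "S = {x \<in> core. \<forall>w\<in>W. \<rho> x w \<in> W}"
  have S_I: "z \<in> S" if "z \<in> core" "\<And>w. w \<in> W \<Longrightarrow> \<rho> z w \<in> W" for z using that by (simp add: S_def)
  have S_D: "z \<in> core" "w \<in> W \<Longrightarrow> \<rho> z w \<in> W" if "z \<in> S" for z w using that by (simp_all add: S_def)
  have cartan: "cembed ` H \<subseteq> S"
  proof (rule image_subsetI)
    fix g assume g: "g \<in> H"
    have "\<rho> (cembed g) w \<in> W" if "w \<in> W" for w using h[OF that, of g] g by (simp only: hop_def if_True)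
    then show "cembed g \<in> S" by (rule S_I[OF core_cartan[OF g]])
  qed
  have root: "aff_root_space \<phi> N T \<beta> \<subseteq> S" if b: "\<beta> \<in> compact_roots \<phi> N T" for \<beta>
  proof
    fix z assume z: "z \<in> aff_root_space \<phi> N T \<beta>"
    have "\<rho> z \<in> X \<beta>" unfolding X_def using z core_compact[OF b z] by blast
    then have "\<rho> z w \<in> W" if "w \<in> W" for w using x[OF b _ that] by blast
    then show "z \<in> S" by (rule S_I[OF core_compact[OF b z]])
  qed
  have sub: "CS.subspace S"
  proof (rule CS.subspaceI)
    show "0 \<in> S"
      by (rule S_I[OF CS.subspace_0[OF core_subspace]]) (simp only: rep_zero V.subspace_0[OF W(1)])
    fix y z assume y: "y \<in> S" and z: "z \<in> S"
    show "y + z \<in> S"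
      by (rule S_I[OF CS.subspace_add[OF core_subspace S_D(1)[OF y] S_D(1)[OF z]]])
        (simp only: rep_add[OF S_D(1)[OF y] S_D(1)[OF z]] V.subspace_add[OF W(1) S_D(2)[OF y] S_D(2)[OF z]])
  next
    fix c z assume z: "z \<in> S"
    show "cscale c z \<in> S"
      by (rule S_I[OF CS.subspace_scale[OF core_subspace S_D(1)[OF z]]])
        (simp only: rep_scale[OF S_D(1)[OF z]] V.subspace_scale[OF W(1) S_D(2)[OF z]])
  qed
  have bracket: "aff_cbracket T \<nu> y z \<in> S" if y: "y \<in> S" and z: "z \<in> S" for y z
    by (rule S_I[OF core_bracket[OF S_D(1)[OF y] S_D(1)[OF z]]])
      (simp only: rep_bracket[OF S_D(1)[OF y] S_D(1)[OF z]]
        V.subspace_diff[OF W(1) S_D(2)[OF y S_D(2)[OF z]] S_D(2)[OF z S_D(2)[OF y]]])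
  have "core \<subseteq> S"
    unfolding core_algebra_def by (rule hull_minimal) (use cartan root sub bracket in blast)+
  then have "subrep core sc \<rho> W" using W(1) S_D(2) unfolding subrep_def by blast
  then have "subrep core sc \<rho> hull {v\<Lambda>} \<subseteq> W" using W(2) by (intro hull_minimal) blast+
  then show ?thesis using is_L unfolding is_L_def highest_weight_rep_def by blast
qed

sublocale M: energy_module sc hop "aff_roots \<phi> N T" "compact_roots \<phi> N T" X "root_functional N T \<nu>"
  "coroot N T \<nu>" v\<Lambda> \<Lambda> D "root_height N T \<nu>'"
proof (intro energy_module.intro V.vector_space_axioms energy_module_axioms.intro)
  fix h
  show "Vector_Spaces.linear sc sc (hop h)"
  proof (cases "h \<in> H")
    case True
    then show ?thesis using rep_linear[OF core_cartan] by (simp add: hop_def)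
  next
    case False
    show ?thesis unfolding hop_def using False
      by (simp add: Vector_Spaces.linear_iff V.vector_space_axioms)
  qed
next
  fix \<beta> x assume "\<beta> \<in> aff_roots \<phi> N T" "x \<in> X \<beta>"
  then show "Vector_Spaces.linear sc sc x" using rep_linear by (elim X_E) simp
next
  fix \<beta> x h v assume b: "\<beta> \<in> aff_roots \<phi> N T" "x \<in> X \<beta>"
  obtain u where u: "u \<in> weight_space_kn \<phi> N T \<beta>" "root_loop (snd \<beta>) u \<in> core" "x = \<rho> (root_loop (snd \<beta>) u)"
    using X_E[OF b(2)] .
  interpret L: Vector_Spaces.linear sc sc x using rep_linear u by simp
  show "hop h (x v) = x (hop h v) + sc (root_functional N T \<nu> \<beta> h) (x v)"
  proof (cases "h \<in> H")
    case True
    have "\<rho> (cembed h) (x v) - x (\<rho> (cembed h) v) = sc (root_functional N T \<nu> \<beta> h) (x v)"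
      using rep_bracket[OF core_cartan[OF True] u(2), of v] cartan_bracket[OF nu b(1) u(1) True]
        rep_scale[OF u(2)] u(3) by simp
    then show ?thesis using True by (simp add: hop_def algebra_simps)
  next
    case False
    then show ?thesis by (simp add: hop_def root_functional_outside L.zero)
  qed
next
  fix \<beta> \<beta>' x y assume b: "\<beta> \<in> aff_roots \<phi> N T" "\<beta>' \<in> aff_roots \<phi> N T" "x \<in> X \<beta>" "y \<in> X \<beta>'"
  obtain u where u: "u \<in> weight_space_kn \<phi> N T \<beta>" "root_loop (snd \<beta>) u \<in> core" "x = \<rho> (root_loop (snd \<beta>) u)"
    using X_E[OF b(3)] .
  obtain w where w: "w \<in> weight_space_kn \<phi> N T \<beta>'" "root_loop (snd \<beta>') w \<in> core" "y = \<rho> (root_loop (snd \<beta>') w)"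
    using X_E[OF b(4)] .
  have kn: "cbracket lie u w \<in> weight_space_kn \<phi> N T (\<beta> + \<beta>')"
    by (rule kn_bracket[OF aff_root_im_dual[OF b(1)] aff_root_im_dual[OF b(2)] u(1) w(1)])
  have c: "aff_cbracket T \<nu> (root_loop (snd \<beta>) u) (root_loop (snd \<beta>') w) \<in> core"
    by (rule core_bracket[OF u(2) w(2)])
  have eq: "x (y v) - y (x v) = \<rho> (aff_cbracket T \<nu> (root_loop (snd \<beta>) u) (root_loop (snd \<beta>') w)) v" for v
    using rep_bracket[OF u(2) w(2)] u(3) w(3) by simp
  show "(\<lambda>v. x (y v) - y (x v)) \<in> X (\<beta> + \<beta>')" if "\<beta> + \<beta>' \<in> aff_roots \<phi> N T"
  proof -
    have "\<beta> + \<beta>' \<noteq> 0" using that by (auto simp: aff_roots_def zero_prod_def)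
    note l = loop_bracket_root[OF nu b(1,2) this u(1) w(1)]
    show ?thesis unfolding eq l using X_I[OF kn] c unfolding l by (simp add: eta_contract_eq)
  qed
  show "\<exists>h. \<forall>v. x (y v) - y (x v) = hop h v" if z: "\<beta> + \<beta>' = 0"
  proof -
    have s: "snd \<beta>' = - snd \<beta>" using z by (simp add: prod_eq_iff eq_neg_iff_add_eq_0 add.commute)
    have "cbracket lie u w \<in> T \<times> T" using kn by (simp only: z kn_zero)
    then show ?thesis
      unfolding eq loop_bracket_opposite[OF nu b(1) s u(1)]
      by (intro exI[of _ "((- root_height N T \<nu> \<beta> * Im (bilinear_form u w), fst (cbracket lie u w), 0),
            (root_height N T \<nu> \<beta> * Re (bilinear_form u w), snd (cbracket lie u w), 0))"])
        (auto simp: hop_def ext_cartan_def)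
  qed
  show "x (y v) - y (x v) = 0" if n: "\<beta> + \<beta>' \<notin> aff_roots \<phi> N T" "\<beta> + \<beta>' \<noteq> 0" for v
  proof -
    have "fst (\<beta> + \<beta>') \<in> im_dual T"
      using im_dual_add[OF T_subspace aff_root_im_dual[OF b(1)] aff_root_im_dual[OF b(2)]] by simp
    then have "cbracket lie u w = 0" using aff_rootI[OF _ n(2) kn] n(1) by blast
    then show ?thesis unfolding eq loop_bracket_root[OF nu b(1,2) n(2) u(1) w(1)]
      by (simp add: root_loop_zero rep_zero)
  qed
next
  show "compact_roots \<phi> N T \<subseteq> aff_roots \<phi> N T" by (auto simp: compact_root_iff)
next
  fix \<beta> assume b: "\<beta> \<in> compact_roots \<phi> N T"
  have rp: "representable (fst \<beta>)" and ne: "fst \<beta> \<noteq> 0"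
    using b aff_root_representable by (auto simp: compact_root_iff)
  show "- \<beta> \<in> compact_roots \<phi> N T" by (rule compact_root_uminus[OF b])
  show "\<exists>e\<in>X \<beta>. \<exists>f\<in>X (- \<beta>). \<forall>v. e (f v) - f (e v) = hop (coroot N T \<nu> \<beta>) v" by (rule sl2_pair[OF b])
  show "root_functional N T \<nu> \<beta> (coroot N T \<nu> \<beta>) = 2"
    unfolding root_functional_coroot[OF rp rp] using dual_vector_nonzero[OF rp ne] by (simp add: dot_square_norm)
  show "root_functional N T \<nu> (- \<beta>) = - root_functional N T \<nu> \<beta>" by (rule root_functional_uminus[OF nu rp])
  show "root_height N T \<nu>' (- \<beta>) = - root_height N T \<nu>' \<beta>" by (rule root_height_uminus[OF nu' rp])
next
  fix \<beta> \<beta>' assume b: "\<beta> \<in> aff_roots \<phi> N T - compact_roots \<phi> N T" "\<beta>' \<in> compact_roots \<phi> N T"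
  have "fst \<beta> = 0" "representable (fst \<beta>')" using b aff_root_representable by (auto simp: compact_root_iff)
  then show "root_functional N T \<nu> \<beta> (coroot N T \<nu> \<beta>') = 0"
    using root_functional_coroot[of \<beta>' \<beta>] representable_zero by simp
next
  fix \<beta> x v assume "\<beta> \<in> compact_roots \<phi> N T" "x \<in> X \<beta>"
  then show "\<exists>n. (x ^^ n) v = 0" using is_L unfolding is_L_def integrable_rep_def X_def by blast
next
  show "v\<Lambda> \<noteq> 0" using is_L by (simp add: is_L_def highest_weight_rep_def)
next
  fix h
  have "v\<Lambda> \<in> weight_space T sc \<rho> \<Lambda>" using is_L by (simp add: is_L_def highest_weight_rep_def)
  then have "\<forall>h\<in>H. \<rho> (cembed h) v\<Lambda> = sc (\<Lambda> h) v\<Lambda>" unfolding weight_space_def by blast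
  moreover have "\<Lambda> h = 0" if "h \<notin> H" using Lambda that unfolding im_dual_def cdual_def by blast
  ultimately show "hop h v\<Lambda> = sc (\<Lambda> h) v\<Lambda>" unfolding hop_def by (cases "h \<in> H") (simp_all only: if_True if_False V.scale_zero_left not_False_eq_True simp_thms)
next
  fix W assume "V.subspace W" "v\<Lambda> \<in> W" "\<And>h w. w \<in> W \<Longrightarrow> hop h w \<in> W"
    "\<And>\<beta> x w. \<beta> \<in> compact_roots \<phi> N T \<Longrightarrow> x \<in> X \<beta> \<Longrightarrow> w \<in> W \<Longrightarrow> x w \<in> W"
  then show "W = UNIV" by (rule subrep_UNIV)
next
  show "Vector_Spaces.linear sc sc D" "D v\<Lambda> = 0" using extension by (auto simp: derivation_extension_def)
next
  fix \<beta> x v assume b: "\<beta> \<in> aff_roots \<phi> N T" "x \<in> X \<beta>"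
  obtain u where u: "u \<in> weight_space_kn \<phi> N T \<beta>" "root_loop (snd \<beta>) u \<in> core" "x = \<rho> (root_loop (snd \<beta>) u)"
    using X_E[OF b(2)] .
  have "\<rho> (map_prod (aff_deriv T \<nu>') (aff_deriv T \<nu>') (root_loop (snd \<beta>) u)) v = D (x v) - x (D v)"
    using extension u unfolding derivation_extension_def by blast
  then have "sc (\<i> * of_real (root_height N T \<nu>' \<beta>)) (x v) = D (x v) - x (D v)"
    unfolding aff_deriv_root_loop[OF nu' b(1) u(1)] rep_scale[OF u(2)] u(3) .
  then show "D (x v) = x (D v) + sc (\<i> * of_real (root_height N T \<nu>' \<beta>)) (x v)"
    by (simp add: algebra_simps)
qed

end

section \<open>Finiteness and discreteness\<close>

text \<open>A vector of \<open>span V\<close> is determined by its inner products with \<open>V\<close>.\<close>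

lemma finite_integral_lattice:
  fixes V :: "'a::real_inner set"
  assumes V: "finite V" and K: "finite K"
  shows "finite {a \<in> span V. \<forall>b\<in>V. 2 * inner a b / (norm b)\<^sup>2 \<in> K}" (is "finite ?A")
proof (rule inj_on_finite)
  let ?f = "\<lambda>a. restrict (\<lambda>b. 2 * inner a b / (norm b)\<^sup>2) V"
  show "finite (V \<rightarrow>\<^sub>E K)" using V K by (rule finite_PiE)
  show "?f ` ?A \<subseteq> V \<rightarrow>\<^sub>E K" by auto
  show "inj_on ?f ?A"
  proof (rule inj_onI)
    fix a c assume ac: "a \<in> ?A" "c \<in> ?A" "?f a = ?f c"
    have "inner (a - c) b = 0" if "b \<in> V" for b
    proof (cases "b = 0")
      case False
      have "2 * inner a b / (norm b)\<^sup>2 = 2 * inner c b / (norm b)\<^sup>2"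
        using fun_cong[OF ac(3), of b] that by simp
      then show ?thesis using False by (simp add: inner_diff_left)
    qed simp
    then have "orthogonal (a - c) b" if "b \<in> span V" for b
      using that orthogonal_to_span[of b V "a - c"] by (auto simp: orthogonal_def inner_commute)
    moreover have "a - c \<in> span V" using ac by (auto intro: span_diff)
    ultimately have "inner (a - c) (a - c) = 0" by (auto simp: orthogonal_def)
    then show "a = c" by simp
  qed
qed

lemma cartan_integer_bound:
  fixes a b :: "'a::real_inner"
  assumes "2 * inner a b / (norm b)\<^sup>2 = of_int m" "2 * inner b a / (norm a)\<^sup>2 = of_int n" "a \<noteq> 0" "b \<noteq> 0"
  shows "\<bar>m\<bar> \<le> 4"
proof (cases "m = 0")
  case False
  have i: "inner a b \<noteq> 0" using False assms(1) by auto
  then have n: "n \<noteq> 0" using assms(2,3) by (auto simp: inner_commute)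
  have "(inner a b)\<^sup>2 \<le> (norm a)\<^sup>2 * (norm b)\<^sup>2"
    using Cauchy_Schwarz_ineq[of a b] by (simp add: power2_norm_eq_inner)
  then have "4 * (inner a b)\<^sup>2 / ((norm a)\<^sup>2 * (norm b)\<^sup>2) \<le> 4" using assms by (simp add: field_simps)
  moreover have "of_int (m * n) = 4 * (inner a b)\<^sup>2 / ((norm a)\<^sup>2 * (norm b)\<^sup>2)"
    unfolding of_int_mult assms(1)[symmetric] assms(2)[symmetric] by (simp add: inner_commute power2_eq_square)
  ultimately have le: "of_int (m * n) \<le> (4::real)" and ge: "of_int (m * n) \<ge> (0::real)" by simp_all
  then have "m * n \<le> 4" "0 \<le> m * n" by linarith+
  then have "\<bar>m\<bar> * \<bar>n\<bar> \<le> 4" by (simp add: abs_mult[symmetric])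
  moreover have "\<bar>m\<bar> * 1 \<le> \<bar>m\<bar> * \<bar>n\<bar>" by (rule mult_left_mono) (use n in auto)
  ultimately show ?thesis by simp
qed simp

text \<open>For a single \<open>p\<close> the largest negative value \<open>n/N + p\<close> is attained at \<open>n = \<lceil>- p N\<rceil> - 1\<close>.\<close>

lemma negative_values_discrete:
  fixes P :: "real set"
  assumes "finite P" "N > 0"
  shows "\<exists>\<epsilon>>0. \<forall>p\<in>P. \<forall>n::int. of_int n / real N + p < 0 \<longrightarrow> of_int n / real N + p \<le> - \<epsilon>"
  using assms(1)
proof induction
  case empty
  then show ?case by (intro exI[of _ 1]) auto
next
  case (insert p P)
  then obtain \<epsilon> where e: "\<epsilon> > 0" "\<And>q n. q \<in> P \<Longrightarrow> of_int n / real N + q < 0 \<Longrightarrow> of_int n / real N + q \<le> - \<epsilon>"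
    by blast
  define k where "k = \<lceil>- p * real N\<rceil> - 1"
  define \<epsilon>' where "\<epsilon>' = - (of_int k / real N + p)"
  have k: "of_int k < - p * real N" unfolding k_def by linarith
  have e': "\<epsilon>' > 0" using k assms(2) by (simp add: \<epsilon>'_def field_simps)
  have "of_int n / real N + p \<le> - \<epsilon>'" if "of_int n / real N + p < 0" for n
  proof -
    have "of_int n < - p * real N" using that assms(2) by (simp add: field_simps)
    then have "n \<le> k" unfolding k_def by linarith
    then show ?thesis using assms(2) by (simp add: \<epsilon>'_def divide_right_mono)
  qed
  with e e' show ?case by (intro exI[of _ "min \<epsilon> \<epsilon>'"]) fastforce
qed

text \<open>As a function of \<open>j\<close> the right hand side is a quadratic polynomial with leading coefficient \<open>\<kappa>\<close>.\<close>

lemma quadratic_bounded_below: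
  fixes \<kappa> :: real
  assumes "\<kappa> \<noteq> 0" "\<And>j::int. m \<le> - ((p - of_int j * \<kappa>) * (q + of_int j))"
  shows "\<kappa> > 0"
proof (rule ccontr)
  assume "\<not> \<kappa> > 0"
  then have k: "\<kappa> < 0" using assms(1) by simp
  define B where "B = \<bar>\<kappa> * q - p\<bar> + \<bar>p * q\<bar> + \<bar>m\<bar> + 1"
  obtain j :: nat where j: "real j > B / (- \<kappa>)" using reals_Archimedean2 by blast
  have "B > 0" by (simp add: B_def)
  then have "B / (- \<kappa>) > 0" using k by (simp add: field_simps)
  then have j1: "real j \<ge> 1" using j by (cases j) auto
  have jk: "\<kappa> * real j + B < 0" using j k by (simp add: field_simps)
  have "- ((p - real j * \<kappa>) * (q + real j)) = real j * (\<kappa> * real j + (\<kappa> * q - p)) - p * q"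
    by (simp add: algebra_simps)
  also have "\<dots> \<le> real j * (\<kappa> * real j + \<bar>\<kappa> * q - p\<bar>) + real j * \<bar>p * q\<bar>"
  proof -
    have "\<bar>p * q\<bar> \<le> real j * \<bar>p * q\<bar>" using j1 mult_right_mono[of 1 "real j" "\<bar>p * q\<bar>"] by simp
    moreover have "real j * (\<kappa> * real j + (\<kappa> * q - p)) \<le> real j * (\<kappa> * real j + \<bar>\<kappa> * q - p\<bar>)"
      by (rule mult_left_mono) auto
    ultimately show ?thesis by linarith
  qed
  also have "\<dots> = real j * (\<kappa> * real j + B) - real j * (\<bar>m\<bar> + 1)" by (simp add: B_def algebra_simps)
  also have "\<dots> < 0 - (\<bar>m\<bar> + 1)"
  proof -
    have "real j * (\<kappa> * real j + B) < 0" using jk j1 by (simp add: mult_pos_neg)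
    moreover have "\<bar>m\<bar> + 1 \<le> real j * (\<bar>m\<bar> + 1)" using j1 mult_right_mono[of 1 "real j" "\<bar>m\<bar> + 1"] by simp
    ultimately show ?thesis by linarith
  qed
  finally show False using assms(2)[of "int j"] by simp
qed

section \<open>The energy spectrum\<close>

context energy_setting
begin

text \<open>The combinations of positive roots with coefficients in \<open>\<nat>\<close>. Pointedness is the independence
  required of a positive system.\<close>

lemma positive_cone:
  obtains Q where "0 \<in> Q" "\<And>a b. a \<in> Q \<Longrightarrow> b \<in> Q \<Longrightarrow> a + b \<in> Q" "\<And>a. a \<in> Q \<Longrightarrow> - a \<in> Q \<Longrightarrow> a = 0"
    "\<And>\<gamma>. \<gamma> \<in> M.weights \<Longrightarrow> \<Lambda> - \<gamma> \<in> Q"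
proof -
  obtain P where P: "positive_system \<phi> N T \<nu> P"
    and hw: "\<And>\<beta> x. \<beta> \<in> P \<Longrightarrow> x \<in> aff_root_space \<phi> N T \<beta> \<inter> core \<Longrightarrow> \<rho> x v\<Lambda> = 0"
    using is_L unfolding is_L_def highest_weight_rep_def by blast
  let ?c = "\<lambda>F c. \<Sum>\<beta>\<in>F. real (c \<beta>) *\<^sub>R root_functional N T \<nu> \<beta>"
  have decomposition: "aff_roots \<phi> N T = P \<union> uminus ` P"
    using P unfolding positive_system_def by (elim conjE)
  have indep: "\<forall>F c. finite F \<and> F \<subseteq> P \<and> ?c F c = 0 \<longrightarrow> (\<forall>\<beta>\<in>F. c \<beta> = 0)"
    using P unfolding positive_system_def by (elim conjE)
  define Q where "Q = {?c F c |F c. finite F \<and> F \<subseteq> P}"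
  have Q_I: "?c F c \<in> Q" if "finite F" "F \<subseteq> P" for F c
    unfolding Q_def using that by (intro CollectI exI[of _ F] exI[of _ c]) simp
  have ext: "?c F c = ?c G (\<lambda>\<beta>. if \<beta> \<in> F then c \<beta> else 0)" if "finite G" "F \<subseteq> G" for F G c
    using that by (intro sum.mono_neutral_cong_left) auto
  have merge: "\<exists>G c' d'. finite G \<and> G \<subseteq> P \<and> a = ?c G c' \<and> b = ?c G d'" if ab: "a \<in> Q" "b \<in> Q" for a b
  proof -
    obtain F c where F: "a = ?c F c" "finite F" "F \<subseteq> P" using ab unfolding Q_def by blast
    obtain G d where G: "b = ?c G d" "finite G" "G \<subseteq> P" using ab unfolding Q_def by blast
    have "finite (F \<union> G)" "F \<union> G \<subseteq> P" using F G by auto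
    moreover have "a = ?c (F \<union> G) (\<lambda>\<beta>. if \<beta> \<in> F then c \<beta> else 0)" "b = ?c (F \<union> G) (\<lambda>\<beta>. if \<beta> \<in> G then d \<beta> else 0)"
      unfolding F(1) G(1) using F G by (intro ext; blast)+
    ultimately show ?thesis by (intro exI conjI)
  qed
  have sum: "?c G c + ?c G d = ?c G (\<lambda>\<beta>. c \<beta> + d \<beta>)" for G c d
    by (simp add: sum.distrib scaleR_add_left)
  have Q0: "0 \<in> Q" unfolding Q_def by (intro CollectI exI[of _ "{}"]) simp
  have Qadd: "a + b \<in> Q" if ab: "a \<in> Q" "b \<in> Q" for a b
  proof -
    obtain G c d where G: "finite G" "G \<subseteq> P" "a = ?c G c" "b = ?c G d" using merge[OF ab] by blast
    show ?thesis unfolding G(3,4) sum by (rule Q_I[OF G(1,2)])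
  qed
  have Qpt: "a = 0" if ab: "a \<in> Q" "- a \<in> Q" for a
  proof -
    obtain G c d where G: "finite G" "G \<subseteq> P" "a = ?c G c" "- a = ?c G d" using merge[OF ab] by blast
    have "a + - a = ?c G (\<lambda>\<beta>. c \<beta> + d \<beta>)" unfolding sum[symmetric] G(3,4)[symmetric] ..
    then have "?c G (\<lambda>\<beta>. c \<beta> + d \<beta>) = 0" by (simp only: right_minus)
    from indep[rule_format, OF conjI[OF G(1) conjI[OF G(2) this]]] have "\<forall>\<beta>\<in>G. c \<beta> = 0" by simp
    then show ?thesis unfolding G(3) by simp
  qed
  have Qroot: "root_functional N T \<nu> \<beta> \<in> Q" if "\<beta> \<in> P" for \<beta>
    unfolding Q_def using that by (intro CollectI exI[of _ "{\<beta>}"] exI[of _ "\<lambda>_. 1"]) simp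
  have pos: "- root_functional N T \<nu> \<beta> \<in> Q \<or> (\<forall>x\<in>X \<beta>. x v\<Lambda> = 0)" if b: "\<beta> \<in> aff_roots \<phi> N T" for \<beta>
  proof (cases "\<beta> \<in> P")
    case True
    then show ?thesis using hw by (auto simp: X_def)
  next
    case False
    then obtain \<beta>' where "\<beta>' \<in> P" "\<beta> = - \<beta>'" using b unfolding decomposition by blast
    then have "- \<beta> \<in> P" by simp
    then have "- root_functional N T \<nu> \<beta> \<in> Q"
      using Qroot[of "- \<beta>"] root_functional_uminus[OF nu aff_root_representable[OF b]] by simp
    then show ?thesis by blast
  qed
  have below: "\<Lambda> - \<gamma> \<in> Q" if "\<gamma> \<in> M.weights" for \<gamma>
    by (rule M.weights_below[OF Q0 Qadd pos that])
  show ?thesis by (rule that[OF Q0 Qadd Qpt below])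
qed

lemma Lambda_extreme: "M.extreme \<Lambda>"
proof -
  obtain Q where Q: "0 \<in> Q" "\<And>a b. a \<in> Q \<Longrightarrow> b \<in> Q \<Longrightarrow> a + b \<in> Q" "\<And>a. a \<in> Q \<Longrightarrow> - a \<in> Q \<Longrightarrow> a = 0"
    "\<And>\<gamma>. \<gamma> \<in> M.weights \<Longrightarrow> \<Lambda> - \<gamma> \<in> Q" by (rule positive_cone) blast
  show ?thesis
    unfolding M.extreme_def
  proof (intro allI impI)
    fix \<eta> assume "\<Lambda> + \<eta> \<in> M.weights" "\<Lambda> - \<eta> \<in> M.weights"
    then have "\<Lambda> - (\<Lambda> + \<eta>) \<in> Q" "\<Lambda> - (\<Lambda> - \<eta>) \<in> Q" using Q(4) by blast+
    moreover have "\<Lambda> - (\<Lambda> + \<eta>) = - \<eta>" "\<Lambda> - (\<Lambda> - \<eta>) = \<eta>" by (rule ext, simp)+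
    ultimately show "\<eta> = 0" using Q(3)[of \<eta>] by (simp only:)
  qed
qed

lemma level_real: "\<Lambda> c_elt = of_real (Re (\<Lambda> c_elt))" "Re (\<Lambda> c_elt) \<noteq> 0"
proof -
  have "\<Lambda> c_elt \<in> \<real>" using Lambda T_zero by (auto simp: im_dual_def c_elt_def ext_cartan_def zero_prod_def)
  then show 1: "\<Lambda> c_elt = of_real (Re (\<Lambda> c_elt))" by (simp add: complex_is_Real_iff complex_eq_iff)
  show "Re (\<Lambda> c_elt) \<noteq> 0" using level 1 by auto
qed

lemma compact_dual_vector:
  assumes "\<beta> \<in> compact_roots \<phi> N T"
  shows "representable (fst \<beta>)" "dual_vector (fst \<beta>) \<noteq> 0"
  using assms aff_root_representable dual_vector_nonzero by (auto simp: compact_root_iff)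

text \<open>If \<open>\<gamma>\<close> and \<open>\<gamma> + \<alpha>\<close> are weights, both take integral values at the coroot of \<open>\<beta>\<close>. Since the level is
  nonzero, \<open>\<Lambda>\<close> differs at the coroots of \<open>\<alpha>\<close> and \<open>\<alpha> + \<delta>\<close>, which provides such a pair.\<close>

lemma cartan_integer:
  assumes a: "\<alpha> \<in> compact_roots \<phi> N T" and b: "\<beta> \<in> compact_roots \<phi> N T"
  shows "root_functional N T \<nu> \<alpha> (coroot N T \<nu> \<beta>) \<in> \<int>"
proof -
  note ra = compact_dual_vector[OF a]
  have "root_functional N T \<nu> (shift 1 \<alpha>) (coroot N T \<nu> \<alpha>) \<noteq> 0"
    using root_functional_coroot[of \<alpha> "shift 1 \<alpha>"] ra by (simp add: dot_square_norm)
  moreover have "\<Lambda> (coroot N T \<nu> \<alpha>) \<noteq> \<Lambda> (coroot N T \<nu> (shift 1 \<alpha>))"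
    unfolding coroot_shift[OF ra(1) Lambda] using level_real(2) ra(2) by simp
  ultimately obtain \<gamma> where g: "\<gamma> \<in> M.weights" "\<gamma> + root_functional N T \<nu> \<alpha> \<in> M.weights"
    using M.weight_step_exists[OF a compact_root_shift[OF a]] by blast
  have "(\<gamma> + root_functional N T \<nu> \<alpha>) (coroot N T \<nu> \<beta>) - \<gamma> (coroot N T \<nu> \<beta>) \<in> \<int>"
    by (rule Ints_diff[OF M.weights_reflect(1)[OF b g(2)] M.weights_reflect(1)[OF b g(1)]])
  then show ?thesis by simp
qed

text \<open>The roots, compact or imaginary, whose finite part is in the real span of the finite parts of \<open>F\<close>. The
  span, rather than the closure of \<open>F\<close> under brackets, makes closedness evident.\<close>

definition subsystem :: "(('k \<times> 'k \<Rightarrow> complex) \<times> int) set \<Rightarrow> (('k \<times> 'k \<Rightarrow> complex) \<times> int) set" where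
  "subsystem F = {\<beta> \<in> aff_roots \<phi> N T. dual_vector (fst \<beta>) \<in> span ((\<lambda>\<beta>. dual_vector (fst \<beta>)) ` F)}"

lemma subsystem_finite:
  assumes F: "finite F" "F \<subseteq> compact_roots \<phi> N T"
  shows "finite ((\<lambda>\<beta>. dual_vector (fst \<beta>)) ` subsystem F)"
proof (rule finite_subset)
  let ?d = "\<lambda>\<beta>. dual_vector (fst \<beta>)"
  let ?K = "real_of_int ` {-4..4}"
  show "finite {a \<in> span (?d ` F). \<forall>b\<in>?d ` F. 2 * inner a b / (norm b)\<^sup>2 \<in> ?K}"
    by (rule finite_integral_lattice) (use F in auto)
  have "2 * inner (?d \<alpha>) (?d \<beta>) / (norm (?d \<beta>))\<^sup>2 \<in> ?K" if a: "\<alpha> \<in> aff_roots \<phi> N T" and b: "\<beta> \<in> F" for \<alpha> \<beta>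
  proof (cases "fst \<alpha> = 0")
    case True
    then show ?thesis using representable_zero(2) by (auto intro!: image_eqI[of _ _ 0])
  next
    case False
    then have ca: "\<alpha> \<in> compact_roots \<phi> N T" using a by (simp add: compact_root_iff)
    have cb: "\<beta> \<in> compact_roots \<phi> N T" using b F by blast
    have "of_real (2 * inner (?d \<alpha>) (?d \<beta>) / (norm (?d \<beta>))\<^sup>2) \<in> (\<int> :: complex set)"
      using cartan_integer[OF ca cb] root_functional_coroot compact_dual_vector[OF ca] compact_dual_vector[OF cb] by simp
    then obtain m where m: "2 * inner (?d \<alpha>) (?d \<beta>) / (norm (?d \<beta>))\<^sup>2 = of_int m"
      unfolding of_real_in_Ints_iff by (auto elim: Ints_cases)
    have "of_real (2 * inner (?d \<beta>) (?d \<alpha>) / (norm (?d \<alpha>))\<^sup>2) \<in> (\<int> :: complex set)"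
      using cartan_integer[OF cb ca] root_functional_coroot compact_dual_vector[OF ca] compact_dual_vector[OF cb] by simp
    then obtain n where n: "2 * inner (?d \<beta>) (?d \<alpha>) / (norm (?d \<alpha>))\<^sup>2 = of_int n"
      unfolding of_real_in_Ints_iff by (auto elim: Ints_cases)
    have "\<bar>m\<bar> \<le> 4"
      by (rule cartan_integer_bound[OF m n compact_dual_vector(2)[OF ca] compact_dual_vector(2)[OF cb]])
    then show ?thesis unfolding m by (intro imageI) auto
  qed
  then show "?d ` subsystem F \<subseteq> {a \<in> span (?d ` F). \<forall>b\<in>?d ` F. 2 * inner a b / (norm b)\<^sup>2 \<in> ?K}"
    by (auto simp: subsystem_def)
qed

lemma subsystem_closed:
  assumes "\<beta> \<in> subsystem F" "\<beta>' \<in> subsystem F" "\<beta> + \<beta>' \<in> aff_roots \<phi> N T"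
  shows "\<beta> + \<beta>' \<in> subsystem F"
  using assms representable_add[OF aff_root_representable aff_root_representable]
  by (auto simp: subsystem_def intro: span_add)

lemma subsystem_uminus:
  assumes "\<beta> \<in> subsystem F \<inter> compact_roots \<phi> N T" shows "- \<beta> \<in> subsystem F"
  using assms compact_root_uminus[of \<beta>] representable_uminus[OF compact_dual_vector(1)[of \<beta>]]
  by (auto simp: subsystem_def compact_root_iff intro: span_neg)

lemma subsystem_gap:
  assumes F: "finite F" "F \<subseteq> compact_roots \<phi> N T"
  obtains \<epsilon> where "\<epsilon> > 0" "\<And>\<beta>. \<beta> \<in> subsystem F \<Longrightarrow> root_height N T \<nu>' \<beta> < 0 \<Longrightarrow> root_height N T \<nu>' \<beta> \<le> - \<epsilon>"
proof -
  let ?P = "real_functional \<nu>' ` (\<lambda>\<beta>. dual_vector (fst \<beta>)) ` subsystem F"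
  obtain \<epsilon> where e: "\<epsilon> > 0" "\<And>p n. p \<in> ?P \<Longrightarrow> of_int n / real N + p < 0 \<Longrightarrow> of_int n / real N + p \<le> - \<epsilon>"
    using negative_values_discrete[OF finite_imageI[OF subsystem_finite[OF F]] N_pos] by metis
  have "root_height N T \<nu>' \<beta> \<le> - \<epsilon>" if "\<beta> \<in> subsystem F" "root_height N T \<nu>' \<beta> < 0" for \<beta>
  proof -
    have "representable (fst \<beta>)" using that aff_root_representable by (simp add: subsystem_def)
    then have "root_height N T \<nu>' \<beta> = of_int (snd \<beta>) / real N + real_functional \<nu>' (dual_vector (fst \<beta>))"
      by (simp add: root_height_def pairing_eq)
    then show ?thesis using e(2)[of "real_functional \<nu>' (dual_vector (fst \<beta>))" "snd \<beta>"] that by auto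
  qed
  with e that show ?thesis by blast
qed

text \<open>Along the reflections in \<open>\<beta> + j \<delta>\<close> the energy of the reflected weight is a quadratic polynomial in
  \<open>j\<close> whose leading coefficient is a positive multiple of the level.\<close>

lemma level_positive:
  assumes b: "\<beta> \<in> subsystem F \<inter> compact_roots \<phi> N T"
    and bdd: "\<And>\<gamma> r. (\<gamma>, r) \<in> M.orbit (subsystem F \<inter> compact_roots \<phi> N T) \<Longrightarrow> m \<le> r"
  shows "Re (\<Lambda> c_elt) > 0"
proof -
  have cb: "\<beta> \<in> compact_roots \<phi> N T" using b by blast
  note r = compact_dual_vector[OF cb]
  let ?k = "2 * Re (\<Lambda> c_elt) / (norm (dual_vector (fst \<beta>)))\<^sup>2"
  have "?k > 0"
  proof (rule quadratic_bounded_below)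
    show "?k \<noteq> 0" using level_real(2) r(2) by simp
    fix j :: int
    have "shift j \<beta> \<in> subsystem F \<inter> compact_roots \<phi> N T"
      using b compact_root_shift[OF cb, of j] by (auto simp: subsystem_def compact_root_iff)
    from bdd[OF reflection_orbit.orbit_step[OF reflection_orbit.orbit_base this]]
    show "m \<le> - ((Re (\<Lambda> (coroot N T \<nu> \<beta>)) - of_int j * ?k) * (root_height N T \<nu>' \<beta> + of_int j))"
      unfolding coroot_shift[OF r(1) Lambda] root_height_shift by (simp add: mult.commute mult.left_commute)
  qed
  then show ?thesis using r(2) by (simp add: zero_less_divide_iff zero_less_mult_iff)
qed

text \<open>At positive level \<open>\<Lambda>\<close> is positive at the coroots of \<open>\<beta> - J \<delta>\<close> and of \<open>- \<beta> - J \<delta>\<close> for large \<open>J\<close>, so subtracting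
  these roots from \<open>\<Lambda>\<close> gives weights, and both roots lie in the cone \<open>Q\<close>. Their sum is \<open>- 2 J \<delta>\<close>. If
  adding a root of the form \<open>(0, n)\<close> with \<open>n < 0\<close> led to a weight, a positive multiple of \<open>\<delta>\<close> would lie in
  \<open>Q\<close> as well, contradicting pointedness.\<close>

lemma imaginary_not_weight:
  assumes lev: "Re (\<Lambda> c_elt) > 0" and b: "\<beta> \<in> compact_roots \<phi> N T"
    and d: "\<delta> \<in> aff_roots \<phi> N T - compact_roots \<phi> N T" and neg: "root_height N T \<nu>' \<delta> < 0"
  shows "\<Lambda> + root_functional N T \<nu> \<delta> \<notin> M.weights"
proof
  assume w: "\<Lambda> + root_functional N T \<nu> \<delta> \<in> M.weights"
  obtain Q where Q: "0 \<in> Q" "\<And>a b. a \<in> Q \<Longrightarrow> b \<in> Q \<Longrightarrow> a + b \<in> Q" "\<And>a. a \<in> Q \<Longrightarrow> - a \<in> Q \<Longrightarrow> a = 0"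
    "\<And>\<gamma>. \<gamma> \<in> M.weights \<Longrightarrow> \<Lambda> - \<gamma> \<in> Q" by (rule positive_cone) blast
  have Qmult: "of_nat k *\<^sub>R a \<in> Q" if "a \<in> Q" for k a
  proof (induction k)
    case 0
    show ?case unfolding of_nat_0 scaleR_zero_left by (rule Q(1))
  next
    case (Suc k)
    show ?case unfolding of_nat_Suc scaleR_add_left scaleR_one by (rule Q(2)[OF that Suc])
  qed
  have low: "\<exists>J0::nat. \<forall>J\<ge>J0. root_functional N T \<nu> \<beta> - of_int (int J) *\<^sub>R null_root \<in> Q"
    if b: "\<beta> \<in> compact_roots \<phi> N T" for \<beta>
  proof -
    note r = compact_dual_vector[OF b]
    let ?k = "2 * Re (\<Lambda> c_elt) / (norm (dual_vector (fst \<beta>)))\<^sup>2"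
    have k: "?k > 0" using lev r(2) by simp
    obtain J0 :: nat where J0: "real J0 > - Re (\<Lambda> (coroot N T \<nu> \<beta>)) / ?k" using reals_Archimedean2 by blast
    have "root_functional N T \<nu> \<beta> - of_int (int J) *\<^sub>R null_root \<in> Q" if "J \<ge> J0" for J
    proof -
      have "real J > - Re (\<Lambda> (coroot N T \<nu> \<beta>)) / ?k" using J0 that by linarith
      then have "Re (\<Lambda> (coroot N T \<nu> \<beta>)) + real J * ?k > 0"
        unfolding pos_divide_less_eq[OF k] by linarith
      then have "Re (\<Lambda> (coroot N T \<nu> (shift (- int J) \<beta>))) > 0"
        unfolding coroot_shift[OF r(1) Lambda] by (simp add: mult.commute mult.left_commute)
      from Q(4)[OF M.weight_step_down[OF compact_root_shift[OF b] this]]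
      have "\<Lambda> - (\<Lambda> - root_functional N T \<nu> (shift (- int J) \<beta>)) \<in> Q" .
      moreover have "\<Lambda> - (\<Lambda> - root_functional N T \<nu> (shift (- int J) \<beta>))
          = root_functional N T \<nu> \<beta> - of_int (int J) *\<^sub>R null_root"
        unfolding root_functional_shift by (rule ext) (simp add: scaleR_fun_def)
      ultimately show ?thesis by (simp only:)
    qed
    then show ?thesis by blast
  qed
  obtain J1 J2 where J: "\<And>J. J \<ge> J1 \<Longrightarrow> root_functional N T \<nu> \<beta> - of_int (int J) *\<^sub>R null_root \<in> Q"
    "\<And>J. J \<ge> J2 \<Longrightarrow> root_functional N T \<nu> (- \<beta>) - of_int (int J) *\<^sub>R null_root \<in> Q"
    using low[OF b] low[OF compact_root_uminus[OF b]] by blast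
  define J where "J = J1 + J2 + 1"
  have "(root_functional N T \<nu> \<beta> - of_int (int J) *\<^sub>R null_root)
      + (root_functional N T \<nu> (- \<beta>) - of_int (int J) *\<^sub>R null_root) \<in> Q"
    using J(1)[of J] J(2)[of J] by (intro Q(2)) (auto simp: J_def)
  moreover have "(root_functional N T \<nu> \<beta> - of_int (int J) *\<^sub>R null_root)
      + (root_functional N T \<nu> (- \<beta>) - of_int (int J) *\<^sub>R null_root) = (- 2 * real J) *\<^sub>R null_root"
    unfolding root_functional_uminus[OF nu compact_dual_vector(1)[OF b]]
    by (rule ext) (simp add: scaleR_fun_def scaleR_conv_of_real)
  ultimately have q1: "(- 2 * real J) *\<^sub>R null_root \<in> Q" by (simp only:)
  have d0: "fst \<delta> = 0" using d by (auto simp: compact_root_iff)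
  have h: "root_height N T \<nu>'' \<delta> = of_int (snd \<delta>) / real N" if "\<nu>'' \<in> im_dual T" for \<nu>''
    by (simp add: root_height_def d0 pairing_zero[OF that])
  have n: "snd \<delta> < 0" using neg N_pos unfolding h[OF nu'] by (simp add: divide_less_0_iff)
  have rd: "root_functional N T \<nu> \<delta> = (of_int (snd \<delta>) / real N) *\<^sub>R null_root"
    unfolding root_functional_def h[OF nu] d0 by (auto simp: fun_eq_iff null_root_def scaleR_fun_def scaleR_conv_of_real)
  have "\<Lambda> - (\<Lambda> + root_functional N T \<nu> \<delta>) \<in> Q" by (rule Q(4)[OF w])
  moreover have "\<Lambda> - (\<Lambda> + root_functional N T \<nu> \<delta>) = (- of_int (snd \<delta>) / real N) *\<^sub>R null_root"
    unfolding rd by (rule ext) (simp add: scaleR_fun_def)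
  ultimately have q2: "(- of_int (snd \<delta>) / real N) *\<^sub>R null_root \<in> Q" by (simp only:)
  (* a common multiple, up to sign, of the two elements of Q just found *)
  define a where "a = (2 * real J * of_int (snd \<delta>)) *\<^sub>R null_root"
  have "a = of_nat (nat (- snd \<delta>)) *\<^sub>R (- 2 * real J) *\<^sub>R null_root" using n by (simp add: a_def)
  then have "a \<in> Q" using Qmult[OF q1] by (simp only:)
  moreover have "- a = of_nat (2 * J * N) *\<^sub>R (- of_int (snd \<delta>) / real N) *\<^sub>R null_root"
    using N_pos by (simp add: a_def)
  then have "- a \<in> Q" using Qmult[OF q2] by (simp only:)
  ultimately have "a = 0" using Q(3) by blast
  then have "a ((0, 0, 1), (0, 0, 0)) = 0" by simp
  then show False using n T_zero by (simp add: a_def scaleR_fun_def null_root_def J_def complex_eq_iff)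
qed

lemma orbit_in_spectrum:
  assumes "(\<gamma>, r) \<in> M.orbit (compact_roots \<phi> N T)"
  shows "r \<in> energy_spectrum sc D"
proof -
  have "aff_roots \<phi> N T \<inter> compact_roots \<phi> N T = compact_roots \<phi> N T" by (auto simp: compact_root_iff)
  then have "(\<gamma>, r) \<in> M.orbit (aff_roots \<phi> N T \<inter> compact_roots \<phi> N T)" using assms by (simp only:)
  then have "\<exists>u\<in>M.weight_vectors \<gamma>. u \<noteq> 0 \<and> D u = sc (\<i> * of_real r) u
      \<and> (\<forall>W. M.stable (aff_roots \<phi> N T) W \<longrightarrow> u \<in> W \<longrightarrow> v\<Lambda> \<in> W)"
    by (rule M.extremal_vector[OF _ Lambda_extreme]) (rule aff_root_uminus[OF IntD1])
  then obtain u where "u \<noteq> 0" "D u = sc (\<i> * of_real r) u" by (elim bexE conjE)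
  then show ?thesis unfolding energy_spectrum_def by (intro CollectI exI[of _ u]) simp
qed

text \<open>A monomial without factors has energy \<open>0\<close>, the orbit energy of \<open>\<Lambda>\<close> itself. Any other one contains a
  compact root, which is what fixes the sign of the level.\<close>

lemma spectrum_bound:
  assumes bdd: "\<And>\<gamma> r. (\<gamma>, r) \<in> M.orbit (compact_roots \<phi> N T) \<Longrightarrow> m \<le> r"
    and E: "E \<in> energy_spectrum sc D"
  shows "m \<le> E"
proof -
  obtain v where v: "v \<noteq> 0" "sc (- \<i>) (D v) = sc (of_real E) v" using E by (auto simp: energy_spectrum_def)
  have "sc \<i> (sc (- \<i>) (D v)) = sc \<i> (sc (of_real E) v)" using v(2) by simp
  then have "D v = sc (\<i> * of_real E) v" by simp
  from M.spectrum_monomial[OF v(1) this] obtain w \<gamma> F where F: "F \<subseteq> compact_roots \<phi> N T" "finite F"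
    and w: "M.monomial F v\<Lambda> \<Lambda> 0 w \<gamma> E" "w \<noteq> 0" by blast
  show ?thesis
  proof (cases "F = {}")
    case True
    have "E = 0" using w(1) unfolding True by cases auto
    then show ?thesis using bdd[OF reflection_orbit.orbit_base] by simp
  next
    case False
    then obtain \<beta> where b: "\<beta> \<in> F" by blast
    let ?S = "subsystem F"
    let ?C = "?S \<inter> compact_roots \<phi> N T"
    have FS: "F \<subseteq> ?C" using F by (auto simp: subsystem_def compact_root_iff intro: span_base)
    have bd: "m \<le> r" if "(\<gamma>, r) \<in> M.orbit ?C" for \<gamma> r
      using bdd reflection_orbit_mono[OF _ that, of "compact_roots \<phi> N T"] by blast
    obtain \<epsilon> where e: "\<epsilon> > 0" "\<And>\<beta>. \<beta> \<in> ?S \<Longrightarrow> root_height N T \<nu>' \<beta> < 0 \<Longrightarrow> root_height N T \<nu>' \<beta> \<le> - \<epsilon>"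
      using subsystem_gap[OF F(2,1)] by blast
    have bC: "\<beta> \<in> ?C" using b FS by blast
    have lev: "Re (\<Lambda> c_elt) > 0" by (rule level_positive[OF bC bd])
    have bc: "\<beta> \<in> compact_roots \<phi> N T" using bC by blast
    have SR: "?S \<subseteq> aff_roots \<phi> N T" by (auto simp: subsystem_def)
    show ?thesis
    proof (rule M.orbit_energy_bound[OF SR _ _ e(1) _ Lambda_extreme _ _ M.monomial_mono[OF w(1) FS] w(2)])
      show "\<And>\<beta> \<beta>'. \<beta> \<in> ?S \<Longrightarrow> \<beta>' \<in> ?S \<Longrightarrow> \<beta> + \<beta>' \<in> aff_roots \<phi> N T \<Longrightarrow> \<beta> + \<beta>' \<in> ?S"
        by (rule subsystem_closed)
      show "\<And>\<beta>. \<beta> \<in> ?C \<Longrightarrow> - \<beta> \<in> ?S" by (rule subsystem_uminus)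
      show "\<And>\<beta>. \<beta> \<in> ?S \<Longrightarrow> root_height N T \<nu>' \<beta> < 0 \<Longrightarrow> root_height N T \<nu>' \<beta> \<le> - \<epsilon>" by (rule e(2))
      show "\<And>\<beta>. \<beta> \<in> ?S - compact_roots \<phi> N T \<Longrightarrow> root_height N T \<nu>' \<beta> < 0 \<Longrightarrow> \<Lambda> + root_functional N T \<nu> \<beta> \<notin> M.weights"
        using imaginary_not_weight[OF lev bc] SR by blast
      show "\<And>\<gamma> r. (\<gamma>, r) \<in> M.orbit ?C \<Longrightarrow> m \<le> r" by (rule bd)
    qed
  qed
qed

end

section \<open>The Weyl orbit of the standard affinisation\<close>

text \<open>\<open>R\<close> relates roots on two sides. The induction carries along the equality of the values of
  corresponding weights at corresponding coroots; the weights themselves need not agree.\<close>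

lemma reflection_orbit_transport:
  assumes "(\<gamma>, r) \<in> reflection_orbit rt co en \<Lambda> B"
    and total: "\<And>\<beta>. \<beta> \<in> B \<Longrightarrow> \<exists>\<beta>'\<in>B'. R \<beta> \<beta>'"
    and base: "\<And>\<beta> \<beta>'. R \<beta> \<beta>' \<Longrightarrow> \<Lambda> (co \<beta>) = \<Lambda>' (co' \<beta>')"
    and cartan: "\<And>\<alpha> \<alpha>' \<beta> \<beta>'. R \<alpha> \<alpha>' \<Longrightarrow> R \<beta> \<beta>' \<Longrightarrow> rt \<alpha> (co \<beta>) = rt' \<alpha>' (co' \<beta>')"
    and energy: "\<And>\<beta> \<beta>'. R \<beta> \<beta>' \<Longrightarrow> en \<beta> = en' \<beta>'"
  shows "\<exists>\<gamma>'. (\<gamma>', r) \<in> reflection_orbit rt' co' en' \<Lambda>' B' \<and> (\<forall>\<beta> \<beta>'. R \<beta> \<beta>' \<longrightarrow> \<gamma> (co \<beta>) = \<gamma>' (co' \<beta>'))"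
  using assms(1)
proof induction
  case orbit_base
  show ?case using base reflection_orbit.orbit_base by blast
next
  case (orbit_step \<gamma> r \<beta>)
  then obtain \<gamma>' where g: "(\<gamma>', r) \<in> reflection_orbit rt' co' en' \<Lambda>' B'"
    and e: "\<And>\<beta> \<beta>'. R \<beta> \<beta>' \<Longrightarrow> \<gamma> (co \<beta>) = \<gamma>' (co' \<beta>')" by blast
  obtain \<beta>' where b: "\<beta>' \<in> B'" "R \<beta> \<beta>'" using total[OF orbit_step(2)] by blast
  have "(\<lambda>h. \<gamma>' h - \<gamma>' (co' \<beta>') * rt' \<beta>' h, r - Re (\<gamma> (co \<beta>)) * en \<beta>) \<in> reflection_orbit rt' co' en' \<Lambda>' B'"
    using reflection_orbit.orbit_step[OF g b(1)] by (simp add: e[OF b(2)] energy[OF b(2)])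
  moreover have "\<gamma> (co \<alpha>) - \<gamma> (co \<beta>) * rt \<beta> (co \<alpha>) = \<gamma>' (co' \<alpha>') - \<gamma>' (co' \<beta>') * rt' \<beta>' (co' \<alpha>')"
    if "R \<alpha> \<alpha>'" for \<alpha> \<alpha>'
    using e[OF that] e[OF b(2)] cartan[OF b(2) that] by simp
  ultimately show ?case by blast
qed

lemma module_int: "module (\<lambda>n::int. scaleR (of_int n) :: 'a::real_vector \<Rightarrow> 'a)"
  by unfold_locales (simp_all add: scaleR_add_right scaleR_add_left)

interpretation Z: module "\<lambda>n::int. scaleR (of_int n) :: 'a::real_vector \<Rightarrow> 'a"
  by (rule module_int)

lemma cscale_mem:
  assumes "subspace T" "v \<in> T \<times> T" shows "cscale c v \<in> T \<times> T"
  using assms by (auto simp: cscale_def subspace_add subspace_diff subspace_scale)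

lemma cdual_diff_cscale:
  assumes T: "subspace T" and f: "f \<in> cdual T" and u: "u \<in> T \<times> T" and v: "v \<in> T \<times> T"
  shows "f (u - cscale x v) = f u - x * f v"
proof -
  have "u - cscale x v = u + cscale (- x) v" by (simp only: CS.scale_minus_left diff_conv_add_uminus)
  then show ?thesis using cdualD(2)[OF f u cscale_mem[OF T v]] cdualD(3)[OF f v] by (simp only:) simp
qed

lemma cdual_diff_scale:
  assumes T: "subspace T" and f: "f \<in> cdual T" and g: "g \<in> cdual T"
  shows "(\<lambda>h. f h - c * g h) \<in> cdual T"
proof -
  have "(\<lambda>h. f h - c * g h) = f + (\<lambda>h. (- c) * g h)" by (rule ext) simp
  then show ?thesis using cdual_add[OF T f cdual_scale[OF g]] by (simp only:)
qed

context fixed_cartan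
begin

lemma root_functional_cdual:
  assumes b: "\<beta> \<in> aff_roots \<phi> N T" shows "root_functional N T \<nu> \<beta> \<in> cdual (ext_cartan T)"
proof -
  note a = im_dual_cdual[OF aff_root_im_dual[OF b]]
  have add: "fst \<beta> (h1 + k1, h2 + k2) = fst \<beta> (h1, h2) + fst \<beta> (k1, k2)"
    if "h1 \<in> T" "h2 \<in> T" "k1 \<in> T" "k2 \<in> T" for h1 h2 k1 k2
    using cdualD(2)[OF a, of "(h1, h2)" "(k1, k2)"] that by simp
  have sc: "fst \<beta> (Re c *\<^sub>R h1 - Im c *\<^sub>R h2, Re c *\<^sub>R h2 + Im c *\<^sub>R h1) = c * fst \<beta> (h1, h2)"
    if "h1 \<in> T" "h2 \<in> T" for h1 h2 c
    using cdualD(3)[OF a, of "(h1, h2)" c] that by (simp add: cscale_def)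
  have T: "h + k \<in> T" "h - k \<in> T" "c *\<^sub>R h \<in> T" if "h \<in> T" "k \<in> T" for h k c
    using that T_subspace by (simp_all add: subspace_add subspace_diff subspace_scale)
  show ?thesis
    unfolding cdual_def
  proof (intro CollectI conjI allI impI ballI)
    fix v assume "v \<notin> ext_cartan T \<times> ext_cartan T"
    then show "root_functional N T \<nu> \<beta> v = 0" by (rule root_functional_outside)
  next
    fix u v assume "u \<in> ext_cartan T \<times> ext_cartan T" "v \<in> ext_cartan T \<times> ext_cartan T"
    then show "root_functional N T \<nu> \<beta> (u + v) = root_functional N T \<nu> \<beta> u + root_functional N T \<nu> \<beta> v"
      by (cases u; cases v) (auto simp: ext_cartan_def root_functional_def add T complex_eq_iff algebra_simps)
  next
    fix c v assume "v \<in> ext_cartan T \<times> ext_cartan T"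
    then obtain z1 h1 t1 z2 h2 t2 where v: "v = ((z1, h1, t1), (z2, h2, t2))" "h1 \<in> T" "h2 \<in> T"
      by (auto simp: ext_cartan_def)
    have "Complex (Re c * t1 - Im c * t2) (Re c * t2 + Im c * t1) = c * Complex t1 t2"
      by (simp add: complex_eq_iff)
    then show "root_functional N T \<nu> \<beta> (cscale c v) = c * root_functional N T \<nu> \<beta> v"
      using v(2,3) by (simp add: v(1) root_functional_def cscale_def sc T subspace_add[OF T_subspace] distrib_left)
  qed
qed

lemma reflection_involution:
  assumes b: "\<beta> \<in> compact_roots \<phi> N T"
  shows "reflection N T \<nu> \<beta> (reflection N T \<nu> \<beta> v) = v"
proof (cases "v \<in> ext_cartan T \<times> ext_cartan T")
  case True
  have r: "\<beta> \<in> aff_roots \<phi> N T" "representable (fst \<beta>)" "fst \<beta> \<noteq> 0"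
    using b aff_root_representable by (auto simp: compact_root_iff)
  let ?f = "root_functional N T \<nu> \<beta>" and ?c = "coroot N T \<nu> \<beta>"
  have two: "?f ?c = 2"
    unfolding root_functional_coroot[OF r(2) r(2)] using dual_vector_nonzero[OF r(2,3)] by (simp add: dot_square_norm)
  have c: "?c \<in> ext_cartan T \<times> ext_cartan T" by (rule coroot_ext_cartan[OF r(2)])
  have "?f (v - cscale (?f v) ?c) = ?f v - ?f v * ?f ?c"
    by (rule cdual_diff_cscale[OF ext_cartan_subspace root_functional_cdual[OF r(1)] True c])
  also have "\<dots> = - ?f v" by (simp add: two)
  finally have "?f (v - cscale (?f v) ?c) = - ?f v" .
  then show ?thesis by (simp add: reflection_def)
next
  case False
  then show ?thesis using root_functional_outside[OF False] by (simp add: reflection_def)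
qed

lemma weyl_bij: "w \<in> weyl_group \<phi> N T \<nu> \<Longrightarrow> bij w"
proof (induction rule: weyl_group.induct)
  case weyl_id
  show ?case by (rule bij_id)
next
  case (weyl_step w \<beta>)
  have "bij (reflection N T \<nu> \<beta>)" by (rule o_bij[of "reflection N T \<nu> \<beta>"]) (auto simp: reflection_involution[OF weyl_step(2)])
  with weyl_step show ?case by (intro bij_comp) auto
qed

lemma dual_action_reflection:
  assumes b: "\<beta> \<in> compact_roots \<phi> N T" and w: "bij w" and g: "dual_action w \<Lambda> \<in> cdual (ext_cartan T)"
  shows "dual_action (reflection N T \<nu> \<beta> \<circ> w) \<Lambda>
    = (\<lambda>h. dual_action w \<Lambda> h - dual_action w \<Lambda> (coroot N T \<nu> \<beta>) * root_functional N T \<nu> \<beta> h)"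
proof
  fix h
  have r: "representable (fst \<beta>)" using b aff_root_representable by (auto simp: compact_root_iff)
  let ?r = "reflection N T \<nu> \<beta>" and ?g = "dual_action w \<Lambda>"
  have "bij ?r" by (rule o_bij[of ?r]) (auto simp: reflection_involution[OF b])
  then have "inv (?r \<circ> w) = inv w \<circ> inv ?r" using w by (rule o_inv_distrib)
  moreover have "inv ?r = ?r" by (rule inv_equality) (rule reflection_involution[OF b])+
  ultimately have e: "dual_action (?r \<circ> w) \<Lambda> h = ?g (?r h)" by (simp add: dual_action_def)
  show "dual_action (?r \<circ> w) \<Lambda> h = ?g h - ?g (coroot N T \<nu> \<beta>) * root_functional N T \<nu> \<beta> h"
  proof (cases "h \<in> ext_cartan T \<times> ext_cartan T")
    case True
    have c: "coroot N T \<nu> \<beta> \<in> ext_cartan T \<times> ext_cartan T" by (rule coroot_ext_cartan[OF r])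
    show ?thesis unfolding e reflection_def cdual_diff_cscale[OF ext_cartan_subspace g True c] by simp
  next
    case False
    then have "?r h = h" by (simp add: reflection_def root_functional_outside)
    then show ?thesis unfolding e using False by (simp add: root_functional_outside)
  qed
qed

context
  fixes \<kappa> :: "'k \<times> 'k \<Rightarrow> complex" and chi and \<Lambda>' :: "'k cartan \<times> 'k cartan \<Rightarrow> complex"
  assumes chi: "energy_character \<phi> N T \<kappa> chi" and L': "\<Lambda>' \<in> cdual (ext_cartan T)"
begin

abbreviation "weight_orbit \<equiv> reflection_orbit (root_functional N T 0) (coroot N T 0) (root_height N T \<kappa>) \<Lambda>'
    (compact_roots \<phi> N T)"

abbreviation "lattice \<equiv> root_lattice \<phi> N T 0"

lemma lattice_closed: "0 \<in> lattice" "a \<in> lattice \<Longrightarrow> b \<in> lattice \<Longrightarrow> a + b \<in> lattice"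
  "a \<in> lattice \<Longrightarrow> b \<in> lattice \<Longrightarrow> a - b \<in> lattice"
  "a \<in> lattice \<Longrightarrow> of_int k *\<^sub>R a \<in> lattice"
  "\<beta> \<in> aff_roots \<phi> N T \<Longrightarrow> root_functional N T 0 \<beta> \<in> lattice"
  unfolding root_lattice_def
  by (auto intro: Z.span_zero Z.span_add Z.span_diff Z.span_scale Z.span_base)

lemma chi_add: "a \<in> lattice \<Longrightarrow> b \<in> lattice \<Longrightarrow> chi (a + b) = chi a + chi b"
  using chi unfolding energy_character_def by blast

lemma chi_zero: "chi 0 = 0"
proof -
  have "chi 0 = chi 0 + chi 0" using chi_add[OF lattice_closed(1) lattice_closed(1)] by (simp only: add_0_left)
  then show ?thesis by (rule iffD1[OF add_cancel_right_right])
qed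

lemma chi_diff: "a \<in> lattice \<Longrightarrow> b \<in> lattice \<Longrightarrow> chi (a - b) = chi a - chi b"
  using chi_add[OF lattice_closed(3), of a b b] by simp

lemma chi_scale:
  assumes a: "a \<in> lattice" shows "chi (of_int k *\<^sub>R a) = of_int k * chi a"
proof -
  have n: "chi (of_int (int n) *\<^sub>R a) = of_int (int n) * chi a" for n
  proof (induction n)
    case 0
    show ?case unfolding of_nat_0 of_int_0 scaleR_zero_left mult_zero_left by (rule chi_zero)
  next
    case (Suc n)
    have "chi (of_int (int (Suc n)) *\<^sub>R a) = chi (a + of_int (int n) *\<^sub>R a)" by (simp add: scaleR_add_left)
    also have "\<dots> = chi a + chi (of_int (int n) *\<^sub>R a)" by (rule chi_add[OF a lattice_closed(4)[OF a]])
    also have "\<dots> = of_int (int (Suc n)) * chi a" unfolding Suc by (simp add: distrib_right)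
    finally show ?case .
  qed
  show ?thesis
  proof (cases k rule: int_cases2)
    case (nonneg m)
    show ?thesis unfolding nonneg by (rule n)
  next
    case (nonpos m)
    have "of_int k *\<^sub>R a = 0 - of_int (int m) *\<^sub>R a" by (simp add: nonpos)
    then show ?thesis using chi_diff[OF lattice_closed(1) lattice_closed(4)[OF a, of "int m"]] n[of m]
      by (simp add: nonpos chi_zero)
  qed
qed

lemma chi_root: "\<beta> \<in> aff_roots \<phi> N T \<Longrightarrow> chi (root_functional N T 0 \<beta>) = root_height N T \<kappa> \<beta>"
  using chi unfolding energy_character_def root_height_def by (cases \<beta>) simp

text \<open>\<open>r\<close> is the value of the character at \<open>\<gamma> - \<Lambda>'\<close>. Membership in the lattice is part of the invariant, as
  \<open>chi\<close> is additive only there, and linearity of \<open>\<gamma>\<close> is needed to let a reflection act on it.\<close>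

definition tracks :: "('k cartan \<times> 'k cartan \<Rightarrow> complex) \<Rightarrow> real \<Rightarrow> bool" where
  "tracks \<gamma> r \<longleftrightarrow> \<gamma> \<in> cdual (ext_cartan T) \<and> \<gamma> - \<Lambda>' \<in> lattice \<and> chi (\<gamma> - \<Lambda>') = r"

lemma tracks_step:
  assumes t: "tracks \<gamma> r" and b: "\<beta> \<in> compact_roots \<phi> N T" and i: "\<gamma> (coroot N T 0 \<beta>) \<in> \<int>"
  shows "tracks (\<lambda>h. \<gamma> h - \<gamma> (coroot N T 0 \<beta>) * root_functional N T 0 \<beta> h)
    (r - Re (\<gamma> (coroot N T 0 \<beta>)) * root_height N T \<kappa> \<beta>)"
proof -
  have rb: "\<beta> \<in> aff_roots \<phi> N T" using b by (simp add: compact_root_iff)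
  let ?f = "root_functional N T 0 \<beta>"
  obtain k where k: "\<gamma> (coroot N T 0 \<beta>) = of_int k" using i by (auto elim: Ints_cases)
  have e: "(\<lambda>h. \<gamma> h - \<gamma> (coroot N T 0 \<beta>) * ?f h) - \<Lambda>' = (\<gamma> - \<Lambda>') - of_int k *\<^sub>R ?f"
    by (rule ext) (simp add: k scaleR_fun_def scaleR_conv_of_real)
  have 1: "(\<lambda>h. \<gamma> h - \<gamma> (coroot N T 0 \<beta>) * ?f h) \<in> cdual (ext_cartan T)"
    by (rule cdual_diff_scale[OF ext_cartan_subspace _ root_functional_cdual[OF rb]]) (use t in \<open>simp add: tracks_def\<close>)
  have l: "\<gamma> - \<Lambda>' \<in> lattice" "of_int k *\<^sub>R ?f \<in> lattice"
    using t lattice_closed(4)[OF lattice_closed(5)[OF rb]] by (simp_all add: tracks_def)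
  have "chi ((\<gamma> - \<Lambda>') - of_int k *\<^sub>R ?f) = r - of_int k * root_height N T \<kappa> \<beta>"
    unfolding chi_diff[OF l] chi_scale[OF lattice_closed(5)[OF rb]] chi_root[OF rb] using t by (simp add: tracks_def)
  then show ?thesis unfolding tracks_def e using 1 lattice_closed(3)[OF l] by (simp add: k)
qed

text \<open>A Weyl group element acts on \<open>\<Lambda>'\<close> as a succession of reflections, each of which subtracts an integral
  multiple of a root, and \<open>chi\<close> adds up the energies of these multiples.\<close>

lemma weyl_orbit:
  assumes integral: "\<And>\<gamma> r \<beta>. (\<gamma>, r) \<in> weight_orbit \<Longrightarrow> \<beta> \<in> compact_roots \<phi> N T \<Longrightarrow> \<gamma> (coroot N T 0 \<beta>) \<in> \<int>"
  shows "(\<lambda>w. chi (dual_action w \<Lambda>' - \<Lambda>')) ` weyl_group \<phi> N T 0 = snd ` weight_orbit"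
proof -
  have base: "tracks \<Lambda>' 0" "dual_action id \<Lambda>' = \<Lambda>'"
    using L' lattice_closed(1) by (simp_all add: tracks_def chi_zero dual_action_def)
  have 1: "\<exists>r. (dual_action w \<Lambda>', r) \<in> weight_orbit \<and> tracks (dual_action w \<Lambda>') r" if "w \<in> weyl_group \<phi> N T 0" for w
    using that
  proof (induction rule: weyl_group.induct)
    case weyl_id
    show ?case unfolding base(2) using base(1) reflection_orbit.orbit_base by blast
  next
    case (weyl_step w \<beta>)
    then obtain r where r: "(dual_action w \<Lambda>', r) \<in> weight_orbit" "tracks (dual_action w \<Lambda>') r" by blast
    have "dual_action w \<Lambda>' \<in> cdual (ext_cartan T)" using r(2) by (simp add: tracks_def)
    note d = dual_action_reflection[OF weyl_step(2) weyl_bij[OF weyl_step(1)] this]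
    show ?case unfolding d
      using reflection_orbit.orbit_step[OF r(1) weyl_step(2)] tracks_step[OF r(2) weyl_step(2) integral[OF r(1) weyl_step(2)]]
      by blast
  qed
  have 2: "tracks \<gamma> r \<and> (\<exists>w\<in>weyl_group \<phi> N T 0. dual_action w \<Lambda>' = \<gamma>)" if "(\<gamma>, r) \<in> weight_orbit" for \<gamma> r
    using that
  proof induction
    case orbit_base
    show ?case using base weyl_group.weyl_id by blast
  next
    case (orbit_step \<gamma> r \<beta>)
    then obtain w where w: "w \<in> weyl_group \<phi> N T 0" "dual_action w \<Lambda>' = \<gamma>" and t: "tracks \<gamma> r" by blast
    have "dual_action w \<Lambda>' \<in> cdual (ext_cartan T)" using t w by (simp add: tracks_def)
    note d = dual_action_reflection[OF orbit_step(2) weyl_bij[OF w(1)] this, unfolded w(2)]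
    show ?case
      using tracks_step[OF t orbit_step(2) integral[OF orbit_step(1,2)]]
        weyl_group.weyl_step[OF w(1) orbit_step(2)] d by blast
  qed
  show ?thesis
  proof (intro equalityI subsetI)
    fix x assume "x \<in> (\<lambda>w. chi (dual_action w \<Lambda>' - \<Lambda>')) ` weyl_group \<phi> N T 0"
    then obtain w where w: "w \<in> weyl_group \<phi> N T 0" "x = chi (dual_action w \<Lambda>' - \<Lambda>')" by blast
    obtain r where r: "(dual_action w \<Lambda>', r) \<in> weight_orbit" "tracks (dual_action w \<Lambda>') r" using 1[OF w(1)] by blast
    have "x = r" using r(2) w(2) by (simp add: tracks_def)
    then show "x \<in> snd ` weight_orbit" using r(1) by force
  next
    fix x assume "x \<in> snd ` weight_orbit"
    then obtain \<gamma> where g: "(\<gamma>, x) \<in> weight_orbit" by auto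
    obtain w where w: "w \<in> weyl_group \<phi> N T 0" "dual_action w \<Lambda>' = \<gamma>" using 2[OF g] by blast
    have "x = chi (dual_action w \<Lambda>' - \<Lambda>')" using 2[OF g] w(2) by (simp add: tracks_def)
    then show "x \<in> (\<lambda>w. chi (dual_action w \<Lambda>' - \<Lambda>')) ` weyl_group \<phi> N T 0" using w(1) by (rule image_eqI)
  qed
qed

end

end

text \<open>The coroot of the untwisted root for the standard affinisation differs from that of the original root by
  the multiple \<open>2(\<mu> + \<nu>)(\<alpha>\<^sup>\<sharp>)/(\<alpha>,\<alpha>)\<close> of \<open>c\<close>, and the shift of the weight compensates exactly for
  this.\<close>

lemma shifted_weight_coroot:
  assumes F: "fixed_cartan \<phi> N T" and P: "fixed_cartan \<psi> N\<psi> T"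
    and mu: "\<mu> \<in> im_dual T" and nu: "\<nu> \<in> im_dual T" and L: "\<Lambda> \<in> im_dual (ext_cartan T)"
    and r: "fixed_cartan.representable T \<alpha>"
    and m: "of_int m = real N\<psi> * (of_int n / real N - pairing T \<mu> \<alpha>)"
  shows "\<Lambda> (coroot N T \<nu> (\<alpha>, n)) = shifted_weight T \<Lambda> (\<mu> + \<nu>) (coroot N\<psi> T 0 (\<alpha>, m))"
proof -
  interpret F: fixed_cartan \<phi> N T by (rule F)
  interpret P: fixed_cartan \<psi> N\<psi> T by (rule P)
  let ?H = "ext_cartan T \<times> ext_cartan T"
  let ?t = "F.dual_vector \<alpha>"
  let ?d = "(norm ?t)\<^sup>2"
  let ?s = "(2 / ?d) *\<^sub>R ?t"
  have h: "of_int m / real N\<psi> = of_int n / real N - pairing T \<mu> \<alpha>" using m P.N_pos by (simp add: field_simps)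
  have s: "?s \<in> T" by (rule subspace_scale[OF F.T_subspace F.representableD(2)[OF r]])
  have kap: "\<mu> + \<nu> \<in> im_dual T" by (rule im_dual_add[OF F.T_subspace mu nu])
  define x where "x = 2 * pairing T (\<mu> + \<nu>) \<alpha> / ?d"
  have "(\<mu> + \<nu>) (0, ?s) = of_real (real_functional (\<mu> + \<nu>) ?s)"
    by (rule im_dual_eval(1)[OF kap s F.T_subspace])
  also have "real_functional (\<mu> + \<nu>) ?s = 2 / ?d * pairing T (\<mu> + \<nu>) \<alpha>"
    using real_functional_linear(2)[OF kap F.representableD(2)[OF r] F.T_zero F.T_subspace] F.pairing_eq[OF r] by simp
  finally have ev: "(\<mu> + \<nu>) (0, ?s) = of_real x" by (simp add: x_def)
  have ps: "pairing T (\<mu> + \<nu>) \<alpha> = pairing T \<mu> \<alpha> + pairing T \<nu> \<alpha>" by (simp add: pairing_def)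
  have p0: "pairing T 0 \<alpha> = 0" by (simp add: pairing_def)
  have r1: "F.representable (fst (\<alpha>, n))" and r2: "F.representable (fst (\<alpha>, m))" using r by simp_all
  have c1: "coroot N T \<nu> (\<alpha>, n) = ((0, 0, 0), (- 2 * (of_int n / real N + pairing T \<nu> \<alpha>) / ?d, ?s, 0))"
    unfolding F.coroot_eq[OF r1] by (simp add: root_height_def)
  have c2: "coroot N\<psi> T 0 (\<alpha>, m) = ((0, 0, 0), (- 2 * (of_int n / real N - pairing T \<mu> \<alpha>) / ?d, ?s, 0))"
    unfolding P.coroot_eq[OF r2] by (simp add: root_height_def p0 h)
  have "coroot N\<psi> T 0 (\<alpha>, m) = coroot N T \<nu> (\<alpha>, n) + cscale (of_real x) c_elt"
    unfolding c1 c2 by (simp add: cscale_def c_elt_def x_def ps diff_divide_distrib add_divide_distrib algebra_simps)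
  moreover have H: "coroot N T \<nu> (\<alpha>, n) \<in> ?H" by (rule F.coroot_ext_cartan[OF r1])
  moreover have c: "c_elt \<in> ?H" using F.T_zero by (simp add: c_elt_def ext_cartan_def)
  moreover have "cscale (of_real x) c_elt \<in> ?H" by (rule cscale_mem[OF F.ext_cartan_subspace c])
  ultimately have "\<Lambda> (coroot N\<psi> T 0 (\<alpha>, m)) = \<Lambda> (coroot N T \<nu> (\<alpha>, n)) + of_real x * \<Lambda> c_elt"
    using cdualD(2)[OF im_dual_cdual[OF L]] cdualD(3)[OF im_dual_cdual[OF L] c] by simp
  moreover have "extend_functional T (\<mu> + \<nu>) (coroot N\<psi> T 0 (\<alpha>, m)) = of_real x"
    unfolding c2 extend_functional_def case_prod_conv using s F.T_zero ev by simp
  ultimately show ?thesis by (simp add: shifted_weight_def)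
qed

lemma shifted_weight_cdual:
  assumes F: "fixed_cartan \<phi> N T" and k: "\<kappa> \<in> im_dual T" and L: "\<Lambda> \<in> im_dual (ext_cartan T)"
  shows "shifted_weight T \<Lambda> \<kappa> \<in> cdual (ext_cartan T)"
proof -
  interpret F: fixed_cartan \<phi> N T by (rule F)
  have add: "\<kappa> (h1 + k1, h2 + k2) = \<kappa> (h1, h2) + \<kappa> (k1, k2)"
    if "h1 \<in> T" "h2 \<in> T" "k1 \<in> T" "k2 \<in> T" for h1 h2 k1 k2
    using cdualD(2)[OF im_dual_cdual[OF k], of "(h1, h2)" "(k1, k2)"] that by simp
  have sc: "\<kappa> (Re c *\<^sub>R h1 - Im c *\<^sub>R h2, Re c *\<^sub>R h2 + Im c *\<^sub>R h1) = c * \<kappa> (h1, h2)"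
    if "h1 \<in> T" "h2 \<in> T" for h1 h2 c
    using cdualD(3)[OF im_dual_cdual[OF k], of "(h1, h2)" c] that by (simp add: cscale_def)
  have T: "h + k \<in> T" "h - k \<in> T" "c *\<^sub>R h \<in> T" if "h \<in> T" "k \<in> T" for h k c
    using that F.T_subspace by (simp_all add: subspace_add subspace_diff subspace_scale)
  have e: "extend_functional T \<kappa> \<in> cdual (ext_cartan T)"
    unfolding cdual_def
  proof (intro CollectI conjI allI impI ballI)
    fix v assume "v \<notin> ext_cartan T \<times> ext_cartan T"
    then show "extend_functional T \<kappa> v = 0"
      by (cases v) (auto simp: ext_cartan_def extend_functional_def split: if_splits)
  next
    fix u v assume "u \<in> ext_cartan T \<times> ext_cartan T" "v \<in> ext_cartan T \<times> ext_cartan T"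
    then show "extend_functional T \<kappa> (u + v) = extend_functional T \<kappa> u + extend_functional T \<kappa> v"
      by (cases u; cases v) (auto simp: ext_cartan_def extend_functional_def add T)
  next
    fix c v assume "v \<in> ext_cartan T \<times> ext_cartan T"
    then show "extend_functional T \<kappa> (cscale c v) = c * extend_functional T \<kappa> v"
      by (cases v) (auto simp: ext_cartan_def extend_functional_def cscale_def sc T)
  qed
  show ?thesis unfolding shifted_weight_def
    by (rule cdual_diff_scale[OF F.ext_cartan_subspace im_dual_cdual[OF L] e])
qed

section \<open>Positive energy\<close>

theorem theorem2:
  fixes \<phi> \<psi> :: "'k::hilbert_lie \<Rightarrow> 'k" and N N\<psi> :: nat
    and \<Phi> :: "real \<Rightarrow> 'k \<Rightarrow> 'k" and \<tt> T :: "'k set"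
    and \<mu> \<nu> \<nu>' :: "'k \<times> 'k \<Rightarrow> complex"
    and \<Lambda> :: "'k cartan \<times> 'k cartan \<Rightarrow> complex"
    and sc :: "complex \<Rightarrow> 'v::ab_group_add \<Rightarrow> 'v" and \<rho> :: "'k aff \<times> 'k aff \<Rightarrow> 'v \<Rightarrow> 'v"
    and v\<Lambda> :: 'v and D :: "'v \<Rightarrow> 'v"
    and chi :: "('k cartan \<times> 'k cartan \<Rightarrow> complex) \<Rightarrow> real" and M :: ereal
  assumes "simple_hilbert_lie TYPE('k)" and "infinite_dimensional TYPE('k)"
    and "hl_aut \<phi>" and "has_order \<phi> N" and "has_order \<psi> N\<psi>"
    and "untwisting_data TYPE('h::{real_inner,complete_space}) \<phi> N \<psi> N\<psi> \<Phi> \<tt> T \<mu>"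
    and "\<nu> \<in> im_dual T" and "\<nu>' \<in> im_dual T"
    and "integral_weight \<phi> N T \<nu> \<Lambda>" and "\<Lambda> c_elt \<noteq> 0"
    and "is_L \<phi> N T \<nu> \<Lambda> sc \<rho> v\<Lambda>"
    and "derivation_extension \<phi> N T \<nu> \<nu>' sc \<rho> v\<Lambda> D"
    and "energy_character \<psi> N\<psi> T (\<mu> + \<nu>') chi"
    and "M = orbit_infimum \<psi> N\<psi> T chi (shifted_weight T \<Lambda> (\<mu> + \<nu>))"
  shows "(positive_energy sc D \<longleftrightarrow> M > -\<infinity>) \<and>
         (M > -\<infinity> \<longrightarrow> ereal (minimal_energy sc D) = M)"
proof -
  note u = assms(6)[unfolded untwisting_data_def]
  have hpsi: "hl_aut \<psi>" using u by (elim conjE)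
  have maxphi: "maximal_abelian_in (fixed_points \<phi>) T" using u by (elim conjE)
  have maxpsi: "maximal_abelian_in (fixed_points \<psi>) T" using u by (elim conjE)
  have mu: "\<mu> \<in> im_dual T" using u by (elim conjE)
  have "aff_root_system_iso T (real_pairs (compact_roots \<phi> N T)) (real_pairs (compact_roots \<psi> N\<psi> T))
      (untwist_root N N\<psi> T \<mu>)" using u assms(7) by blast
  then have bij: "bij_betw (untwist_root N N\<psi> T \<mu>) (real_pairs (compact_roots \<phi> N T)) (real_pairs (compact_roots \<psi> N\<psi> T))"
    by (simp add: aff_root_system_iso_def)
  have L: "\<Lambda> \<in> im_dual (ext_cartan T)" using assms(9) by (simp add: integral_weight_def)
  interpret F: fixed_cartan \<phi> N T
    by unfold_locales (use assms maxphi in \<open>auto simp: has_order_def\<close>)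
  interpret P: fixed_cartan \<psi> N\<psi> T
    by unfold_locales (use assms maxpsi hpsi in \<open>auto simp: has_order_def\<close>)
  interpret S: energy_setting \<phi> N T \<nu> \<nu>' \<Lambda> sc \<rho> v\<Lambda> D
    by unfold_locales (use assms L in auto)
  let ?\<Lambda>' = "shifted_weight T \<Lambda> (\<mu> + \<nu>)"
  let ?C = "compact_roots \<phi> N T" and ?C' = "compact_roots \<psi> N\<psi> T"
  let ?O = "reflection_orbit (root_functional N T \<nu>) (coroot N T \<nu>) (root_height N T \<nu>') \<Lambda> ?C"
  let ?O' = "reflection_orbit (root_functional N\<psi> T 0) (coroot N\<psi> T 0) (root_height N\<psi> T (\<mu> + \<nu>')) ?\<Lambda>' ?C'"
  (* \<beta>' is the untwisted root of \<beta> *)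
  define R where "R \<beta> \<beta>' \<longleftrightarrow> \<beta> \<in> ?C \<and> \<beta>' \<in> ?C' \<and> fst \<beta> = fst \<beta>' \<and>
      of_int (snd \<beta>') = real N\<psi> * (of_int (snd \<beta>) / real N - pairing T \<mu> (fst \<beta>))" for \<beta> \<beta>'
  have R_I: "R \<beta> \<beta>'" if "\<beta> \<in> ?C" "\<beta>' \<in> ?C'"
    "untwist_root N N\<psi> T \<mu> (map_prod id real_of_int \<beta>) = map_prod id real_of_int \<beta>'" for \<beta> \<beta>'
    using that by (cases \<beta>; cases \<beta>') (simp add: R_def untwist_root_def)
  have total: "\<exists>\<beta>'\<in>?C'. R \<beta> \<beta>'" if b: "\<beta> \<in> ?C" for \<beta>
  proof -
    have "map_prod id real_of_int \<beta> \<in> real_pairs ?C" unfolding real_pairs_def using b by (rule imageI)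
    then have "untwist_root N N\<psi> T \<mu> (map_prod id real_of_int \<beta>) \<in> real_pairs ?C'"
      by (rule bij_betwE[OF bij, rule_format])
    then obtain \<beta>' where "untwist_root N N\<psi> T \<mu> (map_prod id real_of_int \<beta>) = map_prod id real_of_int \<beta>'" "\<beta>' \<in> ?C'"
      unfolding real_pairs_def by (rule imageE)
    then show ?thesis using R_I[OF b] by blast
  qed
  have surj: "\<exists>\<beta>\<in>?C. R \<beta> \<beta>'" if b: "\<beta>' \<in> ?C'" for \<beta>'
  proof -
    have "map_prod id real_of_int \<beta>' \<in> real_pairs ?C'" unfolding real_pairs_def using b by (rule imageI)
    then have "map_prod id real_of_int \<beta>' \<in> untwist_root N N\<psi> T \<mu> ` real_pairs ?C"
      by (simp only: bij_betw_imp_surj_on[OF bij])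
    then obtain x where x: "map_prod id real_of_int \<beta>' = untwist_root N N\<psi> T \<mu> x" "x \<in> real_pairs ?C"
      by (rule imageE)
    obtain \<beta> where \<beta>: "x = map_prod id real_of_int \<beta>" "\<beta> \<in> ?C"
      using x(2) unfolding real_pairs_def by (rule imageE)
    have "R \<beta> \<beta>'" by (rule R_I[OF \<beta>(2) b]) (simp only: x(1) \<beta>(1))
    then show ?thesis using \<beta>(2) by blast
  qed
  have rep: "F.representable (fst \<beta>)" if "\<beta> \<in> ?C" for \<beta>
    using that F.aff_root_representable by (simp add: F.compact_root_iff)
  have base: "\<Lambda> (coroot N T \<nu> \<beta>) = ?\<Lambda>' (coroot N\<psi> T 0 \<beta>')" if "R \<beta> \<beta>'" for \<beta> \<beta>'
    using shifted_weight_coroot[OF F.fixed_cartan_axioms P.fixed_cartan_axioms mu assms(7) L, of "fst \<beta>" "snd \<beta>'" "snd \<beta>"]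
      that rep[of \<beta>] unfolding R_def by (metis prod.collapse)
  have cartan: "root_functional N T \<nu> \<alpha> (coroot N T \<nu> \<beta>) = root_functional N\<psi> T 0 \<alpha>' (coroot N\<psi> T 0 \<beta>')"
    if "R \<alpha> \<alpha>'" "R \<beta> \<beta>'" for \<alpha> \<alpha>' \<beta> \<beta>'
    using F.root_functional_coroot[of \<beta> \<alpha>] P.root_functional_coroot[of \<beta>' \<alpha>'] rep[of \<alpha>] rep[of \<beta>] that
    unfolding R_def by simp
  have energy: "root_height N T \<nu>' \<beta> = root_height N\<psi> T (\<mu> + \<nu>') \<beta>'" if "R \<beta> \<beta>'" for \<beta> \<beta>'
    using that P.N_pos by (simp add: R_def root_height_def pairing_def)
  have to': "\<exists>\<gamma>'. (\<gamma>', r) \<in> ?O' \<and> (\<forall>\<beta> \<beta>'. R \<beta> \<beta>' \<longrightarrow> \<gamma> (coroot N T \<nu> \<beta>) = \<gamma>' (coroot N\<psi> T 0 \<beta>'))"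
    if "(\<gamma>, r) \<in> ?O" for \<gamma> r
    by (rule reflection_orbit_transport[OF that, where R = R]) (rule total base cartan energy, assumption+)+
  have from': "\<exists>\<gamma>. (\<gamma>, r) \<in> ?O \<and> (\<forall>\<beta>' \<beta>. R \<beta> \<beta>' \<longrightarrow> \<gamma>' (coroot N\<psi> T 0 \<beta>') = \<gamma> (coroot N T \<nu> \<beta>))"
    if "(\<gamma>', r) \<in> ?O'" for \<gamma>' r
    by (rule reflection_orbit_transport[OF that, where R = "\<lambda>\<beta>' \<beta>. R \<beta> \<beta>'"])
      (rule surj base[symmetric] cartan[symmetric] energy[symmetric], assumption+)+
  have snd_eq: "snd ` ?O' = snd ` ?O"
  proof (intro equalityI subsetI)
    fix r assume "r \<in> snd ` ?O'"
    then obtain \<gamma>' where "(\<gamma>', r) \<in> ?O'" by auto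
    then show "r \<in> snd ` ?O" using from' by force
  next
    fix r assume "r \<in> snd ` ?O"
    then obtain \<gamma> where "(\<gamma>, r) \<in> ?O" by auto
    then show "r \<in> snd ` ?O'" using to' by force
  qed
  have integral: "\<gamma>' (coroot N\<psi> T 0 \<beta>') \<in> \<int>" if g: "(\<gamma>', r) \<in> ?O'" and b: "\<beta>' \<in> ?C'" for \<gamma>' r \<beta>'
  proof -
    obtain \<beta> where "\<beta> \<in> ?C" "R \<beta> \<beta>'" using surj[OF b] by blast
    moreover obtain \<gamma> where "(\<gamma>, r) \<in> ?O" "\<And>\<beta>' \<beta>. R \<beta> \<beta>' \<Longrightarrow> \<gamma>' (coroot N\<psi> T 0 \<beta>') = \<gamma> (coroot N T \<nu> \<beta>)"
      using from'[OF g] by blast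
    ultimately show ?thesis using S.M.orbit_pairing_integral[OF _ order.refl S.Lambda_extreme] by simp
  qed
  have "\<mu> + \<nu> \<in> im_dual T" by (rule im_dual_add[OF F.T_subspace mu assms(7)])
  note cd = shifted_weight_cdual[OF F.fixed_cartan_axioms this L]
  have image: "(\<lambda>w. chi (dual_action w ?\<Lambda>' - ?\<Lambda>')) ` weyl_group \<psi> N\<psi> T 0 = snd ` ?O"
    unfolding snd_eq[symmetric] by (rule P.weyl_orbit[OF assms(13) cd]) (rule integral)
  have M: "M = (INF r\<in>snd ` ?O. ereal r)"
    unfolding assms(14) orbit_infimum_def image[symmetric] by (simp add: image_image)
  let ?E = "energy_spectrum sc D"
  have sub: "snd ` ?O \<subseteq> ?E" using S.orbit_in_spectrum by auto
  have ne: "0 \<in> snd ` ?O" using reflection_orbit.orbit_base by force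
  have bound: "m \<le> E" if "\<And>r. r \<in> snd ` ?O \<Longrightarrow> m \<le> r" "E \<in> ?E" for m E
    by (rule S.spectrum_bound[OF _ that(2)]) (use that(1) in force)
  have fin: "M \<noteq> \<infinity>" unfolding M using INF_lower[OF ne, of ereal] by auto
  show ?thesis
  proof (cases "bdd_below (snd ` ?O)")
    case True
    let ?m = "Inf (snd ` ?O)"
    have Mm: "M = ereal ?m"
      unfolding M using ereal_Inf'[OF True] ne by (metis empty_iff)
    have lower: "?m \<le> E" if "E \<in> ?E" for E
      by (rule bound[OF cInf_lower[OF _ True] that])
    then have "bdd_below ?E" by (rule bdd_belowI)
    moreover have "Inf ?E = ?m"
    proof (rule antisym)
      show "?m \<le> Inf ?E" by (rule cInf_greatest) (use sub ne lower in blast)+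
      show "Inf ?E \<le> ?m" by (rule cInf_superset_mono) (use sub ne \<open>bdd_below ?E\<close> in auto)
    qed
    ultimately show ?thesis by (simp add: positive_energy_def minimal_energy_def Mm)
  next
    case False
    then have "\<not> bdd_below ?E" by (rule contrapos_nn) (rule bdd_below_mono[OF _ sub])
    moreover have "M = -\<infinity>"
    proof (rule ccontr)
      assume "M \<noteq> -\<infinity>"
      then obtain m where m: "M = ereal m" using fin by (cases M) auto
      have "m \<le> r" if "r \<in> snd ` ?O" for r using INF_lower[OF that, of ereal] by (simp add: M[symmetric] m)
      then show False using False by (meson bdd_belowI)
    qed
    ultimately show ?thesis by (simp add: positive_energy_def)
  qed
qed

end
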